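(* Let $G$ be a finitely generated group of orientation-preserving $C^2$ circle diffeomorphisms. (1) If $G$ acts minimally and satisfies property $(\star)$, then the Lebesgue measure is the unique conformal measure which does not charge the orbit $G(\mathrm{NE})$ of the set $\mathrm{NE}=\mathrm{NE}(G)$ of non-expandable points. Moreover, all the other conformal measures (if any) are atomic and supported on $G(\mathrm{NE})$, and their conformal exponents are strictly greater than $1$. (2) If the action of $G$ carries an exceptional minimal set $\Lambda$ for which property $(\Lambda\star)$ holds, then there exists at most one conformal measure supported on $\Lambda$ and not charging the $G$-orbit of $\Lambda\cap\mathrm{NE}$. If such a measure exists, then its exponent belongs to the interval $(0,1)$. (3) In particular, in both the minimal case (1) and the exceptional minimal case (2), the non-atomic conformal measures supported on the minimal invariant set (the whole circle, respectively $\Lambda$) are ergodic.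
   Context: All measures are probability measures; the Lebesgue measure is normalized. A Riemannian metric on $S^1$ is fixed and $g'(x)>0$ is the derivative with respect to it. A measure $\mu$ on $S^1$ is conformal (with exponent $\delta$) for $G$ if $\mu(g(B))=\int_B(g'(x))^\delta\,d\mu(x)$ for every Borel set $B$ and every $g\in G$; "conformal measure" means conformal with some exponent $\delta$. A measure does not charge a set if the set has measure zero; it is supported on a set if the complement has measure zero. A $G$-quasi-invariant measure $\mu$ is ergodic if every measurable $G$-invariant set $A$ satisfies $\mu(A)=0$ or $\mu(S^1\setminus A)=0$. A point $x\in S^1$ is non-expandable if $g'(x)\le1$ for all $g\in G$; $\mathrm{NE}(G)$ is the set of such points. $G$ acts minimally if all orbits are dense. An exceptional minimal set is a nonempty closed $G$-invariant set, minimal for inclusion among such sets, homeomorphic to the Cantor set. Property $(\star)$: $G$ acts minimally, and for every $x\in\mathrm{NE}(G)$ there exist $g_+,g_-\in G$ with $g_+(x)=g_-(x)=x$ such that, for some $\varepsilon>0$, $g_+$ has no other fixed point in $(x,x+\varepsilon)$ and $g_-$ has no other fixed point in $(x-\varepsilon,x)$. Property $(\Lambda\star)$ (for an exceptional minimal set $\Lambda$): for every $x\in\Lambda\cap\mathrm{NE}(G)$ there exist $g_+,g_-\in G$ with the same property as in $(\star)$. *)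

theory Defs
  imports
    "HOL-Probability.Probability"
    "HOL-Algebra.Bij"
    "HOL-Algebra.Generated_Groups"
begin

text \<open>The circle is the unit circle of the complex plane, parametrised by \<^const>\<open>cis\<close>.\<close>

abbreviation S1 :: "complex set" where
  "S1 \<equiv> sphere 0 1"

primrec class_C :: "nat \<Rightarrow> (real \<Rightarrow> 'a::real_normed_vector) \<Rightarrow> bool" where
  "class_C 0 f \<longleftrightarrow> continuous_on UNIV f"
| "class_C (Suc k) f \<longleftrightarrow> (\<exists>f'. (\<forall>t. (f has_vector_derivative f' t) (at t)) \<and> class_C k f')"

definition C2_circle_map :: "(complex \<Rightarrow> complex) \<Rightarrow> bool" where
  "C2_circle_map g \<longleftrightarrow> g ` S1 \<subseteq> S1 \<and> class_C 2 (\<lambda>t. g (cis t))"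

definition orientation_preserving :: "(complex \<Rightarrow> complex) \<Rightarrow> bool" where
  "orientation_preserving g \<longleftrightarrow>
     (\<exists>F :: real \<Rightarrow> real. continuous_on UNIV F \<and> strict_mono F \<and> (\<forall>t. g (cis t) = cis (F t)))"

text \<open>Circle maps are normalised to be \<^const>\<open>undefined\<close> off \<^term>\<open>S1\<close>, so that they are
  elements of \<^term>\<open>BijGroup S1\<close>.\<close>

definition C2_diffeos :: "(complex \<Rightarrow> complex) set" where
  "C2_diffeos = {g \<in> Bij S1. C2_circle_map g \<and> C2_circle_map (inv_into S1 g)
                               \<and> orientation_preserving g}"

definition fg_C2_group :: "(complex \<Rightarrow> complex) set \<Rightarrow> bool" where
  "fg_C2_group G \<longleftrightarrow> subgroup G (BijGroup S1) \<and> G \<subseteq> C2_diffeos \<and>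
     (\<exists>A. finite A \<and> A \<subseteq> G \<and> G = generate (BijGroup S1) A)"

text \<open>Every Riemannian metric on the circle has the form \<open>\<rho>\<^sup>2 d\<theta>\<^sup>2\<close> for a smooth positive
  function \<open>\<rho>\<close>; it is represented by \<open>\<rho>\<close>, whose value at \<open>x\<close> is the length of the tangent
  vector \<open>d/d\<theta>\<close> at \<open>x\<close>.\<close>

definition riemannian_metric :: "(complex \<Rightarrow> real) \<Rightarrow> bool" where
  "riemannian_metric \<rho> \<longleftrightarrow> (\<forall>x\<in>S1. \<rho> x > 0) \<and> (\<forall>k. class_C k (\<lambda>t. \<rho> (cis t)))"

text \<open>The derivative of \<open>g\<close> with respect to the metric: the length of the image of \<open>d/d\<theta>\<close>
  at \<open>x\<close> divided by the length of \<open>d/d\<theta>\<close> at \<open>x\<close>.\<close>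

definition metric_deriv :: "(complex \<Rightarrow> real) \<Rightarrow> (complex \<Rightarrow> complex) \<Rightarrow> complex \<Rightarrow> real" where
  "metric_deriv \<rho> g x =
     \<rho> (g x) * norm (vector_derivative (\<lambda>t. g (cis t)) (at (Arg x))) / \<rho> x"

definition circle_borel :: "complex measure" where
  "circle_borel = restrict_space borel S1"

definition circle_lebesgue :: "(complex \<Rightarrow> real) \<Rightarrow> complex measure" where
  "circle_lebesgue \<rho> =
     distr (density lborel
              (\<lambda>t. ennreal (indicator {0..<2 * pi} t * \<rho> (cis t)
                             / integral {0..2 * pi} (\<lambda>s. \<rho> (cis s)))))
       circle_borel cis"

definition circle_prob :: "complex measure \<Rightarrow> bool" where
  "circle_prob \<mu> \<longleftrightarrow> prob_space \<mu> \<and> sets \<mu> = sets circle_borel"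

definition conformal_exp ::
    "(complex \<Rightarrow> real) \<Rightarrow> (complex \<Rightarrow> complex) set \<Rightarrow> real \<Rightarrow> complex measure \<Rightarrow> bool" where
  "conformal_exp \<rho> G \<delta> \<mu> \<longleftrightarrow> circle_prob \<mu> \<and>
     (\<forall>g\<in>G. \<forall>B\<in>sets \<mu>.
        emeasure \<mu> (g ` B) = (\<integral>\<^sup>+x\<in>B. ennreal (metric_deriv \<rho> g x powr \<delta>) \<partial>\<mu>))"

definition conformal ::
    "(complex \<Rightarrow> real) \<Rightarrow> (complex \<Rightarrow> complex) set \<Rightarrow> complex measure \<Rightarrow> bool" where
  "conformal \<rho> G \<mu> \<longleftrightarrow> (\<exists>\<delta>. conformal_exp \<rho> G \<delta> \<mu>)"

definition not_charging :: "complex measure \<Rightarrow> complex set \<Rightarrow> bool" where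
  "not_charging \<mu> A \<longleftrightarrow> A \<in> null_sets \<mu>"

definition supported_on :: "complex measure \<Rightarrow> complex set \<Rightarrow> bool" where
  "supported_on \<mu> A \<longleftrightarrow> S1 - A \<in> null_sets \<mu>"

text \<open>Atoms of a Borel measure on the circle are points of positive mass. An atomic measure is
  carried by its atoms, a non-atomic measure has none.\<close>

definition atomic :: "complex measure \<Rightarrow> bool" where
  "atomic \<mu> \<longleftrightarrow> (AE x in \<mu>. emeasure \<mu> {x} > 0)"

definition nonatomic :: "complex measure \<Rightarrow> bool" where
  "nonatomic \<mu> \<longleftrightarrow> (\<forall>x\<in>S1. emeasure \<mu> {x} = 0)"

definition invariant_set :: "(complex \<Rightarrow> complex) set \<Rightarrow> complex set \<Rightarrow> bool" where
  "invariant_set G A \<longleftrightarrow> A \<subseteq> S1 \<and> (\<forall>g\<in>G. g ` A = A)"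

definition quasi_invariant :: "(complex \<Rightarrow> complex) set \<Rightarrow> complex measure \<Rightarrow> bool" where
  "quasi_invariant G \<mu> \<longleftrightarrow>
     (\<forall>g\<in>G. \<forall>B\<in>sets \<mu>. emeasure \<mu> (g ` B) = 0 \<longleftrightarrow> emeasure \<mu> B = 0)"

definition ergodic :: "(complex \<Rightarrow> complex) set \<Rightarrow> complex measure \<Rightarrow> bool" where
  "ergodic G \<mu> \<longleftrightarrow> quasi_invariant G \<mu> \<and>
     (\<forall>A\<in>sets \<mu>. invariant_set G A \<longrightarrow> emeasure \<mu> A = 0 \<or> emeasure \<mu> (S1 - A) = 0)"

definition orbit_set :: "(complex \<Rightarrow> complex) set \<Rightarrow> complex set \<Rightarrow> complex set" where
  "orbit_set G A = (\<Union>g\<in>G. g ` A)"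

definition NE :: "(complex \<Rightarrow> real) \<Rightarrow> (complex \<Rightarrow> complex) set \<Rightarrow> complex set" where
  "NE \<rho> G = {x\<in>S1. \<forall>g\<in>G. metric_deriv \<rho> g x \<le> 1}"

definition acts_minimally :: "(complex \<Rightarrow> complex) set \<Rightarrow> bool" where
  "acts_minimally G \<longleftrightarrow> (\<forall>x\<in>S1. S1 \<subseteq> closure (orbit_set G {x}))"

text \<open>The middle-thirds set, as the ternary expansions with all digits 0 or 2.\<close>

definition cantor_set :: "real set" where
  "cantor_set = range (\<lambda>a :: nat \<Rightarrow> bool. \<Sum>n. (if a n then 2 else 0) / 3 ^ Suc n)"

definition exceptional_minimal_set :: "(complex \<Rightarrow> complex) set \<Rightarrow> complex set \<Rightarrow> bool" where
  "exceptional_minimal_set G \<Lambda> \<longleftrightarrow>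
     \<Lambda> \<noteq> {} \<and> closed \<Lambda> \<and> invariant_set G \<Lambda> \<and>
     (\<forall>K. K \<noteq> {} \<and> closed K \<and> invariant_set G K \<and> K \<subseteq> \<Lambda> \<longrightarrow> K = \<Lambda>) \<and>
     \<Lambda> homeomorphic cantor_set"

text \<open>The points of the interval \<open>(x, x + \<epsilon>)\<close> are \<open>x * cis t\<close> with \<open>0 < t < \<epsilon>\<close>.\<close>

definition isolated_fixers :: "(complex \<Rightarrow> complex) set \<Rightarrow> complex \<Rightarrow> bool" where
  "isolated_fixers G x \<longleftrightarrow>
     (\<exists>gp\<in>G. \<exists>gm\<in>G. gp x = x \<and> gm x = x \<and>
        (\<exists>\<epsilon>>0. (\<forall>t\<in>{0<..<\<epsilon>}. gp (x * cis t) \<noteq> x * cis t) \<and>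
                (\<forall>t\<in>{0<..<\<epsilon>}. gm (x * cis (- t)) \<noteq> x * cis (- t))))"

definition property_star :: "(complex \<Rightarrow> real) \<Rightarrow> (complex \<Rightarrow> complex) set \<Rightarrow> bool" where
  "property_star \<rho> G \<longleftrightarrow> acts_minimally G \<and> (\<forall>x\<in>NE \<rho> G. isolated_fixers G x)"

definition property_lambda_star ::
    "(complex \<Rightarrow> real) \<Rightarrow> (complex \<Rightarrow> complex) set \<Rightarrow> complex set \<Rightarrow> bool" where
  "property_lambda_star \<rho> G \<Lambda> \<longleftrightarrow> (\<forall>x\<in>\<Lambda> \<inter> NE \<rho> G. isolated_fixers G x)"

end

theory Submission
  imports Defs
begin

text \<open>Let \<open>M\<close> be the minimal set. Near a point of \<open>M\<close> that is expandable some group element expands. Near a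
  non-expandable point \<open>x\<close> the iterates of \<open>g\<^sub>+\<close> or \<open>g\<^sub>-\<close> lead out of a neighbourhood with bounded
  distortion and with large derivative. By compactness, every point outside \<open>G(NE)\<close> has arbitrarily
  small arcs around it that a group element maps onto an arc of fixed size with uniformly bounded distortion.

  For a conformal measure \<open>\<mu>\<close> of exponent \<open>\<delta>\<close> with full support, such an arc has measure comparable to
  \<open>D\<close> to the power \<open>-\<delta>\<close>, where \<open>D\<close> is the derivative. Covering by such arcs shows that a conformal
  measure \<open>\<nu>\<close> of exponent \<open>\<delta>' \<ge> \<delta>\<close> that does not charge \<open>G(NE)\<close> satisfies \<open>\<nu> \<le> C \<mu>\<close>, and that \<open>\<nu> = 0\<close> if
  \<open>\<delta>' > \<delta>\<close>. All claims follow by applying this to restrictions of conformal measures to invariant sets, to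
  the Lebesgue measure, and to its restriction to the complement of \<open>\<Lambda>\<close>.\<close>

section \<open>Circle diffeomorphisms and their lifts\<close>

text \<open>Near a non-expandable point the number of iterates needed to gain a definite factor is
  unbounded, so distortion cannot be controlled by the length of a word. It is controlled by the sum
  of the derivatives along the word, which stays bounded. For this reason expansion is recorded
  backwards: \<open>x\<close> is written as \<open>h y\<close> with a contraction \<open>h\<close>,
  and derivatives are summed at \<open>y\<close>, the centre of an arc of fixed size. When
  contractions are composed these sums form a geometric series, so one radius serves all depths.

  The comparison of two measures is asymmetric. From above the total mass of \<nu> suffices; from
  below \<mu> only has to be positive on arcs centred on \<open>M\<close>. So \<mu> may sit on a
  countable orbit or entirely off \<open>M\<close>, and the exponent bounds come from exactly such
  choices. Exponents are arbitrary reals throughout, because their sign is part of what is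
  proved.\<close>

lemma cis_eq_cis_iff: "cis a = cis b \<longleftrightarrow> (\<exists>k::int. a = b + 2 * pi * of_int k)"
proof -
  have "cis a = cis b \<longleftrightarrow> sin a = sin b \<and> cos a = cos b"
    by (auto simp: complex_eq_iff)
  also have "\<dots> \<longleftrightarrow> (\<exists>k::int. a = b + 2 * pi * of_int k)"
    by (subst sin_cos_eq_iff) (auto simp: algebra_simps)
  finally show ?thesis .
qed

lemma S1_cis: "x \<in> S1 \<longleftrightarrow> (\<exists>t. x = cis t)"
proof
  assume "x \<in> S1"
  then have "x = cis (Arg x)"
    by (metis cis_Arg dist_0_norm mem_sphere norm_eq_zero norm_sgn sgn_eq div_by_1 of_real_1 zero_neq_one)
  then show "\<exists>t. x = cis t" by blast
qed auto

lemma cis_in_S1 [simp]: "cis t \<in> S1"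
  by simp

lemma cis_add_2pi_int [simp]: "cis (t + 2 * pi * of_int k) = cis t"
  using cis_eq_cis_iff by blast

lemma inj_on_cis: "inj_on cis {a..<a + 2 * pi}"
proof (rule inj_onI)
  fix x y assume xy: "x \<in> {a..<a + 2 * pi}" "y \<in> {a..<a + 2 * pi}" "cis x = cis y"
  then obtain k :: int where k: "x = y + 2 * pi * of_int k" by (auto simp: cis_eq_cis_iff)
  then have "\<bar>2 * pi * of_int k\<bar> < 2 * pi" using xy by auto
  then have "\<bar>of_int k :: real\<bar> < 1" by (simp add: abs_mult)
  then have "k = 0" by linarith
  with k show "x = y" by simp
qed

lemma angle_reduce: obtains k :: int where "t + 2 * pi * of_int k \<in> {a..<a + 2 * pi}"
proof -
  define k where "k = - \<lfloor>(t - a) / (2 * pi)\<rfloor>"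
  have "2 * pi * of_int \<lfloor>(t - a) / (2 * pi)\<rfloor> \<le> 2 * pi * ((t - a) / (2 * pi))"
    by (intro mult_left_mono) auto
  moreover have "2 * pi * ((t - a) / (2 * pi)) < 2 * pi * (of_int \<lfloor>(t - a) / (2 * pi)\<rfloor> + 1)"
    by (intro mult_strict_left_mono) auto
  moreover have "2 * pi * ((t - a) / (2 * pi)) = t - a" by simp
  ultimately have "t + 2 * pi * of_int k \<in> {a..<a + 2 * pi}"
    unfolding k_def of_int_minus by (simp only: atLeastLessThan_iff) (simp add: distrib_left)
  then show ?thesis using that by blast
qed

lemma reduce_2pi: obtains k :: int where "t + 2 * pi * of_int k \<in> {0..<2 * pi}"
  using angle_reduce[of t 0] that by auto

lemma cis_range_reduce: assumes "x \<in> S1" obtains t where "t \<in> {0..<2 * pi}" "x = cis t"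
proof -
  obtain s where s: "x = cis s" using S1_cis assms by blast
  obtain k :: int where "s + 2 * pi * of_int k \<in> {0..<0 + 2 * pi}" using angle_reduce by blast
  then show ?thesis using s by (intro that[of "s + 2 * pi * of_int k"]) auto
qed

lemma cis_image_compact_reduce:
  assumes "K \<subseteq> S1" "compact K" shows "compact ({0..2 * pi} \<inter> cis -` K)"
proof -
  have "closed (cis -` K)"
    by (intro closed_vimage compact_imp_closed assms) (auto intro: continuous_intros)
  then show ?thesis by (intro compact_Int_closed) auto
qed

text \<open>Orientation preservation supplies only a continuous lift, so its smoothness has to be
  recovered from the circle map. Continuity keeps \<open>F s\<close> within \<pi> of
  \<open>F t\<close> for \<open>s\<close> near \<open>t\<close>, so \<open>F s - F t\<close> is
  there the principal value \<open>Im (Ln (\<gamma> s / \<gamma> t))\<close>, which is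
  differentiable.\<close>

lemma lift_has_derivative:
  assumes F: "continuous_on UNIV F" "\<And>t. \<gamma> t = cis (F t)"
    and d: "(\<gamma> has_vector_derivative \<gamma>') (at t)"
  shows "(F has_real_derivative Im (\<gamma>' * cnj (\<gamma> t))) (at t)"
proof -
  have nz: "\<gamma> s \<noteq> 0" for s by (simp add: F)
  have d1: "((\<lambda>s. \<gamma> s / \<gamma> t) has_vector_derivative \<gamma>' / \<gamma> t) (at t)"
    using has_vector_derivative_divide[OF d] by blast
  have d2: "((\<lambda>s. Ln (\<gamma> s / \<gamma> t)) has_vector_derivative (\<gamma>' / \<gamma> t) * inverse (\<gamma> t / \<gamma> t)) (at t)"
    using field_vector_diff_chain_at[OF d1, of Ln, OF has_field_derivative_Ln] nz
    by (simp add: o_def)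
  have d3: "((\<lambda>s. Im (Ln (\<gamma> s / \<gamma> t))) has_vector_derivative Im (\<gamma>' / \<gamma> t)) (at t)"
    using bounded_linear.has_vector_derivative[OF bounded_linear_Im d2]
    unfolding divide_self[OF nz[of t]] inverse_1 mult_1_right .
  have eq: "Im (\<gamma>' / \<gamma> t) = Im (\<gamma>' * cnj (\<gamma> t))"
    unfolding complex_div_cnj[of \<gamma>'] F(2)[of t] norm_cis by simp
  have "isCont F t" using F(1) continuous_on_eq_continuous_at by blast
  then have "\<forall>\<^sub>F s in nhds t. dist (F s) (F t) < pi"
    unfolding isCont_def tendsto_at_iff_tendsto_nhds by (rule tendstoD) simp
  then have ev: "\<forall>\<^sub>F s in nhds t. Im (Ln (\<gamma> s / \<gamma> t)) + F t = F s"
  proof eventually_elim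
    case (elim s)
    then have "\<bar>F s - F t\<bar> < pi" by (simp add: dist_real_def)
    moreover have "\<gamma> s / \<gamma> t = cis (F s - F t)"
      by (simp only: F(2) cis_divide)
    then have "\<gamma> s / \<gamma> t = exp (\<i> * (F s - F t))"
      by (simp only: cis_conv_exp of_real_diff)
    ultimately have "Ln (\<gamma> s / \<gamma> t) = \<i> * (F s - F t)"
      by (simp add: Ln_exp)
    then show ?case by simp
  qed
  have "((\<lambda>s. Im (Ln (\<gamma> s / \<gamma> t)) + F t) has_real_derivative Im (\<gamma>' * cnj (\<gamma> t))) (at t)"
    using d3 unfolding eq has_real_derivative_iff_has_vector_derivative
    by (auto intro!: derivative_eq_intros)
  with DERIV_cong_ev[OF refl ev refl] show ?thesis by blast
qed

locale circle_group =
  fixes \<rho> :: "complex \<Rightarrow> real" and G :: "(complex \<Rightarrow> complex) set"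
  assumes metric: "riemannian_metric \<rho>" and grp: "fg_C2_group G"
begin

lemma subgroup_G: "subgroup G (BijGroup S1)"
  and G_diffeo: "G \<subseteq> C2_diffeos"
  using grp by (auto simp: fg_C2_group_def)

lemma G_Bij: "g \<in> G \<Longrightarrow> g \<in> Bij S1"
  using G_diffeo by (auto simp: C2_diffeos_def)

lemma G_bij_betw: "g \<in> G \<Longrightarrow> bij_betw g S1 S1"
  using G_Bij by (auto simp: Bij_def)

lemma G_S1: "g \<in> G \<Longrightarrow> x \<in> S1 \<Longrightarrow> g x \<in> S1"
  using G_bij_betw bij_betwE by blast

lemma G_inj: "g \<in> G \<Longrightarrow> x \<in> S1 \<Longrightarrow> y \<in> S1 \<Longrightarrow> g x = g y \<Longrightarrow> x = y"
  using G_bij_betw by (metis bij_betw_def inj_onD)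

lemma G_image_S1: "g \<in> G \<Longrightarrow> g ` S1 = S1"
  using G_bij_betw bij_betw_imp_surj_on by blast

lemma G_id: "\<exists>e\<in>G. \<forall>x\<in>S1. e x = x"
  using subgroup.one_closed[OF subgroup_G]
  by (intro bexI[of _ "\<lambda>x\<in>S1. x"] ballI) (simp_all only: restrict_apply' BijGroup_def monoid.simps)

lemma G_comp: assumes "g \<in> G" "h \<in> G" shows "\<exists>k\<in>G. \<forall>x\<in>S1. k x = g (h x)"
proof -
  have "compose S1 g h \<in> G"
    using subgroup.m_closed[OF subgroup_G assms] G_Bij assms by (auto simp: BijGroup_def)
  then show ?thesis by (intro bexI[of _ "compose S1 g h"] ballI) (simp only: compose_eq)
qed

lemma G_inv: assumes "g \<in> G"
  shows "\<exists>k\<in>G. \<forall>x\<in>S1. k (g x) = x \<and> g (k x) = x"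
proof -
  have "restrict (inv_into S1 g) S1 \<in> G"
    using subgroup.m_inv_closed[OF subgroup_G assms] inv_BijGroup[OF G_Bij[OF assms]]
      group_BijGroup[of S1] subgroup.mem_carrier[OF subgroup_G assms]
    by (metis group.m_inv_consistent subgroup_G assms)
  moreover have "inv_into S1 g (g x) = x" "g (inv_into S1 g x) = x" if "x \<in> S1" for x
    using that G_bij_betw[OF assms] by (auto simp: bij_betw_inv_into_left bij_betw_inv_into_right)
  ultimately show ?thesis
    by (intro bexI[of _ "restrict (inv_into S1 g) S1"]) (use G_S1 assms in auto)
qed

text \<open>Finite generation enters here: \<open>T n\<close> consists of products of at most
  \<open>2 ^ n\<close> generators and inverses. Countability later makes the union of all translates
  of a null set null and the orbit of a finite set countable.\<close>

lemma countable_G: "countable G"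
proof -
  obtain A where A: "finite A" "G = generate (BijGroup S1) A"
    using grp by (auto simp: fg_C2_group_def)
  define T where "T = rec_nat ({\<one>\<^bsub>BijGroup S1\<^esub>} \<union> A \<union> m_inv (BijGroup S1) ` A)
     (\<lambda>_ X. X \<union> (\<lambda>(x, y). x \<otimes>\<^bsub>BijGroup S1\<^esub> y) ` (X \<times> X))"
  have T0: "T 0 = {\<one>\<^bsub>BijGroup S1\<^esub>} \<union> A \<union> m_inv (BijGroup S1) ` A"
    and TS: "T (Suc n) = T n \<union> (\<lambda>(x, y). x \<otimes>\<^bsub>BijGroup S1\<^esub> y) ` (T n \<times> T n)" for n
    by (simp_all add: T_def)
  have "countable (T n)" for n
  proof (induction n)
    case 0 then show ?case using A(1) by (auto simp: T0 countable_finite)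
  next
    case (Suc n) then show ?case by (simp add: TS)
  qed
  moreover have "mono T" by (rule mono_iff_le_Suc[THEN iffD2]) (auto simp: TS)
  have "g \<in> (\<Union>n. T n)" if "g \<in> generate (BijGroup S1) A" for g
    using that
  proof (induction rule: generate.induct)
    case one then show ?case using T0 by blast
  next
    case (incl h) then show ?case using T0 by blast
  next
    case (inv h) then show ?case using T0 by blast
  next
    case (eng h1 h2)
    then obtain m n where "h1 \<in> T m" "h2 \<in> T n" by blast
    then have "h1 \<in> T (max m n)" "h2 \<in> T (max m n)"
      using monoD[OF \<open>mono T\<close>, of m "max m n"] monoD[OF \<open>mono T\<close>, of n "max m n"] by auto
    then have "h1 \<otimes>\<^bsub>BijGroup S1\<^esub> h2 \<in> T (Suc (max m n))" by (force simp: TS)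
    then show ?case by blast
  qed
  then have "G \<subseteq> (\<Union>n. T n)" using A(2) by blast
  ultimately show ?thesis by (meson countable_UN countableI_type countable_subset)
qed

subsection \<open>Lifts to the line\<close>

definition lifts :: "(real \<Rightarrow> real) set" where
  "lifts = {F. continuous_on UNIV F \<and> strict_mono F \<and> (\<exists>g\<in>G. \<forall>t. g (cis t) = cis (F t))}"

lemma liftsE:
  assumes "F \<in> lifts"
  obtains g where "g \<in> G" "\<And>t. g (cis t) = cis (F t)"
  using assms by (auto simp: lifts_def)

lemma lift_exists: assumes "g \<in> G" obtains F where "F \<in> lifts" "\<And>t. g (cis t) = cis (F t)"
  using assms G_diffeo by (force simp: C2_diffeos_def orientation_preserving_def lifts_def)

lemma lift_strict_mono: "F \<in> lifts \<Longrightarrow> strict_mono F"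
  by (auto simp: lifts_def)

lemma lift_continuous: "F \<in> lifts \<Longrightarrow> continuous_on X F"
  by (auto simp: lifts_def intro: continuous_on_subset)

lemma lift_less: "F \<in> lifts \<Longrightarrow> F s < F t \<longleftrightarrow> s < t"
  using lift_strict_mono strict_mono_less by blast

lemma lift_le: "F \<in> lifts \<Longrightarrow> F s \<le> F t \<longleftrightarrow> s \<le> t"
  using lift_strict_mono strict_mono_less_eq by blast

lemma lift_eq: "F \<in> lifts \<Longrightarrow> F s = F t \<longleftrightarrow> s = t"
  using lift_strict_mono strict_mono_eq by blast

lemma lift_id: "(\<lambda>t. t) \<in> lifts"
proof -
  obtain e where "e \<in> G" "\<forall>x\<in>S1. e x = x" using G_id by blast
  then have "\<exists>g\<in>G. \<forall>t. g (cis t) = cis t" by (intro bexI[of _ e]) auto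
  then show ?thesis by (auto simp: lifts_def strict_mono_def)
qed

lemma lift_comp: assumes "F \<in> lifts" "H \<in> lifts" shows "(\<lambda>t. F (H t)) \<in> lifts"
proof -
  obtain g where g: "g \<in> G" "\<And>t. g (cis t) = cis (F t)" using assms(1) liftsE by blast
  obtain h where h: "h \<in> G" "\<And>t. h (cis t) = cis (H t)" using assms(2) liftsE by blast
  obtain k where k: "k \<in> G" "\<forall>x\<in>S1. k x = g (h x)" using G_comp g h by blast
  have "continuous_on UNIV (\<lambda>t. F (H t))"
    using continuous_on_compose2[OF lift_continuous[OF assms(1), of UNIV] lift_continuous[OF assms(2), of UNIV]] by simp
  moreover have "strict_mono (\<lambda>t. F (H t))"
    using assms[THEN lift_strict_mono] by (auto simp: strict_mono_def)
  moreover have "\<forall>t. k (cis t) = cis (F (H t))" using g h k by simp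
  ultimately show ?thesis using k(1) by (auto simp: lifts_def)
qed

lemma lift_shift: assumes "F \<in> lifts" shows "(\<lambda>t. F t + 2 * pi * of_int k) \<in> lifts"
  using assms by (auto simp: lifts_def strict_mono_def intro!: continuous_intros)

text \<open>\<open>(F t - t) / (2 * pi)\<close> is continuous with integer values, hence constant.
  This is what allows a lift of the inverse map to be shifted into the exact inverse of a
  lift.\<close>

lemma continuous_lift_of_id:
  assumes c: "continuous_on UNIV F" and id: "\<And>t. cis (F t) = cis t"
  shows "\<exists>k::int. \<forall>t. F t = t + 2 * pi * of_int k"
proof -
  have k: "\<exists>k::int. F t = t + 2 * pi * of_int k" for t using id cis_eq_cis_iff by blast
  have "continuous_on UNIV (\<lambda>t. (F t - t) / (2 * pi))"
    by (intro continuous_intros c) auto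
  moreover have Z: "(F t - t) / (2 * pi) \<in> \<int>" for t
    using k[of t] by auto
  have "1 \<le> \<bar>u - v\<bar>" if "u \<in> \<int>" "v \<in> \<int>" "u \<noteq> v" for u v :: real
    using that Ints_nonzero_abs_ge1[of "u - v"] by auto
  then have "1 \<le> norm ((F y - y) / (2 * pi) - (F x - x) / (2 * pi))"
    if "(F y - y) / (2 * pi) \<noteq> (F x - x) / (2 * pi)" for x y
    using Z that by simp
  ultimately have "(\<lambda>t. (F t - t) / (2 * pi)) constant_on UNIV"
    by (intro continuous_discrete_range_constant[of UNIV]) (auto intro!: exI[of _ 1])
  then obtain c where c: "\<And>t. (F t - t) / (2 * pi) = c" by (auto simp: constant_on_def)
  obtain k :: int where k: "F 0 = 0 + 2 * pi * of_int k" using k by blast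
  with c[of 0] have "c = of_int k" by simp
  with c have "F t = t + 2 * pi * of_int k" for t
    using c[of t] by (simp add: field_simps)
  then show ?thesis by blast
qed

lemma lift_inv: assumes "F \<in> lifts"
  obtains H where "H \<in> lifts" "\<And>t. H (F t) = t" "\<And>t. F (H t) = t"
proof -
  obtain g where g: "g \<in> G" "\<And>t. g (cis t) = cis (F t)" using assms(1) liftsE by blast
  obtain h where h: "h \<in> G" "\<forall>x\<in>S1. h (g x) = x" using G_inv g by blast
  obtain H where H: "H \<in> lifts" "\<And>t. h (cis t) = cis (H t)" using lift_exists h by blast
  have "cis (H (F t)) = cis t" for t using g h H by (metis cis_in_S1)
  then obtain k :: int where k: "\<And>t. H (F t) = t + 2 * pi * of_int k"
    using continuous_lift_of_id lift_continuous[OF lift_comp[OF H(1) assms]] by blast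
  define H' where "H' t = H t + 2 * pi * of_int (- k)" for t
  have H': "H' \<in> lifts" unfolding H'_def using lift_shift H by blast
  moreover have 1: "H' (F t) = t" for t using k by (simp add: H'_def)
  moreover have "F (H' t) = t" for t using 1[of "H' t"] H' by (metis lift_eq)
  ultimately show ?thesis using that by blast
qed

text \<open>The integer \<open>k\<close> is the degree of the circle map; monotonicity makes it
  positive. For \<open>k \<ge> 2\<close> the intermediate value theorem gives a point strictly
  inside one period with the same image on the circle as \<open>t\<close>, against
  injectivity.\<close>

lemma lift_add_2pi: assumes F: "F \<in> lifts" shows "F (t + 2 * pi) = F t + 2 * pi"
proof -
  obtain g where g: "g \<in> G" "\<And>t. g (cis t) = cis (F t)" using assms(1) liftsE by blast
  have "cis (F (t + 2 * pi)) = cis (F t)" using g cis_add_2pi_int[of t 1] by (metis mult.right_neutral of_int_1)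
  then obtain k :: int where k: "F (t + 2 * pi) = F t + 2 * pi * of_int k" by (auto simp: cis_eq_cis_iff)
  have "F t < F (t + 2 * pi)" using lift_less[OF F] by simp
  then have "0 < 2 * pi * real_of_int k" using k by linarith
  then have "0 < real_of_int k" by (rule zero_less_mult_pos) simp
  then have "k \<ge> 1" by linarith
  moreover have "\<not> k \<ge> 2"
  proof
    assume "k \<ge> 2"
    then have "2 * pi * 2 \<le> 2 * pi * real_of_int k" by (intro mult_left_mono) auto
    then have "F t + 2 * pi < F (t + 2 * pi)" using k pi_gt_zero by linarith
    then obtain s where s: "t \<le> s" "s \<le> t + 2 * pi" "F s = F t + 2 * pi"
      using IVT'[of F t "F t + 2 * pi" "t + 2 * pi"] lift_continuous[OF F] by auto
    then have s2: "s < t + 2 * pi" "s \<noteq> t" using \<open>F t + 2 * pi < F (t + 2 * pi)\<close> by (auto simp: less_le)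
    have "cis (F s) = cis (F t)" using s(3) cis_add_2pi_int[of "F t" 1] by simp
    then have "cis s = cis t" using g G_inj[OF g(1)] by (metis cis_in_S1)
    then show False using inj_onD[OF inj_on_cis[of t]] s s2 by auto
  qed
  ultimately have "k = 1" by linarith
  then show ?thesis using k by simp
qed

lemma lift_add_2pi_int: assumes F: "F \<in> lifts" shows "F (t + 2 * pi * of_int k) = F t + 2 * pi * of_int k"
proof (induction k rule: int_induct[where k = 0])
  case base then show ?case by simp
next
  case (step1 i) then show ?case using lift_add_2pi[OF F, of "t + 2 * pi * of_int i"] by (simp add: algebra_simps)
next
  case (step2 i) then show ?case using lift_add_2pi[OF F, of "t + 2 * pi * of_int (i - 1)"] by (simp add: algebra_simps)
qed

lemma lift_C2:
  assumes F: "F \<in> lifts"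
  obtains F' F'' where "\<And>t. (F has_real_derivative F' t) (at t)"
    "\<And>t. (F' has_real_derivative F'' t) (at t)" "continuous_on UNIV F''"
proof -
  obtain g where g: "g \<in> G" "\<And>t. g (cis t) = cis (F t)" using assms(1) liftsE by blast
  have "class_C (Suc (Suc 0)) (\<lambda>t. g (cis t))"
    using G_diffeo g(1) by (auto simp: C2_diffeos_def C2_circle_map_def numeral_2_eq_2)
  then obtain c1 c2 where c: "\<And>t. ((\<lambda>t. g (cis t)) has_vector_derivative c1 t) (at t)"
     "\<And>t. (c1 has_vector_derivative c2 t) (at t)" "continuous_on UNIV c2" by auto
  define c0 where "c0 t = g (cis t)" for t
  have c0: "(c0 has_vector_derivative c1 t) (at t)" for t unfolding c0_def using c(1) .
  define F' where "F' t = Im (c1 t * cnj (c0 t))" for t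
  define F'' where "F'' t = Im (c1 t * cnj (c1 t) + c2 t * cnj (c0 t))" for t
  have "(F has_real_derivative F' t) (at t)" for t
    unfolding F'_def using lift_has_derivative[OF lift_continuous[OF F, of UNIV] _ c0] g(2)
    by (simp add: c0_def)
  moreover have "((\<lambda>t. c1 t * cnj (c0 t)) has_vector_derivative (c1 t * cnj (c1 t) + c2 t * cnj (c0 t))) (at t)" for t
    by (intro has_vector_derivative_mult c bounded_linear.has_vector_derivative[OF bounded_linear_cnj] c0)
  then have "(F' has_real_derivative F'' t) (at t)" for t
    unfolding F'_def F''_def has_real_derivative_iff_has_vector_derivative
    using bounded_linear.has_vector_derivative[OF bounded_linear_Im] by blast
  moreover have "continuous_on UNIV c0" "continuous_on UNIV c1"
    using c0 c(2) by (meson continuous_at_imp_continuous_on has_vector_derivative_continuous)+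
  then have "continuous_on UNIV F''"
    unfolding F''_def by (intro continuous_intros c(3)) 
  ultimately show ?thesis using that by blast
qed

lemma assumes "F \<in> lifts"
  shows lift_DERIV: "(F has_real_derivative deriv F t) (at t)"
    and lift_deriv_DERIV: "(deriv F has_real_derivative deriv (deriv F) t) (at t)"
    and lift_deriv2_continuous: "continuous_on UNIV (deriv (deriv F))"
proof -
  obtain F' F'' where *: "\<And>t. (F has_real_derivative F' t) (at t)"
    "\<And>t. (F' has_real_derivative F'' t) (at t)" "continuous_on UNIV F''" using lift_C2[OF assms] by metis
  then have "deriv F = F'" "deriv F' = F''" by (auto simp: DERIV_imp_deriv)
  with * show "(F has_real_derivative deriv F t) (at t)"
    "(deriv F has_real_derivative deriv (deriv F) t) (at t)" "continuous_on UNIV (deriv (deriv F))" by simp_all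
qed

lemma lift_deriv_continuous: "F \<in> lifts \<Longrightarrow> continuous_on UNIV (deriv F)"
  by (meson lift_deriv_DERIV DERIV_continuous_on has_field_derivative_at_within)

lemma deriv_lift_comp: assumes "F \<in> lifts" "H \<in> lifts"
  shows "deriv (\<lambda>t. F (H t)) t = deriv F (H t) * deriv H t"
  by (intro DERIV_imp_deriv DERIV_chain2[of F] lift_DERIV assms)

text \<open>A strictly monotone function may have critical points; the chain rule with the
  differentiable inverse lift excludes them.\<close>

lemma lift_deriv_pos: assumes F: "F \<in> lifts" shows "deriv F t > 0"
proof -
  obtain H where H: "H \<in> lifts" "\<And>t. H (F t) = t" using lift_inv[OF F] by metis
  have "deriv F t \<ge> 0"
    by (rule mono_on_imp_deriv_nonneg[of UNIV F])
      (use lift_DERIV[OF F, of t] strict_mono_mono[OF lift_strict_mono[OF F]] in \<open>auto simp: monotone_on_def\<close>)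
  moreover have "deriv (\<lambda>t. H (F t)) t = deriv H (F t) * deriv F t" using deriv_lift_comp F H by blast
  then have "deriv H (F t) * deriv F t = 1" by (simp add: H(2))
  then have "deriv F t \<noteq> 0" by auto
  ultimately show ?thesis by simp
qed

lemma deriv_lift_2pi: assumes F: "F \<in> lifts" shows "deriv F (t + 2 * pi * of_int k) = deriv F t"
proof -
  have "((\<lambda>s. F (s + 2 * pi * of_int k)) has_real_derivative deriv F (t + 2 * pi * of_int k)) (at t)"
    by (rule DERIV_shift[THEN iffD1, OF lift_DERIV[OF F]])
  moreover have "((\<lambda>s. F s + 2 * pi * of_int k) has_real_derivative deriv F t) (at t)"
    using DERIV_add[OF lift_DERIV[OF F] DERIV_const] by simp
  ultimately show ?thesis by (intro DERIV_unique) (simp_all only: lift_add_2pi_int[OF F])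
qed


subsection \<open>The metric derivative in the angular coordinate\<close>

definition r :: "real \<Rightarrow> real" where "r t = \<rho> (cis t)"

text \<open>This is \<open>metric_deriv\<close> of the circle map in terms of a lift, as
  \<open>metric_deriv_eq_dd\<close> shows. Conformal measures see \<open>dd F\<close>, whereas
  lengths of intervals are governed by \<open>deriv F\<close>; the two differ by a bounded
  factor.\<close>

definition dd :: "(real \<Rightarrow> real) \<Rightarrow> real \<Rightarrow> real" where "dd F t = r (F t) * deriv F t / r t"

lemma r_pos [simp]: "r t > 0" and r_nonneg [simp]: "r t \<ge> 0" and r_nonzero [simp]: "r t \<noteq> 0"
proof -
  show "r t > 0" using metric by (simp add: r_def riemannian_metric_def)
  then show "r t \<ge> 0" "r t \<noteq> 0" by auto
qed

lemma r_2pi [simp]: "r (t + 2 * pi * of_int k) = r t"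
  by (simp add: r_def)

lemma r_C1:
  obtains r' where "\<And>t. (r has_real_derivative r' t) (at t)" "continuous_on UNIV r'"
proof -
  have "class_C (Suc 0) r"
    using metric by (auto simp: riemannian_metric_def r_def[abs_def] simp del: class_C.simps)
  then show ?thesis using that by (auto simp: has_real_derivative_iff_has_vector_derivative)
qed

lemma r_continuous: "continuous_on X r"
  by (meson DERIV_continuous_on has_field_derivative_at_within r_C1)

lemma periodic_bounded:
  fixes f :: "real \<Rightarrow> real"
  assumes "continuous_on UNIV f" "\<And>t (k::int). f (t + 2 * pi * of_int k) = f t"
  obtains C where "C > 0" "\<And>t. \<bar>f t\<bar> \<le> C"
proof -
  have "compact (f ` {0..2 * pi})"
    using assms(1) by (intro compact_continuous_image) (auto intro: continuous_on_subset)
  then obtain C where C: "C > 0" "\<forall>x\<in>f ` {0..2 * pi}. norm x \<le> C"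
    by (meson compact_imp_bounded bounded_pos)
  have "\<bar>f t\<bar> \<le> C" for t
  proof -
    obtain k :: int where "t + 2 * pi * of_int k \<in> {0..<2 * pi}" using reduce_2pi by blast
    then have "\<bar>f (t + 2 * pi * of_int k)\<bar> \<le> C" using C(2) by auto
    then show ?thesis by (simp only: assms(2))
  qed
  with C(1) that show ?thesis by blast
qed

text \<open>\<open>K\<close> is the price of mixing derivatives in the metric with distances in the
  angle, and it enters the length estimates below.\<close>

lemma r_comparable: obtains K where "K \<ge> 1" "\<And>s t. r s \<le> K * r t"
proof -
  obtain C where C: "C > 0" "\<And>t. \<bar>r t\<bar> \<le> C"
    using periodic_bounded[OF r_continuous r_2pi] by blast
  have "continuous_on UNIV (\<lambda>t. inverse (r t))"
    by (intro continuous_intros r_continuous) auto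
  then obtain C' where C': "C' > 0" "\<And>t. \<bar>inverse (r t)\<bar> \<le> C'"
    using periodic_bounded[of "\<lambda>t. inverse (r t)"] by auto
  have 1: "r s \<le> C * C' * r t" for s t
  proof -
    have "inverse (r t) \<le> C'" using C'(2)[of t] by simp
    then have "1 \<le> C' * r t" by (simp add: field_simps)
    then have "C * 1 \<le> C * (C' * r t)" using C(1) by (intro mult_left_mono) auto
    then show ?thesis using C(2)[of s] by simp
  qed
  then have "r 0 * 1 \<le> r 0 * (C * C')" by (simp add: mult.commute)
  then have "C * C' \<ge> 1" by (subst (asm) mult_le_cancel_left_pos) simp_all
  with 1 that show ?thesis by blast
qed

lemma dd_pos [simp]: "F \<in> lifts \<Longrightarrow> dd F t > 0"
  by (simp add: dd_def lift_deriv_pos)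

lemma dd_nonzero [simp]: "F \<in> lifts \<Longrightarrow> dd F t \<noteq> 0"
  by (metis dd_pos less_irrefl)

lemma dd_id [simp]: "dd (\<lambda>t. t) t = 1"
  by (simp add: dd_def)

lemma dd_comp: "F \<in> lifts \<Longrightarrow> H \<in> lifts \<Longrightarrow> dd (\<lambda>t. F (H t)) t = dd F (H t) * dd H t"
  by (simp add: dd_def deriv_lift_comp)

lemma dd_2pi: "F \<in> lifts \<Longrightarrow> dd F (t + 2 * pi * of_int k) = dd F t"
  by (simp add: dd_def deriv_lift_2pi lift_add_2pi_int)

lemma dd_inverse: assumes "F \<in> lifts" "H \<in> lifts" "\<And>t. F (H t) = t"
  shows "dd F (H t) = 1 / dd H t"
proof -
  have "dd F (H t) * dd H t = 1"
    using dd_comp[OF assms(1,2), of t] by (simp add: assms(3))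
  then show ?thesis using dd_pos[OF assms(2), of t] by (simp add: field_simps)
qed

lemma dd_continuous: "F \<in> lifts \<Longrightarrow> continuous_on X (dd F)"
  unfolding dd_def
  by (intro continuous_intros continuous_on_compose2[OF r_continuous[of UNIV]] lift_continuous
      continuous_on_subset[OF lift_deriv_continuous] r_continuous) auto

text \<open>The definition differentiates at the principal argument, while a lift is used at any
  angle over the same point; periodicity of \<open>deriv F\<close> bridges the two.\<close>

lemma metric_deriv_eq_dd:
  assumes "g \<in> G" "F \<in> lifts" "\<And>t. g (cis t) = cis (F t)"
  shows "metric_deriv \<rho> g (cis t) = dd F t"
proof -
  have "cis (Arg (cis t)) = cis t" by (simp add: cis_Arg)
  then obtain k :: int where k: "Arg (cis t) = t + 2 * pi * of_int k"
    using cis_eq_cis_iff by blast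
  have "((\<lambda>t. g (cis t)) has_vector_derivative (deriv F (Arg (cis t)) *\<^sub>R (\<i> * cis (F (Arg (cis t))))))
          (at (Arg (cis t)))"
  proof -
    have "((cis \<circ> F) has_vector_derivative (deriv F (Arg (cis t)) *\<^sub>R (\<i> * cis (F (Arg (cis t))))))
          (at (Arg (cis t)))"
    proof (rule vector_diff_chain_at)
      show "(F has_vector_derivative deriv F (Arg (cis t))) (at (Arg (cis t)))"
        using lift_DERIV[OF assms(2)] by (simp add: has_real_derivative_iff_has_vector_derivative)
      have "(cis has_derivative (\<lambda>x. x *\<^sub>R (\<i> * cis (F (Arg (cis t)))))) (at (F (Arg (cis t))))"
        using has_derivative_cis[OF has_derivative_ident, of "F (Arg (cis t))" UNIV] by simp
      then show "(cis has_vector_derivative \<i> * cis (F (Arg (cis t)))) (at (F (Arg (cis t))))"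
        by (simp add: has_vector_derivative_def)
    qed
    then show ?thesis using assms(3) by (simp add: o_def)
  qed
  then have "norm (vector_derivative (\<lambda>t. g (cis t)) (at (Arg (cis t)))) = deriv F t"
    using lift_deriv_pos[OF assms(2), of t]
    by (simp add: vector_derivative_at norm_mult k deriv_lift_2pi[OF assms(2)])
  then show ?thesis
    by (simp add: metric_deriv_def dd_def r_def assms(3))
qed

text \<open>The class C2 is used here: the logarithmic derivative of \<open>dd F\<close> is
  continuous and periodic, hence bounded. All distortion estimates rest on this Lipschitz
  constant.\<close>

lemma dd_lipschitz:
  assumes F: "F \<in> lifts"
  obtains L where "L \<ge> 0" "\<And>s t. \<bar>ln (dd F s) - ln (dd F t)\<bar> \<le> L * \<bar>s - t\<bar>"
proof -
  obtain r' where r': "\<And>t. (r has_real_derivative r' t) (at t)" "continuous_on UNIV r'"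
    using r_C1 by blast
  define D where "D t = r' (F t) * deriv F t / r (F t) + deriv (deriv F) t / deriv F t - r' t / r t" for t
  have eq: "ln (dd F t) = ln (r (F t)) + ln (deriv F t) - ln (r t)" for t
    using lift_deriv_pos[OF F, of t] r_pos[of t] r_pos[of "F t"]
    by (simp add: dd_def ln_div ln_mult)
  have rF: "((\<lambda>t. r (F t)) has_real_derivative r' (F t) * deriv F t) (at t)" for t
    by (rule DERIV_chain2[OF r'(1) lift_DERIV[OF F]])
  have der: "((\<lambda>t. ln (dd F t)) has_real_derivative D t) (at t)" for t
    unfolding eq D_def
    using lift_deriv_pos[OF F, of t]
    by (auto intro!: derivative_eq_intros rF r'(1) lift_deriv_DERIV[OF F])
  have cont: "continuous_on UNIV D"
    unfolding D_def using lift_deriv_pos[OF F]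
    by (intro continuous_intros continuous_on_compose2[OF r_continuous[of UNIV]] continuous_on_compose2[OF r'(2)]
        lift_continuous[OF F] lift_deriv_continuous[OF F] lift_deriv2_continuous[OF F] r' r_continuous)
      (auto simp: less_imp_neq[THEN not_sym])
  \<comment> \<open>The formula for \<open>D\<close> contains \<open>r'\<close>, about whose
    periodicity nothing has been recorded; uniqueness of the derivative of the periodic function
    \<open>ln (dd F t)\<close> gives periodicity of \<open>D\<close> as a whole.\<close>
  have per: "D (t + 2 * pi * of_int k) = D t" for t and k :: int
  proof -
    have "((\<lambda>s. ln (dd F (s + 2 * pi * of_int k))) has_real_derivative D (t + 2 * pi * of_int k)) (at t)"
      by (rule DERIV_shift[THEN iffD1, OF der])
    then have "((\<lambda>s. ln (dd F s)) has_real_derivative D (t + 2 * pi * of_int k)) (at t)"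
      by (simp only: dd_2pi[OF F])
    with der[of t] show ?thesis using DERIV_unique by blast
  qed
  obtain L where L: "L > 0" "\<And>t. \<bar>D t\<bar> \<le> L"
    using periodic_bounded[OF cont per] by blast
  have "\<bar>ln (dd F s) - ln (dd F t)\<bar> \<le> L * \<bar>s - t\<bar>" for s t
    using field_differentiable_bound[of UNIV "\<lambda>t. ln (dd F t)" D L s t] der L(2) by simp
  with L(1) that show ?thesis by (meson less_imp_le)
qed

lemma lift_mvt:
  assumes F: "F \<in> lifts" and "s < t"
  obtains u where "s < u" "u < t" "F t - F s = (t - s) * (dd F u * (r u / r (F u)))"
proof -
  obtain u where u: "u > s" "u < t" "F t - F s = (t - s) * deriv F u"
    using MVT2[of s t F "deriv F"] lift_DERIV[OF F] \<open>s < t\<close> by blast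
  moreover have "deriv F u = dd F u * (r u / r (F u))" by (simp add: dd_def)
  ultimately show ?thesis using that by simp
qed

text \<open>A mean value inequality centred at \<open>y\<close>: it asks for derivative bounds only
  at points no farther from \<open>y\<close> than \<open>s\<close>, which is what the inductive
  distortion estimate can supply.\<close>

lemma lift_diff_le:
  assumes F: "F \<in> lifts" and K: "\<And>s t. r s \<le> K * r t"
    and c: "\<And>u. \<bar>u - y\<bar> \<le> \<bar>s - y\<bar> \<Longrightarrow> dd F u \<le> c"
  shows "\<bar>F s - F y\<bar> \<le> K * c * \<bar>s - y\<bar>"
proof -
  have *: "\<bar>F b - F a\<bar> \<le> K * c * \<bar>b - a\<bar>" if "a < b" "\<And>u. a < u \<Longrightarrow> u < b \<Longrightarrow> dd F u \<le> c" for a b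
  proof -
    obtain u where u: "a < u" "u < b" "F b - F a = (b - a) * (dd F u * (r u / r (F u)))"
      using lift_mvt[OF F \<open>a < b\<close>] by blast
    have "r u / r (F u) \<le> K" using K by (simp add: field_simps)
    then have "dd F u * (r u / r (F u)) \<le> c * K"
      using that(2)[OF u(1,2)] dd_pos[OF F, of u] by (intro mult_mono) auto
    moreover have "0 \<le> F b - F a" using lift_le[OF F] \<open>a < b\<close> by simp
    moreover have "(b - a) * (dd F u * (r u / r (F u))) \<le> (b - a) * (c * K)"
      using calculation(1) \<open>a < b\<close> by (intro mult_left_mono) auto
    ultimately show ?thesis using \<open>a < b\<close> unfolding u(3)[symmetric] by (simp add: mult_ac)
  qed
  consider "s = y" | "s < y" | "y < s" by linarith
  then show ?thesis
  proof cases
    case 1 then show ?thesis by simp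
  next
    case 2
    have "\<bar>F y - F s\<bar> \<le> K * c * \<bar>y - s\<bar>" by (rule *) (use 2 c in auto)
    then show ?thesis by (simp add: abs_minus_commute)
  next
    case 3
    show ?thesis by (rule *) (use 3 c in auto)
  qed
qed

end

subsection \<open>Leaving a neighbourhood of a one-sided attracting fixed point\<close>

text \<open>The images of the fundamental domain \<open>[\<phi> a, a]\<close> are disjoint, so their total length is at most
  \<open>a - p\<close>. This bounds the distortion of all iterates on that domain (Denjoy's argument) and
  thereby also the sums of their derivatives.\<close>

lemma parabolic_exit:
  fixes \<phi> d :: "real \<Rightarrow> real" and D :: "nat \<Rightarrow> real \<Rightarrow> real"
  assumes cont: "continuous_on UNIV \<phi>" and mono: "strict_mono \<phi>"
    and p: "\<phi> p = p" "p < a" and contr: "\<And>t. p < t \<Longrightarrow> t \<le> a \<Longrightarrow> \<phi> t < t"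
    and L: "L \<ge> 0" "\<And>s t. \<bar>ln (d s) - ln (d t)\<bar> \<le> L * \<bar>s - t\<bar>" and d: "\<And>t. d t > 0"
    and D: "\<And>t. D 0 t = 1" "\<And>n t. D (Suc n) t = d ((\<phi> ^^ n) t) * D n t"
    and K: "K > 0" and mvt: "\<And>n s t. s < t \<Longrightarrow>
          \<exists>u. s < u \<and> u < t \<and> D n u * (t - s) \<le> K * ((\<phi> ^^ n) t - (\<phi> ^^ n) s)"
  shows "\<exists>B. \<exists>q>p. \<forall>x. p < x \<and> x < q \<longrightarrow>
           (\<exists>n y. (\<phi> ^^ n) y = x \<and> (\<Sum>j<n. D j y) \<le> B \<and> D n y \<le> 1 / 2)"
proof -
  \<comment> \<open>\<open>A\<close> decreases to \<open>p\<close>, so the intervals between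
    consecutive terms tile everything between \<open>p\<close> and \<open>a\<close>.\<close>
  define A where "A n = (\<phi> ^^ n) a" for n
  have A_Suc: "A (Suc n) = \<phi> (A n)" and A_0: "A 0 = a" for n by (simp_all add: A_def)
  have lt: "s < t \<Longrightarrow> (\<phi> ^^ n) s < (\<phi> ^^ n) t" for n s t
    by (induction n) (use mono in \<open>auto simp: strict_mono_def\<close>)
  have le: "s \<le> t \<Longrightarrow> (\<phi> ^^ n) s \<le> (\<phi> ^^ n) t" for n s t
    using lt[of s t n] by (cases "s = t") auto
  have Ap: "p < A n \<and> A n \<le> a" for n
  proof (induction n)
    case 0 then show ?case using p by (simp add: A_0)
  next
    case (Suc n)
    then have "\<phi> p < \<phi> (A n)" using mono by (simp add: strict_mono_def)
    moreover have "\<phi> (A n) < A n" using contr Suc by blast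
    ultimately show ?case using Suc p by (simp add: A_Suc)
  qed
  have dec: "A (Suc n) < A n" for n using contr Ap by (simp add: A_Suc)
  have "decseq A" using dec by (intro decseq_SucI) (simp add: less_imp_le)
  have Alim: "A \<longlonglongrightarrow> p"
  proof -
    obtain l where l: "A \<longlonglongrightarrow> l" "\<And>i. l \<le> A i"
      using decseq_convergent[OF \<open>decseq A\<close>, of p] Ap by (metis less_imp_le)
    have "l \<ge> p" using l(1) by (rule LIMSEQ_le_const) (use Ap less_imp_le in blast)
    have "(\<lambda>n. \<phi> (A n)) \<longlonglongrightarrow> \<phi> l"
      using l(1) cont by (auto intro!: continuous_on_tendsto_compose[of UNIV \<phi>])
    moreover have "(\<lambda>n. \<phi> (A n)) \<longlonglongrightarrow> l" using LIMSEQ_Suc[OF l(1)] by (simp add: A_Suc)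
    ultimately have "\<phi> l = l" using LIMSEQ_unique by blast
    with contr[of l] l(2)[of 0] \<open>l \<ge> p\<close> have "l = p" by (fastforce simp: A_0)
    with l(1) show ?thesis by simp
  qed
  define len where "len n = A n - A (Suc n)" for n
  have len_pos: "len n > 0" for n using dec by (simp add: len_def)
  have len_sum: "(\<Sum>j<n. len j) = a - A n" for n
    by (induction n) (simp_all add: len_def A_0)
  then have len_sum_le: "(\<Sum>j<n. len j) \<le> a - p" for n using Ap[of n] by simp
  have in_step: "A (Suc n) \<le> (\<phi> ^^ n) y \<and> (\<phi> ^^ n) y \<le> A n" if "\<phi> a \<le> y" "y \<le> a" for y n
    using le[OF that(1), of n] le[OF that(2), of n] by (simp add: A_def funpow_swap1)
  have Dpos: "D n t > 0" for n t by (induction n) (auto simp: D d)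
  have dist: "\<bar>ln (D n s) - ln (D n y)\<bar> \<le> L * (\<Sum>j<n. len j)"
    if "\<phi> a \<le> y" "y \<le> a" "\<phi> a \<le> s" "s \<le> a" for s y n
  proof (induction n)
    case 0 then show ?case by (simp add: D)
  next
    case (Suc n)
    have "\<bar>(\<phi> ^^ n) s - (\<phi> ^^ n) y\<bar> \<le> len n"
      using in_step[of y n] in_step[of s n] that by (auto simp: len_def)
    then have "L * \<bar>(\<phi> ^^ n) s - (\<phi> ^^ n) y\<bar> \<le> L * len n" using L(1) by (rule mult_left_mono)
    then have "\<bar>ln (d ((\<phi> ^^ n) s)) - ln (d ((\<phi> ^^ n) y))\<bar> \<le> L * len n"
      using L(2) by (meson order_trans)
    moreover have "ln (D (Suc n) t) = ln (d ((\<phi> ^^ n) t)) + ln (D n t)" for t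
      using d[of "(\<phi> ^^ n) t"] Dpos[of n t] by (simp add: D ln_mult)
    ultimately show ?case using Suc by (simp add: algebra_simps)
  qed
  \<comment> \<open>\<open>K / len 0\<close> comes from the mean value estimate on the fundamental
    domain, valid at one point \<open>u\<close> depending on \<open>n\<close>; the exponential is
    the distortion bound that carries it to every other point of the domain.\<close>
  define C where "C = exp (L * (a - p)) * K / len 0"
  have C: "C > 0" using K len_pos by (simp add: C_def)
  have Dle: "D n y \<le> C * len n" if y: "\<phi> a \<le> y" "y \<le> a" for y n
  proof -
    have "\<phi> a < a" using dec[of 0] by (simp add: A_def)
    then obtain u where u: "\<phi> a < u" "u < a" "D n u * (a - \<phi> a) \<le> K * ((\<phi> ^^ n) a - (\<phi> ^^ n) (\<phi> a))"
      using mvt by blast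
    then have "D n u * len 0 \<le> K * len n" by (simp add: len_def A_def funpow_swap1)
    then have 1: "D n u \<le> K * len n / len 0" using len_pos[of 0] by (simp add: field_simps)
    have "\<bar>ln (D n y) - ln (D n u)\<bar> \<le> L * (\<Sum>j<n. len j)"
      by (rule dist) (use u y in auto)
    also have "\<dots> \<le> L * (a - p)" using L(1) len_sum_le by (intro mult_left_mono) auto
    finally have "ln (D n y) \<le> ln (exp (L * (a - p)) * D n u)"
      using Dpos[of n u] by (simp add: ln_mult)
    then have "D n y \<le> exp (L * (a - p)) * D n u"
      using Dpos by (subst (asm) ln_le_cancel_iff) auto
    also have "\<dots> \<le> exp (L * (a - p)) * (K * len n / len 0)" using 1 by (intro mult_left_mono) auto
    finally show ?thesis by (simp add: C_def)
  qed
  \<comment> \<open>From some depth \<open>N\<close> on, the derivatives on the fundamental domain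
    are below 1/2. Points closer to \<open>p\<close> than \<open>A N\<close> need at least
    \<open>N\<close> iterates, hence the neighbourhood chosen below.\<close>
  have "len \<longlonglongrightarrow> 0"
    using tendsto_diff[OF Alim LIMSEQ_Suc[OF Alim]] by (simp add: len_def[abs_def])
  then have "(\<lambda>n. C * len n) \<longlonglongrightarrow> C * 0" by (intro tendsto_intros)
  from order_tendstoD(2)[OF this, of "1 / 2"] have "\<forall>\<^sub>F n in sequentially. C * len n < 1 / 2" by simp
  then obtain N where N: "\<And>n. n \<ge> N \<Longrightarrow> C * len n < 1 / 2"
    by (auto simp only: eventually_sequentially)
  show ?thesis
  proof (rule exI[of _ "C * (a - p)"], rule exI[of _ "A N"], intro conjI allI impI)
    show "p < A N" using Ap by blast
    fix x assume x: "p < x \<and> x < A N"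
    then obtain i where "\<And>n. n \<ge> i \<Longrightarrow> A n < x"
      using order_tendstoD(2)[OF Alim, of x] by (auto simp: eventually_sequentially)
    then have "A i \<le> x" by (simp add: less_imp_le)
    \<comment> \<open>The first term of the sequence not above \<open>x\<close>. The preceding index
      \<open>n\<close> names the tile that contains \<open>x\<close>, so \<open>x\<close> is the
      image under \<open>\<phi> ^^ n\<close> of a point of the fundamental domain.\<close>
    define m where "m = (LEAST m. A m \<le> x)"
    have m: "A m \<le> x"
      unfolding m_def by (rule LeastI[of "\<lambda>m. A m \<le> x", OF \<open>A i \<le> x\<close>])
    have m': "x < A i" if "i < m" for i
      using not_less_Least[of i "\<lambda>m. A m \<le> x"] that by (simp only: m_def not_le)
    have "N < m"
    proof (rule ccontr)
      assume "\<not> N < m"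
      then have "A N \<le> A m" using decseqD[OF \<open>decseq A\<close>] by simp
      with m x show False by linarith
    qed
    then obtain n where n: "m = Suc n" "n \<ge> N" by (cases m) auto
    have contn: "continuous_on UNIV (\<phi> ^^ n)"
      by (induction n) (auto simp: o_def intro: continuous_on_compose2[OF cont])
    have "\<phi> a \<le> a" using dec[of 0] by (simp add: A_def)
    moreover have "(\<phi> ^^ n) (\<phi> a) \<le> x" using m n by (simp add: A_def funpow_swap1)
    moreover have "x \<le> (\<phi> ^^ n) a" using m'[of n] n by (simp add: A_def)
    ultimately obtain y where y: "\<phi> a \<le> y" "y \<le> a" "(\<phi> ^^ n) y = x"
      using IVT'[of "\<phi> ^^ n" "\<phi> a" x a] continuous_on_subset[OF contn] by auto
    have "(\<Sum>j<n. D j y) \<le> (\<Sum>j<n. C * len j)" by (intro sum_mono Dle y)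
    also have "\<dots> = C * (\<Sum>j<n. len j)" by (simp add: sum_distrib_left)
    also have "\<dots> \<le> C * (a - p)" using C len_sum_le by (intro mult_left_mono) auto
    finally have "(\<Sum>j<n. D j y) \<le> C * (a - p)" .
    moreover have "D n y \<le> 1 / 2" using Dle[OF y(1,2), of n] N[OF n(2)] by simp
    ultimately show "\<exists>n y. (\<phi> ^^ n) y = x \<and> (\<Sum>j<n. D j y) \<le> C * (a - p) \<and> D n y \<le> 1 / 2"
      using y(3) by blast
  qed
qed

text \<open>Conjugation with \<open>t \<mapsto> - t\<close>. The reflected map is in general no lift
  of a group element, which is why \<open>parabolic_exit\<close> speaks of abstract \<open>d\<close>
  and \<open>D\<close> instead of \<open>dd\<close>.\<close>

lemma parabolic_exit_left:
  fixes \<phi> d :: "real \<Rightarrow> real" and D :: "nat \<Rightarrow> real \<Rightarrow> real"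
  assumes cont: "continuous_on UNIV \<phi>" and mono: "strict_mono \<phi>"
    and p: "\<phi> p = p" "a < p" and contr: "\<And>t. t < p \<Longrightarrow> a \<le> t \<Longrightarrow> t < \<phi> t"
    and L: "L \<ge> 0" "\<And>s t. \<bar>ln (d s) - ln (d t)\<bar> \<le> L * \<bar>s - t\<bar>" and d: "\<And>t. d t > 0"
    and D: "\<And>t. D 0 t = 1" "\<And>n t. D (Suc n) t = d ((\<phi> ^^ n) t) * D n t"
    and K: "K > 0" and mvt: "\<And>n s t. s < t \<Longrightarrow>
          \<exists>u. s < u \<and> u < t \<and> D n u * (t - s) \<le> K * ((\<phi> ^^ n) t - (\<phi> ^^ n) s)"
  shows "\<exists>B. \<exists>q<p. \<forall>x. q < x \<and> x < p \<longrightarrow>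
           (\<exists>n y. (\<phi> ^^ n) y = x \<and> (\<Sum>j<n. D j y) \<le> B \<and> D n y \<le> 1 / 2)"
proof -
  define \<psi> where "\<psi> t = - \<phi> (- t)" for t
  have pow: "(\<psi> ^^ n) t = - (\<phi> ^^ n) (- t)" for n t
    by (induction n) (simp_all add: \<psi>_def)
  have "\<exists>B. \<exists>q>-p. \<forall>x. -p < x \<and> x < q \<longrightarrow>
           (\<exists>n y. (\<psi> ^^ n) y = x \<and> (\<Sum>j<n. D j (- y)) \<le> B \<and> D n (- y) \<le> 1 / 2)"
  proof (rule parabolic_exit[where d = "\<lambda>t. d (- t)" and a = "- a" and L = L and K = K])
    show "continuous_on UNIV \<psi>"
      unfolding \<psi>_def by (intro continuous_intros continuous_on_compose2[OF cont]) auto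
    show "strict_mono \<psi>" using mono by (simp add: strict_mono_def \<psi>_def)
    show "\<psi> (- p) = - p" "- p < - a" using p by (simp_all add: \<psi>_def)
    show "\<psi> t < t" if "- p < t" "t \<le> - a" for t
      using contr[of "- t"] that by (simp add: \<psi>_def)
    show "\<bar>ln (d (- s)) - ln (d (- t))\<bar> \<le> L * \<bar>s - t\<bar>" for s t
      using L(2)[of "- s" "- t"] by (simp add: abs_minus_commute)
    show "\<exists>u>s. u < t \<and> D n (- u) * (t - s) \<le> K * ((\<psi> ^^ n) t - (\<psi> ^^ n) s)" if st: "s < t" for n s t
    proof -
      obtain u where "- t < u" "u < - s" "D n u * (- s - - t) \<le> K * ((\<phi> ^^ n) (- s) - (\<phi> ^^ n) (- t))"
        using mvt[of "- t" "- s" n] st by auto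
      then show ?thesis by (intro exI[of _ "- u"]) (simp add: pow)
    qed
  qed (use L d D K in \<open>auto simp: pow\<close>)
  then obtain B q where q: "q > - p" "\<And>x. - p < x \<Longrightarrow> x < q \<Longrightarrow>
           (\<exists>n y. (\<psi> ^^ n) y = x \<and> (\<Sum>j<n. D j (- y)) \<le> B \<and> D n (- y) \<le> 1 / 2)" by blast
  show ?thesis
  proof (rule exI[of _ B], rule exI[of _ "- q"], intro conjI allI impI)
    show "- q < p" using q(1) by simp
    fix x assume "- q < x \<and> x < p"
    then obtain n y where "(\<psi> ^^ n) y = - x" "(\<Sum>j<n. D j (- y)) \<le> B" "D n (- y) \<le> 1 / 2"
      using q(2)[of "- x"] by auto
    then show "\<exists>n y. (\<phi> ^^ n) y = x \<and> (\<Sum>j<n. D j y) \<le> B \<and> D n y \<le> 1 / 2"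
      by (intro exI[of _ n] exI[of _ "- y"]) (simp add: pow)
  qed
qed

context circle_group
begin

subsection \<open>Words and distortion\<close>

text \<open>In \<open>word \<Phi> h y S\<close> the map \<open>h\<close> is a composition of letters from \<open>\<Phi>\<close>, and \<open>S\<close> is the sum of the
  derivatives at \<open>y\<close> of its proper partial compositions. This sum controls the distortion of \<open>h\<close>
  near \<open>y\<close>.\<close>

inductive word :: "(real \<Rightarrow> real) set \<Rightarrow> (real \<Rightarrow> real) \<Rightarrow> real \<Rightarrow> real \<Rightarrow> bool" for \<Phi> where
  word_Nil: "word \<Phi> (\<lambda>t. t) y 0"
| word_Cons: "word \<Phi> h y S \<Longrightarrow> \<phi> \<in> \<Phi> \<Longrightarrow> word \<Phi> (\<lambda>t. \<phi> (h t)) y (S + dd h y)"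

lemma word_lift: "word \<Phi> h y S \<Longrightarrow> \<Phi> \<subseteq> lifts \<Longrightarrow> h \<in> lifts"
  by (induction rule: word.induct) (auto intro: lift_id lift_comp)

lemma word_mono: "word \<Phi> h y S \<Longrightarrow> \<Phi> \<subseteq> \<Phi>' \<Longrightarrow> word \<Phi>' h y S"
  by (induction rule: word.induct) (auto intro: word.intros)

lemma word_2pi: "word \<Phi> h y S \<Longrightarrow> \<Phi> \<subseteq> lifts \<Longrightarrow> word \<Phi> h (y + 2 * pi * of_int k) S"
proof (induction rule: word.induct)
  case (word_Nil y)
  show ?case by (rule word.word_Nil)
next
  case (word_Cons h y S \<phi>)
  then have "dd h (y + 2 * pi * of_int k) = dd h y" using dd_2pi word_lift by blast
  with word.word_Cons[of \<Phi> h "y + 2 * pi * of_int k" S \<phi>] word_Cons show ?case by simp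
qed

text \<open>\<open>h\<close> acts first, so its derivative sum is kept, and by the chain rule that
  of \<open>h0\<close> is multiplied by \<open>dd h y\<close>.\<close>

lemma word_append:
  assumes "word \<Phi> h0 y0 S0" "word \<Phi> h y S" "h y = y0" "\<Phi> \<subseteq> lifts"
  shows "word \<Phi> (\<lambda>t. h0 (h t)) y (S + S0 * dd h y)"
  using assms
proof (induction rule: word.induct)
  case (word_Nil y0)
  then show ?case by simp
next
  case (word_Cons h1 y0 S1 \<phi>)
  then have 1: "word \<Phi> (\<lambda>t. h1 (h t)) y (S + S1 * dd h y)" by blast
  have "dd (\<lambda>t. h1 (h t)) y = dd h1 y0 * dd h y"
    using dd_comp[of h1 h y] word_lift word_Cons by blast
  then show ?case using word.word_Cons[OF 1 \<open>\<phi> \<in> \<Phi>\<close>] by (simp add: algebra_simps)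
qed

lemma finite_lipschitz:
  assumes "finite \<Phi>" "\<Phi> \<subseteq> lifts"
  obtains L where "L \<ge> 0" "\<And>\<phi> s t. \<phi> \<in> \<Phi> \<Longrightarrow> \<bar>ln (dd \<phi> s) - ln (dd \<phi> t)\<bar> \<le> L * \<bar>s - t\<bar>"
proof -
  have "\<forall>\<phi>\<in>\<Phi>. \<exists>L\<ge>0. \<forall>s t. \<bar>ln (dd \<phi> s) - ln (dd \<phi> t)\<bar> \<le> L * \<bar>s - t\<bar>"
    using dd_lipschitz assms(2) by (metis subsetD)
  from bchoice[OF this] obtain L where L: "\<And>\<phi>. \<phi> \<in> \<Phi> \<Longrightarrow> L \<phi> \<ge> 0"
    "\<And>\<phi> s t. \<phi> \<in> \<Phi> \<Longrightarrow> \<bar>ln (dd \<phi> s) - ln (dd \<phi> t)\<bar> \<le> L \<phi> * \<bar>s - t\<bar>" by blast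
  show ?thesis
  proof (rule that[of "sum L \<Phi>"])
    show "sum L \<Phi> \<ge> 0" using L(1) by (rule sum_nonneg)
    fix \<phi> s t assume \<phi>: "\<phi> \<in> \<Phi>"
    have "L \<phi> \<le> sum L \<Phi>" using assms(1) L(1) by (intro member_le_sum \<phi>) auto
    then have "L \<phi> * \<bar>s - t\<bar> \<le> sum L \<Phi> * \<bar>s - t\<bar>" by (rule mult_right_mono) simp
    with L(2)[OF \<phi>] show "\<bar>ln (dd \<phi> s) - ln (dd \<phi> t)\<bar> \<le> sum L \<Phi> * \<bar>s - t\<bar>"
      by (rule order_trans)
  qed
qed

lemma dd_le_if_ln_close:
  assumes "F \<in> lifts" "\<bar>ln (dd F u) - ln (dd F y)\<bar> \<le> 1" shows "dd F u \<le> exp 1 * dd F y"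
proof -
  have "ln (dd F u) \<le> ln (exp 1 * dd F y)" using assms by (simp add: ln_mult)
  then show ?thesis using assms(1) by (subst (asm) ln_le_cancel_iff) auto
qed

text \<open>A bootstrap over the letters. While the distortion of \<open>h\<close> is at most 1 on
  the radius \<open>\<eta>\<close>, points of that interval are moved to within a constant times
  \<open>\<eta> * dd h y\<close> of \<open>h y\<close>, so the next letter adds at most a multiple
  of this to the distortion. The total is \<open>q * \<eta> * S\<close>, whence a radius that
  depends on \<open>B\<close> but not on the number of letters.\<close>

lemma word_distortion:
  assumes "finite \<Phi>" "\<Phi> \<subseteq> lifts"
  obtains \<eta> where "\<eta> > 0"
    "\<And>h y S s. word \<Phi> h y S \<Longrightarrow> S \<le> B \<Longrightarrow> \<bar>s - y\<bar> \<le> \<eta> \<Longrightarrow> \<bar>ln (dd h s) - ln (dd h y)\<bar> \<le> 1"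
proof -
  obtain L where L: "L \<ge> 0" "\<And>\<phi> s t. \<phi> \<in> \<Phi> \<Longrightarrow> \<bar>ln (dd \<phi> s) - ln (dd \<phi> t)\<bar> \<le> L * \<bar>s - t\<bar>"
    using finite_lipschitz[OF assms] by blast
  obtain K where K: "K \<ge> 1" "\<And>s t. r s \<le> K * r t" using r_comparable by blast
  define q where "q = L * K * exp 1"
  have q: "q \<ge> 0" using L K by (simp add: q_def)
  \<comment> \<open>Chosen so that \<open>q * \<eta> * S \<le> 1\<close> for all
    \<open>S \<le> B\<close>; the absolute value and the added 1 allow for \<open>B\<close> of any
    sign and for \<open>q = 0\<close>.\<close>
  define \<eta> where "\<eta> = 1 / (q * \<bar>B\<bar> + 1)"
  have \<eta>: "\<eta> > 0" using q by (simp add: \<eta>_def add_nonneg_pos)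
  have small: "q * \<eta> * S \<le> 1" if "S \<le> B" for S
  proof -
    have "q * S \<le> q * \<bar>B\<bar> + 1" using q that by (smt (verit) mult_left_mono)
    moreover have "0 < 1 + q * \<bar>B\<bar>" using q by (simp add: add_pos_nonneg)
    ultimately show ?thesis by (simp add: \<eta>_def field_simps)
  qed
  have "\<forall>s. \<bar>s - y\<bar> \<le> \<eta> \<longrightarrow> \<bar>ln (dd h s) - ln (dd h y)\<bar> \<le> q * \<eta> * S"
    if "word \<Phi> h y S" "S \<le> B" for h y S
    using that
  proof (induction rule: word.induct)
    case (word_Nil y)
    then show ?case by simp
  next
    case (word_Cons h y S \<phi>)
    have h: "h \<in> lifts" "\<phi> \<in> lifts" using word_lift word_Cons assms by auto
    have "dd h y > 0" using h by simp
    then have S: "S \<le> B" using word_Cons by linarith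
    show ?case
    proof (intro allI impI)
      fix s assume s: "\<bar>s - y\<bar> \<le> \<eta>"
      have "dd h u \<le> exp 1 * dd h y" if "\<bar>u - y\<bar> \<le> \<bar>s - y\<bar>" for u
      proof -
        have "\<bar>ln (dd h u) - ln (dd h y)\<bar> \<le> 1"
          using word_Cons(3) S small[OF S] that s by (meson order_trans)
        then show ?thesis by (rule dd_le_if_ln_close[OF h(1)])
      qed
      then have "\<bar>h s - h y\<bar> \<le> K * (exp 1 * dd h y) * \<bar>s - y\<bar>"
        by (rule lift_diff_le[OF h(1) K(2)])
      also have "\<dots> \<le> K * (exp 1 * dd h y) * \<eta>" using s K h(1) by (intro mult_left_mono) (auto simp: less_imp_le)
      finally have "L * \<bar>h s - h y\<bar> \<le> L * (K * (exp 1 * dd h y) * \<eta>)" using L(1) by (rule mult_left_mono)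
      then have "\<bar>ln (dd \<phi> (h s)) - ln (dd \<phi> (h y))\<bar> \<le> q * \<eta> * dd h y"
        using L(2)[OF word_Cons(2), of "h s" "h y"] by (simp add: q_def mult_ac)
      moreover have "\<bar>ln (dd h s) - ln (dd h y)\<bar> \<le> q * \<eta> * S" using word_Cons(3) S s by blast
      moreover have "ln (dd (\<lambda>t. \<phi> (h t)) t) = ln (dd \<phi> (h t)) + ln (dd h t)" for t
        using h by (simp add: dd_comp ln_mult)
      ultimately show "\<bar>ln (dd (\<lambda>t. \<phi> (h t)) s) - ln (dd (\<lambda>t. \<phi> (h t)) y)\<bar> \<le> q * \<eta> * (S + dd h y)"
        by (simp add: algebra_simps)
    qed
  qed
  with \<eta> small that show ?thesis by (meson order_trans)
qed

subsection \<open>Uniform expansion\<close>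

text \<open>The map that expands at \<open>x\<close> is the inverse of \<open>h\<close>. Recording
  the contraction instead puts the derivative sum at \<open>y\<close>, around which the arc has
  fixed size.\<close>

definition expands :: "(real \<Rightarrow> real) set \<Rightarrow> real \<Rightarrow> real \<Rightarrow> real \<Rightarrow> bool" where
  "expands \<Phi> \<kappa> B x \<longleftrightarrow> (\<exists>h y S. word \<Phi> h y S \<and> h y = x \<and> S \<le> B \<and> dd h y \<le> \<kappa>)"

lemma expands_mono: "expands \<Phi> \<kappa> B x \<Longrightarrow> \<Phi> \<subseteq> \<Phi>' \<Longrightarrow> \<kappa> \<le> \<kappa>' \<Longrightarrow> B \<le> B' \<Longrightarrow> expands \<Phi>' \<kappa>' B' x"
proof -
  assume le: "\<Phi> \<subseteq> \<Phi>'" "\<kappa> \<le> \<kappa>'" "B \<le> B'" and "expands \<Phi> \<kappa> B x"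
  then obtain h y S where "word \<Phi> h y S" "h y = x" "S \<le> B" "dd h y \<le> \<kappa>"
    by (auto simp: expands_def)
  then have "word \<Phi>' h y S \<and> h y = x \<and> S \<le> B' \<and> dd h y \<le> \<kappa>'"
    using le word_mono by auto
  then show ?thesis unfolding expands_def by blast
qed

lemma expands_2pi: assumes "expands \<Phi> \<kappa> B x" "\<Phi> \<subseteq> lifts" shows "expands \<Phi> \<kappa> B (x + 2 * pi * of_int k)"
proof -
  obtain h y S where *: "word \<Phi> h y S" "h y = x" "S \<le> B" "dd h y \<le> \<kappa>"
    using assms by (auto simp: expands_def)
  have h: "h \<in> lifts" using * assms word_lift by blast
  show ?thesis unfolding expands_def
    using * word_2pi[OF *(1) assms(2), of k] dd_2pi[OF h] lift_add_2pi_int[OF h] by metis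
qed

text \<open>One letter suffices, the inverse of an element that expands by more than
  \<open>c > 1\<close> near \<open>p\<close>. The bound 1 on the sum is the derivative of the empty
  composition.\<close>

lemma not_NE_expands:
  assumes "cis p \<notin> NE \<rho> G"
  shows "\<exists>U \<Phi> \<kappa> B. open U \<and> p \<in> U \<and> finite \<Phi> \<and> \<Phi> \<subseteq> lifts \<and> \<kappa> < 1 \<and> (\<forall>x\<in>U. expands \<Phi> \<kappa> B x)"
proof -
  obtain g where g: "g \<in> G" "metric_deriv \<rho> g (cis p) > 1" using assms by (auto simp: NE_def not_le)
  obtain F where F: "F \<in> lifts" "\<And>t. g (cis t) = cis (F t)" using lift_exists g by blast
  obtain H where H: "H \<in> lifts" "\<And>t. H (F t) = t" "\<And>t. F (H t) = t" by (rule lift_inv[OF F(1)]) (rule that)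
  obtain c where c: "1 < c" "c < dd F p" using g metric_deriv_eq_dd[OF g(1) F] dense by metis
  have op: "open {t. c < dd F t}" by (intro open_Collect_less dd_continuous F continuous_intros)
  have "expands {H} (1 / c) 1 x" if "c < dd F x" for x
  proof -
    have "dd H (F x) = 1 / dd F x" using dd_inverse[OF H(1) F(1)] H by blast
    also have "\<dots> \<le> 1 / c" using that c by (simp add: frac_le)
    finally have "dd H (F x) \<le> 1 / c" .
    moreover have "word {H} (\<lambda>t. H t) (F x) (0 + dd (\<lambda>t. t) (F x))"
      by (rule word_Cons[OF word_Nil]) simp
    ultimately show ?thesis unfolding expands_def using H by fastforce
  qed
  then show ?thesis
    using op c H(1) by (intro exI[of _ "{t. c < dd F t}"] exI[of _ "{H}"] exI[of _ "1 / c"] exI[of _ 1]) auto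
qed

lemma funpow_lift: "F \<in> lifts \<Longrightarrow> F ^^ n \<in> lifts"
  by (induction n) (use lift_id lift_comp in \<open>auto simp: o_def id_def\<close>)

lemma word_funpow: assumes "F \<in> lifts" shows "word {F} (F ^^ n) y (\<Sum>j<n. dd (F ^^ j) y)"
proof (induction n)
  case 0 then show ?case using word_Nil[of "{F}" y] by (simp add: id_def)
next
  case (Suc n) then show ?case using word_Cons[OF Suc, of F] by (simp add: o_def)
qed

text \<open>The facts that \<open>parabolic_exit\<close> asks of \<open>d = dd F\<close> and
  \<open>D n = dd (F ^^ n)\<close>.\<close>

lemma dd_funpow:
  assumes F: "F \<in> lifts" and K: "K \<ge> 1" "\<And>s t. r s \<le> K * r t"
  shows "dd (F ^^ 0) t = 1" "dd (F ^^ Suc n) t = dd F ((F ^^ n) t) * dd (F ^^ n) t"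
    "s < t \<Longrightarrow> \<exists>u. s < u \<and> u < t \<and> dd (F ^^ n) u * (t - s) \<le> K * ((F ^^ n) t - (F ^^ n) s)"
proof -
  show "dd (F ^^ 0) t = 1" by (simp add: id_def)
  show "dd (F ^^ Suc n) t = dd F ((F ^^ n) t) * dd (F ^^ n) t"
    using dd_comp[OF F funpow_lift[OF F, of n]] by (simp add: o_def)
  assume st: "s < t"
  obtain u where u: "s < u" "u < t" "(F ^^ n) t - (F ^^ n) s = (t - s) * (dd (F ^^ n) u * (r u / r ((F ^^ n) u)))"
    using lift_mvt[OF funpow_lift[OF F, of n] st] by blast
  have "1 \<le> K * (r u / r ((F ^^ n) u))" using K(2) by (simp add: field_simps)
  then have "dd (F ^^ n) u * (t - s) * 1 \<le> dd (F ^^ n) u * (t - s) * (K * (r u / r ((F ^^ n) u)))"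
    using st dd_pos[OF funpow_lift[OF F, of n], of u] by (intro mult_left_mono) auto
  with u(3) have "dd (F ^^ n) u * (t - s) \<le> K * ((F ^^ n) t - (F ^^ n) s)" by (simp add: mult_ac)
  with u show "\<exists>u. s < u \<and> u < t \<and> dd (F ^^ n) u * (t - s) \<le> K * ((F ^^ n) t - (F ^^ n) s)" by blast
qed

text \<open>\<open>F t - t\<close> has constant sign on \<open>I\<close>; where it is the wrong one,
  the inverse lift has the other.\<close>

lemma fixed_point_contraction:
  assumes F: "F \<in> lifts" "F p = p" and I: "connected I" "\<And>t. t \<in> I \<Longrightarrow> F t \<noteq> t"
  shows "\<exists>\<phi>\<in>lifts. \<phi> p = p \<and> (\<forall>t\<in>I. \<phi> t < t)" "\<exists>\<phi>\<in>lifts. \<phi> p = p \<and> (\<forall>t\<in>I. \<phi> t > t)"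
proof -
  obtain H where H: "H \<in> lifts" "\<And>t. H (F t) = t" "\<And>t. F (H t) = t" by (rule lift_inv[OF F(1)]) (rule that)
  have Hp: "H p = p" using H(2)[of p] F by simp
  have Hlt: "H t < t \<longleftrightarrow> t < F t" "t < H t \<longleftrightarrow> F t < t" for t
    using lift_less[OF F(1), of "H t" t] lift_less[OF F(1), of t "H t"] H(3) by auto
  have "(\<forall>t\<in>I. F t < t) \<or> (\<forall>t\<in>I. F t > t)"
  proof (rule ccontr)
    assume "\<not> ?thesis"
    then obtain s t where st: "s \<in> I" "F s > s" "t \<in> I" "F t < t" using I(2) by (meson linorder_neqE)
    have "connected ((\<lambda>t. F t - t) ` I)"
      by (intro connected_continuous_image I continuous_intros lift_continuous F)
    then have "{F t - t..F s - s} \<subseteq> (\<lambda>t. F t - t) ` I" using st connected_contains_Icc by blast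
    then have "0 \<in> (\<lambda>t. F t - t) ` I" using st by (auto simp: subset_iff)
    then show False using I(2) by auto
  qed
  then show "\<exists>\<phi>\<in>lifts. \<phi> p = p \<and> (\<forall>t\<in>I. \<phi> t < t)" "\<exists>\<phi>\<in>lifts. \<phi> p = p \<and> (\<forall>t\<in>I. \<phi> t > t)"
    using F H(1) Hp Hlt by blast+
qed

lemma fixing_lift:
  assumes "g \<in> G" "g (cis p) = cis p"
  obtains F where "F \<in> lifts" "F p = p" "\<And>t. g (cis t) = cis (F t)"
proof -
  obtain F where F: "F \<in> lifts" "\<And>t. g (cis t) = cis (F t)" using lift_exists assms by blast
  then obtain k :: int where k: "F p = p + 2 * pi * of_int k" using assms cis_eq_cis_iff by metis
  show ?thesis
    using that[OF lift_shift[OF F(1), of "- k"]] k F(2) cis_add_2pi_int[of _ "- k"] by simp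
qed

text \<open>On each side a lift moving points towards \<open>p\<close> is chosen; its inverse
  iterates push points out of the neighbourhood. At \<open>p\<close> itself nothing is gained, so it
  is left out.\<close>

lemma isolated_fixers_expands:
  assumes "isolated_fixers G (cis p)"
  shows "\<exists>U \<Phi> \<kappa> B. open U \<and> p \<in> U \<and> finite \<Phi> \<and> \<Phi> \<subseteq> lifts \<and> \<kappa> < 1 \<and> (\<forall>x\<in>U - {p}. expands \<Phi> \<kappa> B x)"
proof -
  obtain gp gm \<epsilon> where g: "gp \<in> G" "gm \<in> G" "gp (cis p) = cis p" "gm (cis p) = cis p" and \<epsilon>: "\<epsilon> > 0"
    and iso: "\<And>t. t \<in> {0<..<\<epsilon>} \<Longrightarrow> gp (cis p * cis t) \<noteq> cis p * cis t"
       "\<And>t. t \<in> {0<..<\<epsilon>} \<Longrightarrow> gm (cis p * cis (- t)) \<noteq> cis p * cis (- t)"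
    using assms by (auto simp: isolated_fixers_def)
  obtain Fp where Fp: "Fp \<in> lifts" "Fp p = p" "\<And>t. gp (cis t) = cis (Fp t)" using fixing_lift g by blast
  obtain Fm where Fm: "Fm \<in> lifts" "Fm p = p" "\<And>t. gm (cis t) = cis (Fm t)" using fixing_lift g by blast
  have "Fp t \<noteq> t" if "t \<in> {p<..<p + \<epsilon>}" for t
    using iso(1)[of "t - p"] Fp(3)[of t] that by (auto simp: cis_mult)
  then obtain \<phi> where \<phi>: "\<phi> \<in> lifts" "\<phi> p = p" "\<And>t. t \<in> {p<..<p + \<epsilon>} \<Longrightarrow> \<phi> t < t"
    using fixed_point_contraction(1)[OF Fp(1,2), of "{p<..<p + \<epsilon>}"] by auto
  have "Fm t \<noteq> t" if "t \<in> {p - \<epsilon><..<p}" for t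
    using iso(2)[of "p - t"] Fm(3)[of t] that by (auto simp: cis_mult)
  then obtain \<psi> where \<psi>: "\<psi> \<in> lifts" "\<psi> p = p" "\<And>t. t \<in> {p - \<epsilon><..<p} \<Longrightarrow> t < \<psi> t"
    using fixed_point_contraction(2)[OF Fm(1,2), of "{p - \<epsilon><..<p}"] by auto
  obtain K where K: "K \<ge> 1" "\<And>s t. r s \<le> K * r t" using r_comparable by blast
  obtain L where L: "L \<ge> 0" "\<And>s t. \<bar>ln (dd \<phi> s) - ln (dd \<phi> t)\<bar> \<le> L * \<bar>s - t\<bar>"
    using dd_lipschitz[OF \<phi>(1)] by blast
  obtain L' where L': "L' \<ge> 0" "\<And>s t. \<bar>ln (dd \<psi> s) - ln (dd \<psi> t)\<bar> \<le> L' * \<bar>s - t\<bar>"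
    using dd_lipschitz[OF \<psi>(1)] by blast
  \<comment> \<open>Half of \<epsilon> keeps the closed interval ending at \<open>a\<close> inside
    the open one without fixed points.\<close>
  have "\<exists>B. \<exists>q>p. \<forall>x. p < x \<and> x < q \<longrightarrow>
      (\<exists>n y. (\<phi> ^^ n) y = x \<and> (\<Sum>j<n. dd (\<phi> ^^ j) y) \<le> B \<and> dd (\<phi> ^^ n) y \<le> 1 / 2)"
    by (rule parabolic_exit[where d = "dd \<phi>" and a = "p + \<epsilon> / 2" and L = L and K = K])
      (use \<phi> \<epsilon> L K dd_funpow[OF \<phi>(1) K] lift_continuous lift_strict_mono in auto)
  then obtain B q where q: "q > p" "\<And>x. p < x \<Longrightarrow> x < q \<Longrightarrow>
      (\<exists>n y. (\<phi> ^^ n) y = x \<and> (\<Sum>j<n. dd (\<phi> ^^ j) y) \<le> B \<and> dd (\<phi> ^^ n) y \<le> 1 / 2)" by blast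
  have "\<exists>B. \<exists>q<p. \<forall>x. q < x \<and> x < p \<longrightarrow>
      (\<exists>n y. (\<psi> ^^ n) y = x \<and> (\<Sum>j<n. dd (\<psi> ^^ j) y) \<le> B \<and> dd (\<psi> ^^ n) y \<le> 1 / 2)"
    by (rule parabolic_exit_left[where d = "dd \<psi>" and a = "p - \<epsilon> / 2" and L = L' and K = K])
      (use \<psi> \<epsilon> L' K dd_funpow[OF \<psi>(1) K] lift_continuous lift_strict_mono in auto)
  then obtain B' q' where q': "q' < p" "\<And>x. q' < x \<Longrightarrow> x < p \<Longrightarrow>
      (\<exists>n y. (\<psi> ^^ n) y = x \<and> (\<Sum>j<n. dd (\<psi> ^^ j) y) \<le> B' \<and> dd (\<psi> ^^ n) y \<le> 1 / 2)" by blast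
  have "expands {\<phi>, \<psi>} (1 / 2) (max B B') x" if x: "x \<in> {q'<..<q}" "x \<noteq> p" for x
  proof -
    consider "p < x" "x < q" | "q' < x" "x < p" using x by fastforce
    then show ?thesis
    proof cases
      case 1
      then obtain n y where "(\<phi> ^^ n) y = x" "(\<Sum>j<n. dd (\<phi> ^^ j) y) \<le> B" "dd (\<phi> ^^ n) y \<le> 1 / 2"
        using q(2) by blast
      then have "expands {\<phi>} (1 / 2) B x" unfolding expands_def using word_funpow[OF \<phi>(1)] by blast
      then show ?thesis by (rule expands_mono) auto
    next
      case 2
      then obtain n y where "(\<psi> ^^ n) y = x" "(\<Sum>j<n. dd (\<psi> ^^ j) y) \<le> B'" "dd (\<psi> ^^ n) y \<le> 1 / 2"
        using q'(2) by blast
      then have "expands {\<psi>} (1 / 2) B' x" unfolding expands_def using word_funpow[OF \<psi>(1)] by blast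
      then show ?thesis by (rule expands_mono) auto
    qed
  qed
  then show ?thesis using q(1) q'(1) \<phi>(1) \<psi>(1)
    by (intro exI[of _ "{q'<..<q}"] exI[of _ "{\<phi>, \<psi>}"] exI[of _ "1 / 2"] exI[of _ "max B B'"]) auto
qed

text \<open>The inverse of \<open>h\<close> has derivative \<open>1 / dd h y > 1\<close> at
  \<open>x\<close>. This turns local expansion into finiteness of the set of non-expandable
  points.\<close>

lemma expands_not_NE: assumes "expands \<Phi> \<kappa> B x" "\<Phi> \<subseteq> lifts" "\<kappa> < 1" shows "cis x \<notin> NE \<rho> G"
proof -
  obtain h y S where *: "word \<Phi> h y S" "h y = x" "S \<le> B" "dd h y \<le> \<kappa>"
    using assms by (auto simp: expands_def)
  have h: "h \<in> lifts" using * assms word_lift by blast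
  obtain H where H: "H \<in> lifts" "\<And>t. H (h t) = t" "\<And>t. h (H t) = t"
    by (rule lift_inv[OF h]) (rule that)
  obtain g where g: "g \<in> G" "\<And>t. g (cis t) = cis (H t)" by (rule liftsE[OF H(1)]) (rule that)
  have "metric_deriv \<rho> g (cis x) = dd H (h y)" using metric_deriv_eq_dd[OF g(1) H(1) g(2)] *(2) by simp
  also have "\<dots> = 1 / dd h y" using dd_inverse[OF H(1) h H(2)] .
  also have "\<dots> > 1" using * assms dd_pos[OF h, of y] by simp
  finally show ?thesis using g(1) by (auto simp: NE_def not_le intro!: bexI[of _ g])
qed

text \<open>Each angle \<open>p\<close> over \<open>M\<close> has a neighbourhood in which all
  points, except possibly \<open>p\<close>, expand. Finitely many neighbourhoods cover one period,
  so the constants can be made uniform, and a non-expandable point of \<open>M\<close> must be one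
  of the finitely many centres.\<close>

lemma uniform_expansion:
  assumes M: "closed M" "M \<subseteq> S1" and iso: "\<And>x. x \<in> M \<inter> NE \<rho> G \<Longrightarrow> isolated_fixers G x"
  obtains \<Phi> \<kappa> B where "finite \<Phi>" "\<Phi> \<subseteq> lifts" "0 < \<kappa>" "\<kappa> < 1" "B \<ge> 0"
    "\<And>x. cis x \<in> M - NE \<rho> G \<Longrightarrow> expands \<Phi> \<kappa> B x" "finite (M \<inter> NE \<rho> G)"
proof -
  define C where "C = {0..2 * pi} \<inter> cis -` M"
  have "compact M" using M by (meson bounded_sphere bounded_subset compact_eq_bounded_closed)
  then have C: "compact C" unfolding C_def using M(2) by (intro cis_image_compact_reduce)
  \<comment> \<open>The centre is exempt only when it is non-expandable, so that both local lemmas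
    fit one predicate.\<close>
  define Q where "Q p U \<Phi> \<kappa> B \<longleftrightarrow> open U \<and> p \<in> U \<and> finite \<Phi> \<and> \<Phi> \<subseteq> lifts \<and> \<kappa> < 1 \<and>
      (\<forall>x\<in>U. x \<noteq> p \<or> cis p \<notin> NE \<rho> G \<longrightarrow> expands \<Phi> \<kappa> B x)" for p U \<Phi> \<kappa> B
  have "\<forall>p\<in>C. \<exists>U \<Phi> \<kappa> B. Q p U \<Phi> \<kappa> B"
  proof (rule ballI)
    fix p assume p: "p \<in> C"
    show "\<exists>U \<Phi> \<kappa> B. Q p U \<Phi> \<kappa> B"
    proof (cases "cis p \<in> NE \<rho> G")
      case True
      then have "isolated_fixers G (cis p)" using p iso by (auto simp: C_def)
      from isolated_fixers_expands[OF this] show ?thesis unfolding Q_def using True by (metis Diff_iff singletonD)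
    next
      case False
      from not_NE_expands[OF this] show ?thesis unfolding Q_def by blast
    qed
  qed
  from bchoice[OF this] obtain U where "\<forall>p\<in>C. \<exists>\<Phi> \<kappa> B. Q p (U p) \<Phi> \<kappa> B" ..
  from bchoice[OF this] obtain \<Phi> where "\<forall>p\<in>C. \<exists>\<kappa> B. Q p (U p) (\<Phi> p) \<kappa> B" ..
  from bchoice[OF this] obtain \<kappa> where "\<forall>p\<in>C. \<exists>B. Q p (U p) (\<Phi> p) (\<kappa> p) B" ..
  from bchoice[OF this] obtain B where Q: "\<forall>p\<in>C. Q p (U p) (\<Phi> p) (\<kappa> p) (B p)" ..
  have U: "\<And>p. p \<in> C \<Longrightarrow> open (U p)" "\<And>p. p \<in> C \<Longrightarrow> p \<in> U p"
    and \<Phi>: "\<And>p. p \<in> C \<Longrightarrow> finite (\<Phi> p)" "\<And>p. p \<in> C \<Longrightarrow> \<Phi> p \<subseteq> lifts" and \<kappa>: "\<And>p. p \<in> C \<Longrightarrow> \<kappa> p < 1"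
    and ex: "\<And>p x. p \<in> C \<Longrightarrow> x \<in> U p \<Longrightarrow> x \<noteq> p \<or> cis p \<notin> NE \<rho> G \<Longrightarrow> expands (\<Phi> p) (\<kappa> p) (B p) x"
    using Q unfolding Q_def by simp_all
  obtain T where T: "T \<subseteq> C" "finite T" "C \<subseteq> (\<Union>p\<in>T. U p)"
    using compactE_image[OF C, of C U] U by blast
  define \<Phi>' where "\<Phi>' = (\<Union>p\<in>T. \<Phi> p)"
  \<comment> \<open>Inserting 1/2 keeps the maximum positive, and defined even for an empty cover; 0
    plays the same part for \<open>B'\<close>.\<close>
  define \<kappa>' where "\<kappa>' = Max (insert (1 / 2) (\<kappa> ` T))"
  define B' where "B' = Max (insert 0 (B ` T))"
  have 1: "finite \<Phi>'" "\<Phi>' \<subseteq> lifts"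
    unfolding \<Phi>'_def by (intro finite_UN_I T \<Phi>(1), use T in blast) (intro UN_least \<Phi>(2), use T in blast)
  have "\<kappa> p < 1" if "p \<in> T" for p using that T(1) \<kappa> by blast
  then have "\<kappa>' < 1" unfolding \<kappa>'_def using T(2) by (subst Max_less_iff) auto
  moreover have "\<kappa>' \<ge> 1 / 2" unfolding \<kappa>'_def using T(2) by (intro Max_ge) auto
  moreover have "B' \<ge> 0" unfolding B'_def using T(2) by (intro Max_ge) auto
  ultimately have \<kappa>': "\<kappa>' < 1" "\<kappa>' \<ge> 1 / 2" "B' \<ge> 0" by blast+
  have ex': "expands \<Phi>' \<kappa>' B' x" if "p \<in> T" "x \<in> U p" "x \<noteq> p \<or> cis p \<notin> NE \<rho> G" for p x
  proof (rule expands_mono[OF ex])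
    show "p \<in> C" using that T by blast
    show "\<Phi> p \<subseteq> \<Phi>'" using that by (auto simp: \<Phi>'_def)
    show "\<kappa> p \<le> \<kappa>'" unfolding \<kappa>'_def using that T(2) by (intro Max_ge) auto
    show "B p \<le> B'" unfolding B'_def using that T(2) by (intro Max_ge) auto
  qed (use that in auto)
  have main: "expands \<Phi>' \<kappa>' B' x" if x: "cis x \<in> M - NE \<rho> G" for x
  proof -
    obtain k :: int where k: "x + 2 * pi * of_int k \<in> {0..<2 * pi}" using reduce_2pi by blast
    define x' where "x' = x + 2 * pi * of_int k"
    have cx: "cis x' = cis x" by (simp add: x'_def)
    have "x' \<in> C" using k x cx by (simp add: C_def x'_def)
    then obtain p where "p \<in> T" "x' \<in> U p" using T by blast
    then have "expands \<Phi>' \<kappa>' B' x'" using ex' x cx by (cases "x' = p") auto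
    then have "expands \<Phi>' \<kappa>' B' (x' + 2 * pi * of_int (- k))" using expands_2pi 1 by blast
    then show ?thesis by (simp add: x'_def)
  qed
  have "M \<inter> NE \<rho> G \<subseteq> cis ` T"
  proof
    fix x assume x: "x \<in> M \<inter> NE \<rho> G"
    then obtain x' where x': "x' \<in> {0..<2 * pi}" "x = cis x'" using cis_range_reduce M(2) by blast
    then have "x' \<in> C" using x by (auto simp: C_def)
    then obtain p where p: "p \<in> T" "x' \<in> U p" using T by blast
    have "x' = p"
    proof (rule ccontr)
      assume "x' \<noteq> p"
      then have "expands \<Phi>' \<kappa>' B' x'" using ex' p by blast
      from expands_not_NE[OF this 1(2) \<kappa>'(1)] show False using x x'(2) by simp
    qed
    with p x'(2) show "x \<in> cis ` T" by blast
  qed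
  then have "finite (M \<inter> NE \<rho> G)" using T finite_surj by blast
  with 1 \<kappa>' main that[of \<Phi>' \<kappa>' B'] show ?thesis by auto
qed

text \<open>The base point \<open>y\<close> lies in \<open>X\<close> again and can be expanded in
  turn; the new word \<open>h'\<close> acts before \<open>h\<close>. The sums satisfy
  \<open>S' + S * dd h' y' \<le> B + B / (1 - \<kappa>) * \<kappa>\<close>, and
  \<open>B / (1 - \<kappa>)\<close> is the fixed point of this recursion, so the bound does not grow
  with \<open>n\<close>.\<close>

lemma iterated_expansion:
  assumes \<Phi>: "\<Phi> \<subseteq> lifts" and \<kappa>: "0 < \<kappa>" "\<kappa> < 1" and B: "B \<ge> 0"
    and X: "\<And>g x. g \<in> G \<Longrightarrow> x \<in> X \<Longrightarrow> g x \<in> X"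
    and ex: "\<And>x. cis x \<in> X \<Longrightarrow> expands \<Phi> \<kappa> B x"
  shows "cis x \<in> X \<Longrightarrow> expands \<Phi> (\<kappa> ^ n) (B / (1 - \<kappa>)) x"
proof (induction n)
  case 0
  have "word \<Phi> (\<lambda>t. t) x 0" by (rule word_Nil)
  then show ?case unfolding expands_def using \<kappa> B by (intro exI[of _ "\<lambda>t. t"] exI[of _ x] exI[of _ 0]) auto
next
  case (Suc n)
  then obtain h y S where *: "word \<Phi> h y S" "h y = x" "S \<le> B / (1 - \<kappa>)" "dd h y \<le> \<kappa> ^ n"
    by (auto simp: expands_def)
  have h: "h \<in> lifts" using * assms word_lift by blast
  obtain H where H: "H \<in> lifts" "\<And>t. H (h t) = t" "\<And>t. h (H t) = t"
    by (rule lift_inv[OF h]) (rule that)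
  obtain g where g: "g \<in> G" "\<And>t. g (cis t) = cis (H t)" by (rule liftsE[OF H(1)]) (rule that)
  have "cis y = g (cis x)" using g(2)[of x] H(2)[of y] *(2) by simp
  then have "cis y \<in> X" using X g(1) Suc by simp
  then obtain h' y' S' where **: "word \<Phi> h' y' S'" "h' y' = y" "S' \<le> B" "dd h' y' \<le> \<kappa>"
    using ex[of y] unfolding expands_def by blast
  have h': "h' \<in> lifts" using ** assms word_lift by blast
  have "word \<Phi> (\<lambda>t. h (h' t)) y' (S' + S * dd h' y')"
    using word_append[OF *(1) **(1,2) \<Phi>] .
  moreover have "S' + S * dd h' y' \<le> B / (1 - \<kappa>)"
  proof -
    have "S * dd h' y' \<le> B / (1 - \<kappa>) * dd h' y'"
      using *(3) dd_pos[OF h', of y'] by (intro mult_right_mono) auto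
    also have "\<dots> \<le> B / (1 - \<kappa>) * \<kappa>" using **(4) B \<kappa> by (intro mult_left_mono) auto
    finally have "S' + S * dd h' y' \<le> B + B / (1 - \<kappa>) * \<kappa>" using **(3) by simp
    also have "\<dots> = B / (1 - \<kappa>)" using \<kappa> by (simp add: field_simps)
    finally show ?thesis .
  qed
  moreover have "dd (\<lambda>t. h (h' t)) y' \<le> \<kappa> ^ Suc n"
  proof -
    have "dd h y * dd h' y' \<le> \<kappa> ^ n * \<kappa>"
      using *(4) **(4) dd_pos[OF h, of y] dd_pos[OF h', of y'] \<kappa> by (intro mult_mono) auto
    then show ?thesis using dd_comp[OF h h', of y'] **(2) by (simp add: mult.commute)
  qed
  moreover have "h (h' y') = x" using * ** by simp
  ultimately show ?case unfolding expands_def by blast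
qed

end

section \<open>A covering argument on the circle\<close>

lemma cis_image_shift: "cis ` {a + 2 * pi * of_int k<..<b + 2 * pi * of_int k} = cis ` {a<..<b}"
proof -
  have "{a + 2 * pi * of_int k<..<b + 2 * pi * of_int k} = (\<lambda>t. t + 2 * pi * of_int k) ` {a<..<b}"
    by (auto simp: image_iff intro!: bexI[of _ "_ - 2 * pi * of_int k"])
  then show ?thesis by (simp add: image_image)
qed

lemma Un_intervals:
  fixes t :: real
  assumes "t \<in> {a<..<b}" "t \<in> {c<..<d}"
  shows "{a<..<b} \<union> {c<..<d} = {min a c<..<max b d}"
  using assms by (auto simp: min_def max_def)

text \<open>Two of the intervals can be chosen to attain the least left end and the greatest right
  end of the three. They overlap at \<open>t\<close>, so their union contains the third.\<close>

lemma three_intervals: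
  fixes t :: real
  assumes "t \<in> {a1<..<b1}" "t \<in> {a2<..<b2}" "t \<in> {a3<..<b3}"
  shows "{a1<..<b1} \<subseteq> {a2<..<b2} \<union> {a3<..<b3} \<or> {a2<..<b2} \<subseteq> {a1<..<b1} \<union> {a3<..<b3} \<or>
         {a3<..<b3} \<subseteq> {a1<..<b1} \<union> {a2<..<b2}"
proof -
  have "(min a2 a3 \<le> a1 \<and> b1 \<le> max b2 b3) \<or> (min a1 a3 \<le> a2 \<and> b2 \<le> max b1 b3) \<or>
        (min a1 a2 \<le> a3 \<and> b3 \<le> max b1 b2)" by linarith
  then show ?thesis
    unfolding Un_intervals[OF assms(1,2)] Un_intervals[OF assms(1,3)] Un_intervals[OF assms(2,3)]
    using assms by (auto simp: greaterThanLessThan_subseteq_greaterThanLessThan)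
qed

abbreviation arc_ball :: "real \<Rightarrow> real \<Rightarrow> complex set" where
  "arc_ball y \<eta> \<equiv> cis ` {y - \<eta><..<y + \<eta>}"

definition arcs :: "complex set set" where "arcs = {cis ` {a<..<b} | a b. True}"

lemma arc_at: assumes "A \<in> arcs" "cis t \<in> A" obtains a b where "A = cis ` {a<..<b}" "t \<in> {a<..<b}"
proof -
  obtain a b where ab: "A = cis ` {a<..<b}" using assms by (auto simp: arcs_def)
  then obtain s where s: "s \<in> {a<..<b}" "cis t = cis s" using assms by auto
  then obtain k :: int where k: "t = s + 2 * pi * of_int k" using cis_eq_cis_iff by blast
  show ?thesis
    by (rule that[of "a + 2 * pi * of_int k" "b + 2 * pi * of_int k"])
      (use ab s k cis_image_shift in auto)
qed

text \<open>In a minimal subcover no point lies in three arcs, since one of them would be covered by the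
  other two.\<close>

lemma arcs_subcover:
  assumes "finite \<A>" "\<A> \<subseteq> arcs"
  obtains \<B> where "\<B> \<subseteq> \<A>" "\<Union>\<B> = \<Union>\<A>" "\<And>x. card {B \<in> \<B>. x \<in> B} \<le> 2"
proof -
  define P where "P \<B> \<longleftrightarrow> \<B> \<subseteq> \<A> \<and> \<Union>\<B> = \<Union>\<A>" for \<B>
  have "P \<A>" by (simp add: P_def)
  from ex_has_least_nat[of P, OF this, of card]
  obtain \<B> where \<B>: "P \<B>" "\<And>\<C>. P \<C> \<Longrightarrow> card \<B> \<le> card \<C>" by blast
  have fin: "finite \<B>" using \<B>(1) assms(1) finite_subset by (auto simp: P_def)
  have drop: False if "A \<in> \<B>" "B \<in> \<B>" "C \<in> \<B>" "A \<noteq> B" "A \<noteq> C" "A \<subseteq> B \<union> C" for A B C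
  proof -
    have "\<Union>(\<B> - {A}) = \<Union>\<B>" using that by blast
    then have "P (\<B> - {A})" using \<B>(1) by (auto simp: P_def)
    then have "card \<B> \<le> card (\<B> - {A})" using \<B>(2) by blast
    then show False using fin that(1) card_Diff1_less[OF fin that(1)] by simp
  qed
  have "card {B \<in> \<B>. x \<in> B} \<le> 2" for x
  proof (rule ccontr)
    assume "\<not> card {B \<in> \<B>. x \<in> B} \<le> 2"
    then have "3 \<le> card {B \<in> \<B>. x \<in> B}" by simp
    then obtain T where T: "T \<subseteq> {B \<in> \<B>. x \<in> B}" "card T = 3"
      by (meson obtain_subset_with_card_n)
    then obtain A B C where ABC: "T = {A, B, C}" "A \<noteq> B" "B \<noteq> C" "A \<noteq> C" by (auto simp: card_3_iff)
    have mem: "A \<in> \<B>" "B \<in> \<B>" "C \<in> \<B>" "x \<in> A" "x \<in> B" "x \<in> C" using T ABC by auto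
    then have arc: "A \<in> arcs" "B \<in> arcs" "C \<in> arcs" using \<B>(1) assms(2) by (auto simp: P_def)
    then obtain t where t: "x = cis t" using mem by (auto simp: arcs_def)
    obtain a1 b1 where 1: "A = cis ` {a1<..<b1}" "t \<in> {a1<..<b1}" using arc_at arc(1) mem t by metis
    obtain a2 b2 where 2: "B = cis ` {a2<..<b2}" "t \<in> {a2<..<b2}" using arc_at arc(2) mem t by metis
    obtain a3 b3 where 3: "C = cis ` {a3<..<b3}" "t \<in> {a3<..<b3}" using arc_at arc(3) mem t by metis
    from three_intervals[OF 1(2) 2(2) 3(2)]
    have "A \<subseteq> B \<union> C \<or> B \<subseteq> A \<union> C \<or> C \<subseteq> A \<union> B"
      unfolding 1 2 3 image_Un[symmetric] by (meson image_mono)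
    then show False using drop mem ABC by metis
  qed
  with \<B>(1) that show ?thesis by (auto simp: P_def)
qed

section \<open>Borel sets of the circle and the comparison of measures by fine covers\<close>

lemma space_circle_borel: "space circle_borel = S1"
  by (simp add: circle_borel_def space_restrict_space)

lemma sets_circle_borel: "sets circle_borel = {A \<in> sets borel. A \<subseteq> S1}"
proof -
  have "S1 \<in> sets borel" by (intro borel_closed) simp
  then show ?thesis
    unfolding circle_borel_def using sets_restrict_space_iff[of S1 borel]
    by (auto simp: sets.Int_space_eq2)
qed

lemma sets_circle_closed: "closed A \<Longrightarrow> A \<subseteq> S1 \<Longrightarrow> A \<in> sets circle_borel"
  by (simp add: sets_circle_borel borel_closed)

text \<open>The translates of the interval by multiples of \<open>2 * pi\<close> form the open set
  \<open>V\<close> of all angles of the arc. The rest of the circle is the image of the compact set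
  of angles in one period outside \<open>V\<close>, hence closed.\<close>

lemma arc_open: obtains W where "open W" "cis ` {a<..<b} = W \<inter> S1"
proof -
  define V where "V = (\<Union>k::int. {a + 2 * pi * of_int k<..<b + 2 * pi * of_int k})"
  have V: "t \<in> V \<longleftrightarrow> cis t \<in> cis ` {a<..<b}" for t
  proof
    assume "t \<in> V"
    then obtain k :: int where "t \<in> {a + 2 * pi * of_int k<..<b + 2 * pi * of_int k}" by (auto simp only: V_def)
    then have "cis t \<in> cis ` {a + 2 * pi * of_int k<..<b + 2 * pi * of_int k}" by (rule imageI)
    then show "cis t \<in> cis ` {a<..<b}" by (simp only: cis_image_shift)
  next
    assume "cis t \<in> cis ` {a<..<b}"
    then obtain s where s: "s \<in> {a<..<b}" "cis t = cis s" by blast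
    then obtain k :: int where "t = s + 2 * pi * of_int k" using cis_eq_cis_iff by blast
    with s(1) show "t \<in> V" unfolding V_def by (intro UN_I[of k]) auto
  qed
  define K where "K = cis ` ({0..2 * pi} - V)"
  have "open V" unfolding V_def by (intro open_UN ballI open_greaterThanLessThan)
  then have "compact K" unfolding K_def
    by (intro compact_continuous_image compact_diff continuous_on_cis continuous_on_id) auto
  then have "open (- K)" using compact_imp_closed by blast
  moreover have "cis ` {a<..<b} = (- K) \<inter> S1"
  proof (intro equalityI subsetI)
    fix x assume x: "x \<in> cis ` {a<..<b}"
    have "x \<notin> K"
    proof
      assume "x \<in> K"
      then obtain s where "s \<notin> V" "x = cis s" unfolding K_def by blast
      with V[of s] x show False by simp
    qed
    then show "x \<in> (- K) \<inter> S1" using x by auto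
  next
    fix x assume x: "x \<in> (- K) \<inter> S1"
    then obtain t where t: "t \<in> {0..<2 * pi}" "x = cis t" using cis_range_reduce by blast
    have "t \<in> V"
    proof (rule ccontr)
      assume "t \<notin> V"
      then have "cis t \<in> K" unfolding K_def using t(1) by (intro imageI) simp
      then show False using x t(2) by simp
    qed
    with V[of t] t(2) show "x \<in> cis ` {a<..<b}" by simp
  qed
  ultimately show ?thesis by (rule that)
qed

lemma arc_sets [simp, intro]: "cis ` {a<..<b} \<in> sets circle_borel"
proof -
  obtain W where W: "open W" "cis ` {a<..<b} = W \<inter> S1" using arc_open by blast
  have "S1 \<in> sets borel" by (intro borel_closed) simp
  with W show ?thesis by (simp add: sets_circle_borel borel_open)
qed

text \<open>Integrate the number of members of \<open>\<B>\<close> that contain a point: it is at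
  most 2 on \<open>U\<close> and 0 elsewhere.\<close>

lemma sum_measure_multiplicity:
  assumes "finite_measure m" "finite \<B>" "\<B> \<subseteq> sets m" "\<And>x. card {B \<in> \<B>. x \<in> B} \<le> 2"
    and U: "U \<in> sets m" "\<Union>\<B> \<subseteq> U"
  shows "(\<Sum>B\<in>\<B>. measure m B) \<le> 2 * measure m U"
proof -
  interpret finite_measure m by fact
  have int: "integrable m (indicator B :: _ \<Rightarrow> real)" if "B \<in> sets m" for B
    using that by (simp add: emeasure_eq_measure less_top[symmetric])
  have "(\<Sum>B\<in>\<B>. measure m B) = (\<Sum>B\<in>\<B>. \<integral>x. indicator B x \<partial>m)"
    using assms(3) by (intro sum.cong refl) (auto simp: sets.Int_space_eq2 subset_iff)
  also have "\<dots> = (\<integral>x. (\<Sum>B\<in>\<B>. indicator B x) \<partial>m)"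
    using assms(3) int by (subst Bochner_Integration.integral_sum) auto
  also have "\<dots> \<le> (\<integral>x. 2 * indicator U x \<partial>m)"
  proof (rule integral_mono)
    show "integrable m (\<lambda>x. \<Sum>B\<in>\<B>. indicator B x :: real)"
      using assms(3) int by (intro Bochner_Integration.integrable_sum) auto
    show "integrable m (\<lambda>x. 2 * indicator U x :: real)"
      using int[OF U(1)] by (intro integrable_mult_right) auto
    fix x
    have eq: "(\<Sum>B\<in>\<B>. indicator B x :: real) = card {B \<in> \<B>. x \<in> B}"
      using assms(2) by (simp add: indicator_def sum.If_cases Int_def)
    show "(\<Sum>B\<in>\<B>. indicator B x :: real) \<le> 2 * indicator U x"
    proof (cases "x \<in> U")
      case True then show ?thesis using assms(4)[of x] by (simp add: eq)
    next
      case False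
      then have "{B \<in> \<B>. x \<in> B} = {}" using U(2) by auto
      then show ?thesis using eq False by simp
    qed
  qed
  also have "\<dots> = 2 * measure m U" using U(1) by (simp add: sets.Int_space_eq2)
  finally show ?thesis .
qed

text \<open>A finite subcover is thinned out to multiplicity 2, which is the origin of the factor 2
  and lets the local estimates be summed whatever the sizes of the arcs.\<close>

lemma fine_cover_compact:
  assumes fin: "finite_measure \<nu>" "finite_measure m" and sets: "sets \<nu> = sets circle_borel" "sets m = sets circle_borel"
    and K: "compact K" "K \<subseteq> S1" and U: "U \<in> sets circle_borel" and c: "c \<ge> 0"
    and fine: "\<And>t. cis t \<in> K \<Longrightarrow> \<exists>a b. t \<in> {a<..<b} \<and> cis ` {a<..<b} \<subseteq> U \<and>
        measure \<nu> (cis ` {a<..<b}) \<le> c * measure m (cis ` {a<..<b})"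
  shows "measure \<nu> K \<le> 2 * c * measure m U"
proof -
  define C where "C = {0..2 * pi} \<inter> cis -` K"
  have C: "compact C" unfolding C_def by (intro cis_image_compact_reduce K)
  define Q where "Q t J \<longleftrightarrow> open J \<and> t \<in> J \<and> cis ` J \<in> arcs \<and> cis ` J \<subseteq> U \<and>
      measure \<nu> (cis ` J) \<le> c * measure m (cis ` J)" for t J
  have "\<forall>t\<in>C. \<exists>J. Q t J"
  proof
    fix t assume "t \<in> C"
    then obtain a b where "t \<in> {a<..<b}" "cis ` {a<..<b} \<subseteq> U"
      "measure \<nu> (cis ` {a<..<b}) \<le> c * measure m (cis ` {a<..<b})"
      using fine[of t] by (auto simp: C_def)
    then have "Q t {a<..<b}" by (auto simp: Q_def arcs_def)
    then show "\<exists>J. Q t J" ..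
  qed
  from bchoice[OF this] obtain J where "\<forall>t\<in>C. Q t (J t)" ..
  then have J: "\<And>t. t \<in> C \<Longrightarrow> open (J t)" "\<And>t. t \<in> C \<Longrightarrow> t \<in> J t" "\<And>t. t \<in> C \<Longrightarrow> cis ` J t \<in> arcs"
    and I: "\<And>t. t \<in> C \<Longrightarrow> cis ` J t \<subseteq> U"
      "\<And>t. t \<in> C \<Longrightarrow> measure \<nu> (cis ` J t) \<le> c * measure m (cis ` J t)"
    unfolding Q_def by simp_all
  have "C \<subseteq> (\<Union>t\<in>C. J t)" using J(2) by blast
  from compactE_image[OF C J(1) this]
  obtain T where T: "T \<subseteq> C" "finite T" "C \<subseteq> (\<Union>t\<in>T. J t)" by blast
  define \<A> where "\<A> = (\<lambda>t. cis ` J t) ` T"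
  have "finite \<A>" "\<A> \<subseteq> arcs" using T J(3) by (auto simp: \<A>_def)
  then obtain \<B> where \<B>: "\<B> \<subseteq> \<A>" "\<Union>\<B> = \<Union>\<A>" "\<And>x. card {B \<in> \<B>. x \<in> B} \<le> 2"
    using arcs_subcover by blast
  have finB: "finite \<B>" using \<B>(1) \<open>finite \<A>\<close> finite_subset by blast
  have A: "A \<in> sets circle_borel" "A \<subseteq> U" "measure \<nu> A \<le> c * measure m A" if memA: "A \<in> \<A>" for A
  proof -
    obtain t where t: "t \<in> C" "A = cis ` J t" using memA T(1) by (auto simp: \<A>_def)
    then show "A \<in> sets circle_borel" using J(3)[OF t(1)] by (auto simp: arcs_def)
    show "A \<subseteq> U" "measure \<nu> A \<le> c * measure m A" using I[OF t(1)] t(2) by simp_all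
  qed
  have "K \<subseteq> \<Union>\<B>"
  proof
    fix x assume x: "x \<in> K"
    then obtain t where t: "t \<in> {0..<2 * pi}" "x = cis t" using cis_range_reduce K(2) by blast
    then have "t \<in> C" using x by (auto simp: C_def)
    then obtain s where "s \<in> T" "t \<in> J s" using T(3) by blast
    then have "x \<in> \<Union>\<A>" using t(2) by (auto simp: \<A>_def)
    then show "x \<in> \<Union>\<B>" using \<B>(2) by simp
  qed
  interpret \<nu>: finite_measure \<nu> by fact
  have "measure \<nu> K \<le> measure \<nu> (\<Union>\<B>)"
    using \<open>K \<subseteq> \<Union>\<B>\<close> finB A(1) \<B>(1) sets by (intro \<nu>.finite_measure_mono) (auto simp: subset_iff)
  also have "\<dots> \<le> (\<Sum>B\<in>\<B>. measure \<nu> B)"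
    using \<nu>.finite_measure_subadditive_finite[OF finB, of "\<lambda>B. B"] A(1) \<B>(1) sets by auto
  also have "\<dots> \<le> (\<Sum>B\<in>\<B>. c * measure m B)" using A(3) \<B>(1) by (intro sum_mono) auto
  also have "\<dots> = c * (\<Sum>B\<in>\<B>. measure m B)" by (simp add: sum_distrib_left)
  also have "\<dots> \<le> c * (2 * measure m U)"
    using sum_measure_multiplicity[OF fin(2) finB _ \<B>(3), of U] A(1,2) \<B>(1) sets U c
    by (intro mult_left_mono) auto
  finally show ?thesis by (simp add: mult_ac)
qed

text \<open>Regularity of finite Borel measures on the plane, transported along the inclusion of the
  circle.\<close>

lemma circle_regular:
  assumes fin: "finite_measure \<nu>" and sets: "sets \<nu> = sets circle_borel" and A: "A \<in> sets circle_borel" and e: "e > 0"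
  obtains K W where "compact K" "K \<subseteq> A" "measure \<nu> A \<le> measure \<nu> K + e"
    "open W" "A \<subseteq> W" "measure \<nu> (W \<inter> S1) \<le> measure \<nu> A + e"
proof -
  interpret finite_measure \<nu> by fact
  have sp: "space \<nu> = S1" using sets space_circle_borel sets_eq_imp_space_eq by blast
  have A': "A \<in> sets borel" "A \<subseteq> S1" using A by (auto simp: sets_circle_borel)
  have meas: "(\<lambda>x. x) \<in> \<nu> \<rightarrow>\<^sub>M borel"
    unfolding measurable_cong_sets[OF sets refl] circle_borel_def by (intro measurable_restrict_space1) simp
  define N where "N = distr \<nu> borel (\<lambda>x. x)"
  have N: "sets N = sets borel" by (simp add: N_def)
  have eN: "emeasure N B = ennreal (measure \<nu> (B \<inter> S1))" if "B \<in> sets borel" for B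
    using that meas by (simp add: N_def emeasure_distr sp emeasure_eq_measure Int_commute)
  have fN: "emeasure N (space N) \<noteq> \<infinity>"
    using eN[of UNIV] by (simp add: sets_eq_imp_space_eq[OF N])
  have eA: "emeasure N A = ennreal (measure \<nu> A)" using eN[OF A'(1)] A'(2) by (simp add: Int_absorb2)
  have "emeasure N A < ennreal (measure \<nu> A + e)" using e by (simp add: eA ennreal_less_iff)
  then have "(INF U \<in> {U. A \<subseteq> U \<and> open U}. emeasure N U) < ennreal (measure \<nu> A + e)"
    using outer_regular[OF N fN A'(1)] by simp
  then obtain W where W: "A \<subseteq> W" "open W" "emeasure N W < ennreal (measure \<nu> A + e)"
    by (auto simp: INF_less_iff)
  then have 1: "measure \<nu> (W \<inter> S1) \<le> measure \<nu> A + e"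
    using e eN[OF borel_open[OF W(2)]] by (simp add: ennreal_less_iff del: ennreal_plus)
  \<comment> \<open>If the measure of \<open>A\<close> is at most \<open>e\<close>, the empty set
    serves; otherwise \<open>measure \<nu> A - e\<close> is nonnegative and survives the passage to
    \<open>ennreal\<close>.\<close>
  have "\<exists>K. compact K \<and> K \<subseteq> A \<and> measure \<nu> A \<le> measure \<nu> K + e"
  proof (cases "measure \<nu> A \<le> e")
    case True
    then show ?thesis by (intro exI[of _ "{}"]) auto
  next
    case False
    then have "ennreal (measure \<nu> A - e) < emeasure N A" using e by (simp add: eA ennreal_less_iff)
    then have "ennreal (measure \<nu> A - e) < (SUP K \<in> {K. K \<subseteq> A \<and> compact K}. emeasure N K)"
      using inner_regular[OF N fN A'(1)] by simp
    then obtain K where K: "K \<subseteq> A" "compact K" "ennreal (measure \<nu> A - e) < emeasure N K"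
      by (auto simp: less_SUP_iff)
    then have "measure \<nu> A - e < measure \<nu> (K \<inter> S1)"
      using False by (simp add: eN borel_compact ennreal_less_iff)
    moreover have "K \<inter> S1 = K" using K(1) A'(2) by blast
    ultimately show ?thesis using K by (intro exI[of _ K]) auto
  qed
  with 1 W that show ?thesis by blast
qed

text \<open>Inner approximation by a compact set and outer approximation by an open
  \<open>W\<close>: short enough arcs around points of the compact set stay inside
  \<open>W\<close>.\<close>

lemma fine_cover_measure_le:
  assumes fin: "finite_measure \<nu>" "finite_measure m" and sets: "sets \<nu> = sets circle_borel" "sets m = sets circle_borel"
    and A: "A \<in> sets circle_borel" and c: "c \<ge> 0"
    and fine: "\<And>t w. cis t \<in> A \<Longrightarrow> w > 0 \<Longrightarrow> \<exists>a b. t \<in> {a<..<b} \<and> {a<..<b} \<subseteq> {t - w<..<t + w} \<and>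
        measure \<nu> (cis ` {a<..<b}) \<le> c * measure m (cis ` {a<..<b})"
  shows "measure \<nu> A \<le> 2 * c * measure m A"
proof (rule field_le_epsilon)
  fix e :: real assume e: "e > 0"
  \<comment> \<open>The inner error \<open>d\<close> and the outer error \<open>2 * c * d\<close>
    then add up to \<open>e\<close>.\<close>
  define d where "d = e / (2 * c + 1)"
  have d: "d > 0" using e c by (simp add: d_def)
  obtain K where K: "compact K" "K \<subseteq> A" "measure \<nu> A \<le> measure \<nu> K + d"
    using circle_regular[OF fin(1) sets(1) A d] by metis
  obtain W where W: "open W" "A \<subseteq> W" "measure m (W \<inter> S1) \<le> measure m A + d"
    using circle_regular[OF fin(2) sets(2) A d] by metis
  have AS: "A \<subseteq> S1" using A by (auto simp: sets_circle_borel)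
  have "measure \<nu> K \<le> 2 * c * measure m (W \<inter> S1)"
  proof (rule fine_cover_compact[OF fin sets K(1)])
    show "K \<subseteq> S1" using K AS by blast
    have "S1 \<in> sets borel" by (intro borel_closed) simp
    then show "W \<inter> S1 \<in> sets circle_borel" using W(1) by (simp add: sets_circle_borel borel_open)
    fix t assume t: "cis t \<in> K"
    have "open (cis -` W)" using W(1) by (intro open_vimage) (auto intro: continuous_intros)
    moreover have "t \<in> cis -` W" using t K(2) W(2) by blast
    ultimately obtain w where w: "w > 0" "\<And>s. dist s t < w \<Longrightarrow> cis s \<in> W"
      by (auto simp: open_dist)
    obtain a b where ab: "t \<in> {a<..<b}" "{a<..<b} \<subseteq> {t - w<..<t + w}"
        "measure \<nu> (cis ` {a<..<b}) \<le> c * measure m (cis ` {a<..<b})"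
      using fine[of t w] t K(2) w(1) by blast
    have "cis s \<in> W \<inter> S1" if "s \<in> {a<..<b}" for s
    proof -
      have "s \<in> {t - w<..<t + w}" using that ab(2) by blast
      then have "dist s t < w" by (auto simp: dist_real_def)
      then show ?thesis using w(2) by simp
    qed
    then have "cis ` {a<..<b} \<subseteq> W \<inter> S1" by blast
    with ab show "\<exists>a b. t \<in> {a<..<b} \<and> cis ` {a<..<b} \<subseteq> W \<inter> S1 \<and>
        measure \<nu> (cis ` {a<..<b}) \<le> c * measure m (cis ` {a<..<b})" by blast
  qed (use c in auto)
  also have "\<dots> \<le> 2 * c * (measure m A + d)" using W(3) c by (intro mult_left_mono) auto
  finally have "measure \<nu> A \<le> 2 * c * measure m A + (2 * c * d + d)" using K(3) by (simp add: algebra_simps)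
  moreover have "2 * c * d + d = (2 * c + 1) * d" by (simp add: distrib_right)
  moreover have "2 * c + 1 \<noteq> 0" using c by linarith
  then have "(2 * c + 1) * d = e" unfolding d_def by simp
  ultimately show "measure \<nu> A \<le> 2 * c * measure m A + e" by simp
qed

section \<open>Finite conformal measures\<close>

text \<open>\<open>cis\<close> is a quotient map onto the circle: the angles of one period that map
  into a closed set form a compact set, whose image under \<open>cis\<close> is closed.\<close>

lemma continuous_on_S1_if_cis:
  fixes f :: "complex \<Rightarrow> 'a::topological_space"
  assumes "continuous_on UNIV (\<lambda>t. f (cis t))"
  shows "continuous_on S1 f"
  unfolding continuous_on_closed_invariant
proof (intro allI impI)
  fix B :: "'a set" assume B: "closed B"
  define A where "A = cis ` ({0..2 * pi} \<inter> (\<lambda>t. f (cis t)) -` B)"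
  have "compact ({0..2 * pi} \<inter> (\<lambda>t. f (cis t)) -` B)"
    using assms B by (intro compact_Int_closed closed_vimage) auto
  then have "compact A" unfolding A_def by (intro compact_continuous_image continuous_on_cis continuous_on_id)
  moreover have "A \<inter> S1 = f -` B \<inter> S1"
  proof (intro equalityI subsetI)
    fix x assume x: "x \<in> f -` B \<inter> S1"
    then obtain t where "t \<in> {0..<2 * pi}" "x = cis t" using cis_range_reduce by blast
    then show "x \<in> A \<inter> S1" using x by (auto simp: A_def)
  qed (auto simp: A_def)
  ultimately show "\<exists>A. closed A \<and> A \<inter> S1 = f -` B \<inter> S1" using compact_imp_closed by blast
qed

lemma countable_sets_circle: "countable A \<Longrightarrow> A \<subseteq> S1 \<Longrightarrow> A \<in> sets circle_borel"
  by (simp add: sets_circle_borel sets.countable)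

lemma S1_sets: "S1 \<in> sets circle_borel"
  by (intro sets_circle_closed) auto

context circle_group
begin

lemma G_continuous: "g \<in> G \<Longrightarrow> continuous_on S1 g"
proof (rule continuous_on_S1_if_cis)
  assume "g \<in> G"
  then obtain F where F: "F \<in> lifts" "\<And>t. g (cis t) = cis (F t)" using lift_exists by blast
  show "continuous_on UNIV (\<lambda>t. g (cis t))"
    unfolding F(2) by (intro continuous_on_cis lift_continuous F(1))
qed

lemma metric_deriv_continuous: "g \<in> G \<Longrightarrow> continuous_on S1 (metric_deriv \<rho> g)"
proof (rule continuous_on_S1_if_cis)
  assume g: "g \<in> G"
  then obtain F where F: "F \<in> lifts" "\<And>t. g (cis t) = cis (F t)" using lift_exists by blast
  show "continuous_on UNIV (\<lambda>t. metric_deriv \<rho> g (cis t))"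
    unfolding metric_deriv_eq_dd[OF g F] by (intro dd_continuous F(1))
qed

lemma metric_deriv_pos: "g \<in> G \<Longrightarrow> x \<in> S1 \<Longrightarrow> metric_deriv \<rho> g x > 0"
proof -
  assume g: "g \<in> G" and "x \<in> S1"
  then obtain t where t: "x = cis t" using S1_cis by blast
  obtain F where F: "F \<in> lifts" "\<And>t. g (cis t) = cis (F t)" using lift_exists g by blast
  show ?thesis unfolding t metric_deriv_eq_dd[OF g F] using F(1) by simp
qed

lemma metric_deriv_measurable [measurable]: "g \<in> G \<Longrightarrow> metric_deriv \<rho> g \<in> borel_measurable circle_borel"
  unfolding circle_borel_def by (intro borel_measurable_continuous_on_restrict metric_deriv_continuous)

lemma G_measurable: assumes "g \<in> G" shows "g \<in> circle_borel \<rightarrow>\<^sub>M circle_borel"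
  unfolding circle_borel_def
proof (rule measurable_restrict_space2)
  show "g \<in> space (restrict_space borel S1) \<rightarrow> S1"
    using G_S1[OF assms] by (simp add: space_restrict_space)
  show "g \<in> restrict_space borel S1 \<rightarrow>\<^sub>M borel"
    by (intro borel_measurable_continuous_on_restrict G_continuous assms)
qed

lemma G_image_eq_vimage:
  assumes "g \<in> G" "k \<in> G" "\<forall>x\<in>S1. k (g x) = x \<and> g (k x) = x" "B \<subseteq> S1"
  shows "g ` B = k -` B \<inter> S1"
proof (intro equalityI subsetI)
  fix x assume "x \<in> g ` B"
  then show "x \<in> k -` B \<inter> S1" using assms G_S1[OF assms(1)] by blast
next
  fix x assume x: "x \<in> k -` B \<inter> S1"
  then have "x = g (k x)" using assms by simp
  with x show "x \<in> g ` B" by blast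
qed

lemma G_image_sets: assumes "g \<in> G" "B \<in> sets circle_borel" shows "g ` B \<in> sets circle_borel"
proof -
  obtain k where k: "k \<in> G" "\<forall>x\<in>S1. k (g x) = x \<and> g (k x) = x"
    using G_inv assms by blast
  have BS: "B \<subseteq> S1" using assms by (simp add: sets_circle_borel)
  then have "g ` B = k -` B \<inter> space circle_borel"
    using G_image_eq_vimage[OF assms(1) k BS] by (simp only: space_circle_borel)
  then show ?thesis using measurable_sets[OF G_measurable[OF k(1)] assms(2)] by simp
qed

lemma lift_image_arc:
  assumes F: "F \<in> lifts" and g: "\<And>t. g (cis t) = cis (F t)"
  shows "g ` cis ` {a<..<b} = cis ` {F a<..<F b}"
proof -
  obtain H where H: "H \<in> lifts" "\<And>t. H (F t) = t" "\<And>t. F (H t) = t" by (rule lift_inv[OF F]) (rule that)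
  have "F ` {a<..<b} = {F a<..<F b}"
  proof (intro equalityI subsetI)
    fix x assume "x \<in> {F a<..<F b}"
    then have "H (F a) < H x" "H x < H (F b)" using lift_less[OF H(1)] by auto
    then show "x \<in> F ` {a<..<b}" using H by (intro image_eqI[of x F "H x"]) auto
  qed (use lift_less[OF F] in auto)
  then have "cis ` {F a<..<F b} = (\<lambda>t. cis (F t)) ` {a<..<b}" by (metis image_image)
  then show ?thesis by (simp add: image_image g)
qed

lemma invariant_setI:
  assumes "A \<subseteq> S1" "\<And>g x. g \<in> G \<Longrightarrow> x \<in> A \<Longrightarrow> g x \<in> A"
  shows "invariant_set G A"
proof -
  have "A \<subseteq> g ` A" if g: "g \<in> G" for g
  proof
    fix x assume x: "x \<in> A"
    obtain k where k: "k \<in> G" "\<forall>x\<in>S1. k (g x) = x \<and> g (k x) = x"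
      using G_inv g by blast
    have "x \<in> S1" using x assms(1) by blast
    then have "g (k x) = x" using k(2) by blast
    moreover have "k x \<in> A" using assms(2)[OF k(1) x] .
    ultimately show "x \<in> g ` A" by (metis image_eqI)
  qed
  then show ?thesis using assms unfolding invariant_set_def by blast
qed

lemma invariant_set_complement: assumes A: "invariant_set G A" shows "invariant_set G (S1 - A)"
proof (rule invariant_setI)
  fix g x assume g: "g \<in> G" and x: "x \<in> S1 - A"
  have A': "A \<subseteq> S1" "g ` A = A" using A g by (auto simp: invariant_set_def)
  have "g x \<notin> A"
  proof
    assume "g x \<in> A"
    then obtain z where z: "z \<in> A" "g x = g z" using A'(2) by blast
    then have "x = z" using G_inj[OF g _ _ z(2)] x A'(1) by blast
    then show False using x z(1) by blast
  qed
  then show "g x \<in> S1 - A" using G_S1[OF g] x by blast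
qed auto

text \<open>Not normalised, since restrictions to invariant sets and the differences formed below
  have arbitrary mass, possibly zero.\<close>

definition finite_conformal :: "real \<Rightarrow> complex measure \<Rightarrow> bool" where
  "finite_conformal \<delta> \<mu> \<longleftrightarrow> finite_measure \<mu> \<and> sets \<mu> = sets circle_borel \<and>
     (\<forall>g\<in>G. \<forall>B\<in>sets \<mu>. emeasure \<mu> (g ` B) = (\<integral>\<^sup>+x\<in>B. ennreal (metric_deriv \<rho> g x powr \<delta>) \<partial>\<mu>))"

lemma conformal_exp_iff: "conformal_exp \<rho> G \<delta> \<mu> \<longleftrightarrow> prob_space \<mu> \<and> finite_conformal \<delta> \<mu>"
  unfolding conformal_exp_def circle_prob_def finite_conformal_def
  using prob_space.finite_measure by blast

lemma finite_conformalD: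
  assumes "finite_conformal \<delta> \<mu>"
  shows "finite_measure \<mu>" "sets \<mu> = sets circle_borel" "space \<mu> = S1"
  using assms sets_eq_imp_space_eq[of \<mu> circle_borel]
  by (simp_all add: finite_conformal_def space_circle_borel)

lemma finite_conformal_image:
  assumes "finite_conformal \<delta> \<mu>" "g \<in> G" "B \<in> sets circle_borel"
  shows "emeasure \<mu> (g ` B) = (\<integral>\<^sup>+x\<in>B. ennreal (metric_deriv \<rho> g x powr \<delta>) \<partial>\<mu>)"
  using assms by (auto simp: finite_conformal_def)

lemma finite_conformal_null_image:
  assumes \<mu>: "finite_conformal \<delta> \<mu>" and g: "g \<in> G" and B: "B \<in> sets circle_borel"
  shows "emeasure \<mu> (g ` B) = 0 \<longleftrightarrow> emeasure \<mu> B = 0"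
proof -
  note D = finite_conformalD[OF \<mu>]
  have [measurable]: "metric_deriv \<rho> g \<in> borel_measurable \<mu>" "B \<in> sets \<mu>"
    using metric_deriv_measurable[OF g] D(2) B by (simp_all cong: measurable_cong_sets)
  have "emeasure \<mu> (g ` B) = 0 \<longleftrightarrow>
      (AE x in \<mu>. ennreal (metric_deriv \<rho> g x powr \<delta>) * indicator B x = 0)"
    unfolding finite_conformal_image[OF \<mu> g B] by (intro nn_integral_0_iff_AE) measurable
  also have "\<dots> \<longleftrightarrow> (AE x in \<mu>. x \<notin> B)"
    using metric_deriv_pos[OF g] D(3) by (intro AE_cong) (force simp: indicator_def)
  also have "\<dots> \<longleftrightarrow> emeasure \<mu> B = 0"
    using AE_iff_measurable[of B \<mu> "\<lambda>x. x \<notin> B"] sets.sets_into_space[of B \<mu>] by auto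
  finally show ?thesis .
qed

text \<open>Invariance of \<open>A\<close> and injectivity of \<open>g\<close> let intersection with
  \<open>A\<close> commute with taking images under \<open>g\<close>. Pieces of one measure can then
  be compared as conformal measures in their own right.\<close>

lemma finite_conformal_restrict:
  assumes \<mu>: "finite_conformal \<delta> \<mu>" and A: "A \<in> sets circle_borel" "invariant_set G A"
  obtains \<mu>' where "finite_conformal \<delta> \<mu>'"
    "\<And>B. B \<in> sets circle_borel \<Longrightarrow> emeasure \<mu>' B = emeasure \<mu> (A \<inter> B)"
proof -
  note D = finite_conformalD[OF \<mu>]
  define \<mu>' where "\<mu>' = density \<mu> (indicator A)"
  have A': "A \<in> sets \<mu>" using A D by simp
  have em: "emeasure \<mu>' B = emeasure \<mu> (A \<inter> B)" if "B \<in> sets circle_borel" for B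
  proof -
    have "emeasure \<mu>' B = (\<integral>\<^sup>+x. indicator A x * indicator B x \<partial>\<mu>)"
      unfolding \<mu>'_def using that A' D(2) by (intro emeasure_density) auto
    also have "\<dots> = (\<integral>\<^sup>+x. indicator (A \<inter> B) x \<partial>\<mu>)"
      by (intro nn_integral_cong) (simp add: indicator_def)
    also have "\<dots> = emeasure \<mu> (A \<inter> B)" using that A' D(2) by simp
    finally show ?thesis .
  qed
  have sets': "sets \<mu>' = sets circle_borel" by (simp add: \<mu>'_def D(2))
  have sp: "space \<mu>' = S1" by (simp add: \<mu>'_def D(3))
  interpret finite_measure \<mu> by (rule D)
  have "finite_measure \<mu>'"
  proof (rule finite_measureI)
    have "S1 \<in> sets circle_borel" using sets.top[of circle_borel] by (simp add: space_circle_borel)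
    then show "emeasure \<mu>' (space \<mu>') \<noteq> \<infinity>" by (simp add: em sp)
  qed
  moreover have "emeasure \<mu>' (g ` B) = (\<integral>\<^sup>+x\<in>B. ennreal (metric_deriv \<rho> g x powr \<delta>) \<partial>\<mu>')"
    if g: "g \<in> G" and B: "B \<in> sets circle_borel" for g B
  proof -
    have [measurable]: "metric_deriv \<rho> g \<in> borel_measurable \<mu>" "B \<in> sets \<mu>"
      using metric_deriv_measurable[OF g] D(2) B by (simp_all cong: measurable_cong_sets)
    have "A \<inter> g ` B = g ` (A \<inter> B)"
    proof -
      have "inj_on g S1" using G_bij_betw[OF g] by (simp add: bij_betw_def)
      moreover have "A \<subseteq> S1" "g ` A = A" using A(2) g by (auto simp: invariant_set_def)
      moreover have "B \<subseteq> S1" using B by (simp add: sets_circle_borel)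
      ultimately show ?thesis by (simp add: inj_on_image_Int)
    qed
    then have "emeasure \<mu>' (g ` B) = emeasure \<mu> (g ` (A \<inter> B))" using em G_image_sets[OF g B] by simp
    also have "\<dots> = (\<integral>\<^sup>+x\<in>A \<inter> B. ennreal (metric_deriv \<rho> g x powr \<delta>) \<partial>\<mu>)"
      using A B by (intro finite_conformal_image[OF \<mu> g]) auto
    also have "\<dots> = (\<integral>\<^sup>+x. indicator A x * (ennreal (metric_deriv \<rho> g x powr \<delta>) * indicator B x) \<partial>\<mu>)"
      by (intro nn_integral_cong) (simp add: indicator_def)
    also have "\<dots> = (\<integral>\<^sup>+x\<in>B. ennreal (metric_deriv \<rho> g x powr \<delta>) \<partial>\<mu>')"
      unfolding \<mu>'_def using A' by (subst nn_integral_density) auto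
    finally show ?thesis .
  qed
  ultimately have "finite_conformal \<delta> \<mu>'" using sets' by (simp add: finite_conformal_def)
  with em that show ?thesis by blast
qed

text \<open>The absolute value serves exponents of either sign; positivity of \<delta> is a later
  conclusion.\<close>

lemma powr_distortion:
  fixes u v \<delta> :: real
  assumes "u > 0" "v > 0" "\<bar>ln u - ln v\<bar> \<le> 1"
  shows "exp (- \<bar>\<delta>\<bar>) * v powr \<delta> \<le> u powr \<delta>" "u powr \<delta> \<le> exp \<bar>\<delta>\<bar> * v powr \<delta>"
proof -
  have "\<bar>\<delta> * ln u - \<delta> * ln v\<bar> = \<bar>\<delta>\<bar> * \<bar>ln u - ln v\<bar>"
    by (simp add: abs_mult[symmetric] right_diff_distrib)
  also have "\<dots> \<le> \<bar>\<delta>\<bar> * 1" using assms(3) by (intro mult_left_mono) auto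
  finally have *: "\<bar>\<delta> * ln u - \<delta> * ln v\<bar> \<le> \<bar>\<delta>\<bar>" by simp
  have "exp (- \<bar>\<delta>\<bar> + \<delta> * ln v) \<le> exp (\<delta> * ln u)" "exp (\<delta> * ln u) \<le> exp (\<bar>\<delta>\<bar> + \<delta> * ln v)"
    using * by auto
  then show "exp (- \<bar>\<delta>\<bar>) * v powr \<delta> \<le> u powr \<delta>" "u powr \<delta> \<le> exp \<bar>\<delta>\<bar> * v powr \<delta>"
    using assms(1,2) by (simp_all add: powr_def exp_add[symmetric] mult.commute)
qed

text \<open>Conformality integrates \<open>metric_deriv \<rho> g x powr \<delta>\<close> over the
  arc around \<open>y\<close>; bounded distortion replaces the integrand by its value at the centre
  up to the factor \<open>exp \<bar>\<delta>\<bar>\<close>.\<close>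

lemma finite_conformal_distortion:
  assumes \<mu>: "finite_conformal \<delta> \<mu>" and h: "h \<in> lifts"
    and dist: "\<And>s. \<bar>s - y\<bar> \<le> \<eta> \<Longrightarrow> \<bar>ln (dd h s) - ln (dd h y)\<bar> \<le> 1"
  shows "measure \<mu> (cis ` {h (y - \<eta>)<..<h (y + \<eta>)}) \<le>
           exp \<bar>\<delta>\<bar> * dd h y powr \<delta> * measure \<mu> (arc_ball y \<eta>)"
    "exp (- \<bar>\<delta>\<bar>) * dd h y powr \<delta> * measure \<mu> (arc_ball y \<eta>) \<le>
           measure \<mu> (cis ` {h (y - \<eta>)<..<h (y + \<eta>)})"
proof -
  note D = finite_conformalD[OF \<mu>]
  interpret finite_measure \<mu> by (rule D)
  obtain g where g: "g \<in> G" "\<And>t. g (cis t) = cis (h t)" by (rule liftsE[OF h]) (rule that)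
  define B where "B = arc_ball y \<eta>"
  have B: "B \<in> sets \<mu>" by (simp add: B_def D(2))
  have gB: "cis ` {h (y - \<eta>)<..<h (y + \<eta>)} = g ` B"
    unfolding B_def using lift_image_arc[OF h g(2)] by simp
  have eq: "emeasure \<mu> (g ` B) = (\<integral>\<^sup>+x\<in>B. ennreal (metric_deriv \<rho> g x powr \<delta>) \<partial>\<mu>)"
    using finite_conformal_image[OF \<mu> g(1)] B D(2) by simp
  have pw: "exp (- \<bar>\<delta>\<bar>) * dd h y powr \<delta> \<le> metric_deriv \<rho> g x powr \<delta> \<and>
      metric_deriv \<rho> g x powr \<delta> \<le> exp \<bar>\<delta>\<bar> * dd h y powr \<delta>" if xB: "x \<in> B" for x
  proof -
    obtain s' where "x = cis s'" "s' \<in> {y - \<eta><..<y + \<eta>}" using xB unfolding B_def by blast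
    then obtain s where s: "x = cis s" "\<bar>s - y\<bar> \<le> \<eta>" by fastforce
    show ?thesis unfolding s(1) metric_deriv_eq_dd[OF g(1) h g(2)]
      using powr_distortion[OF dd_pos[OF h] dd_pos[OF h] dist[OF s(2)]] by blast
  qed
  have const: "(\<integral>\<^sup>+x\<in>B. ennreal c \<partial>\<mu>) = ennreal (c * measure \<mu> B)" if "c \<ge> 0" for c
    using B that by (simp add: nn_integral_cmult_indicator emeasure_eq_measure ennreal_mult'')
  have "emeasure \<mu> (g ` B) \<le> (\<integral>\<^sup>+x\<in>B. ennreal (exp \<bar>\<delta>\<bar> * dd h y powr \<delta>) \<partial>\<mu>)"
    unfolding eq using pw by (intro nn_integral_mono) (auto simp: indicator_def intro: ennreal_leI)
  then have "ennreal (measure \<mu> (g ` B)) \<le> ennreal (exp \<bar>\<delta>\<bar> * dd h y powr \<delta> * measure \<mu> B)"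
    by (simp add: const emeasure_eq_measure)
  then show "measure \<mu> (cis ` {h (y - \<eta>)<..<h (y + \<eta>)}) \<le>
           exp \<bar>\<delta>\<bar> * dd h y powr \<delta> * measure \<mu> (arc_ball y \<eta>)"
    unfolding gB B_def[symmetric] by (subst (asm) ennreal_le_iff) auto
  have "(\<integral>\<^sup>+x\<in>B. ennreal (exp (- \<bar>\<delta>\<bar>) * dd h y powr \<delta>) \<partial>\<mu>) \<le> emeasure \<mu> (g ` B)"
    unfolding eq using pw by (intro nn_integral_mono) (auto simp: indicator_def intro: ennreal_leI)
  then have "ennreal (exp (- \<bar>\<delta>\<bar>) * dd h y powr \<delta> * measure \<mu> B) \<le> ennreal (measure \<mu> (g ` B))"
    by (simp add: const emeasure_eq_measure)
  then show "exp (- \<bar>\<delta>\<bar>) * dd h y powr \<delta> * measure \<mu> (arc_ball y \<eta>) \<le>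
           measure \<mu> (cis ` {h (y - \<eta>)<..<h (y + \<eta>)})"
    unfolding gB B_def[symmetric] by (subst (asm) ennreal_le_iff) auto
qed

text \<open>Domination makes the difference a measure, and conformality is linear in the measure. To
  avoid subtracting values in \<open>ennreal\<close>, the relation is kept in the additive form
  \<open>\<theta> + \<nu> = c * \<mu>\<close>, extended from sets to nonnegative functions by
  induction, and cancelled only at the end, where the mass of \<nu> is finite.\<close>

lemma finite_conformal_diff:
  assumes \<mu>: "finite_conformal \<delta> \<mu>" and \<nu>: "finite_conformal \<delta> \<nu>" and c: "c \<ge> 0"
    and le: "\<And>A. A \<in> sets circle_borel \<Longrightarrow> measure \<nu> A \<le> c * measure \<mu> A"
  obtains \<theta> where "finite_conformal \<delta> \<theta>"
    "\<And>A. A \<in> sets circle_borel \<Longrightarrow> measure \<theta> A = c * measure \<mu> A - measure \<nu> A"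
proof -
  note D = finite_conformalD[OF \<mu>] and E = finite_conformalD[OF \<nu>]
  interpret \<mu>: finite_measure \<mu> by (rule D)
  interpret \<nu>: finite_measure \<nu> by (rule E)
  define \<mu>' where "\<mu>' = scale_measure (ennreal c) \<mu>"
  have s': "sets \<mu>' = sets circle_borel" "space \<mu>' = S1" using D by (simp_all add: \<mu>'_def space_scale_measure)
  have em': "emeasure \<mu>' A = ennreal (c * measure \<mu> A)" for A
    using c by (simp add: \<mu>'_def \<mu>.emeasure_eq_measure ennreal_mult'')
  have fin': "finite_measure \<mu>'" by (rule finite_measureI) (simp add: em')
  define \<theta> where "\<theta> = diff_measure \<mu>' \<nu>"
  have ge: "emeasure \<nu> A \<le> emeasure \<mu>' A" if "A \<in> sets \<mu>'" for A
    using le[of A] that s' by (simp add: em' \<nu>.emeasure_eq_measure ennreal_leI)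
  have em: "emeasure \<theta> A = ennreal (c * measure \<mu> A - measure \<nu> A)" if "A \<in> sets circle_borel" for A
    unfolding \<theta>_def using emeasure_diff_measure[OF fin' E(1) _ ge, of A] s' E that
    by (simp add: em' \<nu>.emeasure_eq_measure ennreal_minus)
  have s: "sets \<theta> = sets circle_borel" "space \<theta> = S1" using s' by (simp_all add: \<theta>_def)
  have S1: "S1 \<in> sets circle_borel" using sets.top[of circle_borel] by (simp add: space_circle_borel)
  have fin: "finite_measure \<theta>" by (rule finite_measureI) (simp add: s em[OF S1])
  have add: "emeasure \<theta> A + emeasure \<nu> A = ennreal c * emeasure \<mu> A" if "A \<in> sets circle_borel" for A
    using em[OF that] le[OF that] c
    by (simp add: \<nu>.emeasure_eq_measure \<mu>.emeasure_eq_measure ennreal_plus[symmetric] ennreal_mult''[symmetric] del: ennreal_plus)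
  have mb: "f \<in> borel_measurable \<theta>" "f \<in> borel_measurable \<mu>" "f \<in> borel_measurable \<nu>"
    if "f \<in> borel_measurable circle_borel" for f :: "complex \<Rightarrow> ennreal"
    using that s D E by (simp_all cong: measurable_cong_sets)
  have int: "(\<integral>\<^sup>+x. f x \<partial>\<theta>) + (\<integral>\<^sup>+x. f x \<partial>\<nu>) = ennreal c * (\<integral>\<^sup>+x. f x \<partial>\<mu>)"
    if "f \<in> borel_measurable circle_borel" for f
    using that
  proof (induction rule: borel_measurable_induct)
    case (cong f g)
    have "(\<integral>\<^sup>+x. f x \<partial>M) = (\<integral>\<^sup>+x. g x \<partial>M)" if "space M = S1" for M :: "complex measure"
      using cong(3) that by (intro nn_integral_cong) (simp add: space_circle_borel)
    then show ?case using cong s D E by simp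
  next
    case (set A)
    then show ?case using add s D E by simp
  next
    case (mult u c')
    note [measurable] = mb[OF \<open>u \<in> borel_measurable circle_borel\<close>]
    have "c' * ((\<integral>\<^sup>+x. u x \<partial>\<theta>) + (\<integral>\<^sup>+x. u x \<partial>\<nu>)) = c' * (ennreal c * (\<integral>\<^sup>+x. u x \<partial>\<mu>))"
      using mult by simp
    then show ?case by (simp add: nn_integral_cmult distrib_left mult_ac)
  next
    case (add u v)
    note [measurable] = mb[OF \<open>u \<in> borel_measurable circle_borel\<close>] mb[OF \<open>v \<in> borel_measurable circle_borel\<close>]
    have "(\<integral>\<^sup>+x. v x + u x \<partial>\<theta>) + (\<integral>\<^sup>+x. v x + u x \<partial>\<nu>) =
      ((\<integral>\<^sup>+x. v x \<partial>\<theta>) + (\<integral>\<^sup>+x. v x \<partial>\<nu>)) + ((\<integral>\<^sup>+x. u x \<partial>\<theta>) + (\<integral>\<^sup>+x. u x \<partial>\<nu>))"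
      by (simp add: nn_integral_add add_ac)
    also have "\<dots> = ennreal c * (\<integral>\<^sup>+x. v x + u x \<partial>\<mu>)"
      using add by (simp add: nn_integral_add distrib_left)
    finally show ?case by simp
  next
    case (seq U)
    note [measurable] = mb[OF \<open>\<And>i. U i \<in> borel_measurable circle_borel\<close>]
    have sup: "(\<integral>\<^sup>+x. (SUP i. U i x) \<partial>M) = (SUP i. \<integral>\<^sup>+x. U i x \<partial>M)"
      if "\<And>i. U i \<in> borel_measurable M" for M
      using seq that by (intro nn_integral_monotone_convergence_SUP) auto
    have inc: "incseq (\<lambda>i. \<integral>\<^sup>+x. U i x \<partial>M)" for M
      using seq by (auto simp: incseq_def le_fun_def intro!: nn_integral_mono)
    have "(\<integral>\<^sup>+x. (SUP i. U i x) \<partial>\<theta>) + (\<integral>\<^sup>+x. (SUP i. U i x) \<partial>\<nu>) =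
        (SUP i. (\<integral>\<^sup>+x. U i x \<partial>\<theta>) + (\<integral>\<^sup>+x. U i x \<partial>\<nu>))"
      by (simp add: sup ennreal_SUP_add[OF inc inc])
    also have "\<dots> = (SUP i. ennreal c * (\<integral>\<^sup>+x. U i x \<partial>\<mu>))" using seq by simp
    also have "\<dots> = ennreal c * (\<integral>\<^sup>+x. (SUP i. U i x) \<partial>\<mu>)" by (simp add: sup SUP_mult_left_ennreal)
    finally show ?case by (simp add: SUP_apply image_comp)
  qed
  have "emeasure \<theta> (g ` B) = (\<integral>\<^sup>+x\<in>B. ennreal (metric_deriv \<rho> g x powr \<delta>) \<partial>\<theta>)"
    if g: "g \<in> G" and B: "B \<in> sets circle_borel" for g B
  proof -
    define f where "f x = ennreal (metric_deriv \<rho> g x powr \<delta>) * indicator B x" for x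
    have "f \<in> borel_measurable circle_borel" unfolding f_def using metric_deriv_measurable[OF g] B by measurable
    from int[OF this] have "(\<integral>\<^sup>+x. f x \<partial>\<theta>) + emeasure \<nu> (g ` B) = ennreal c * emeasure \<mu> (g ` B)"
      unfolding f_def finite_conformal_image[OF \<mu> g B] finite_conformal_image[OF \<nu> g B] .
    also have "\<dots> = emeasure \<theta> (g ` B) + emeasure \<nu> (g ` B)" using add[OF G_image_sets[OF g B]] by simp
    finally show ?thesis
      unfolding f_def by (simp add: \<nu>.emeasure_eq_measure ennreal_add_left_cancel add.commute[of _ "ennreal _"])
  qed
  then have "finite_conformal \<delta> \<theta>" using fin s by (simp add: finite_conformal_def)
  moreover have "measure \<theta> A = c * measure \<mu> A - measure \<nu> A" if "A \<in> sets circle_borel" for A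
    using em[OF that] le[OF that] by (simp add: measure_def)
  ultimately show ?thesis using that by blast
qed

end

section \<open>Conformal measures on a minimal set\<close>

text \<open>Common ground of the circle under a minimal action and of \<open>\<Lambda>\<close>.
  Minimality has the form \<open>M_min\<close> because null arcs then spread to all of
  \<open>M\<close>; together with \<open>M_inf\<close> it also excludes finite orbits.\<close>

locale minimal_set = circle_group +
  fixes M :: "complex set"
  assumes M_closed: "closed M" and M_S1: "M \<subseteq> S1" and M_inv: "g \<in> G \<Longrightarrow> g ` M = M"
    and M_min: "cis y \<in> M \<Longrightarrow> \<eta> > 0 \<Longrightarrow> M \<subseteq> (\<Union>g\<in>G. g ` arc_ball y \<eta>)"
    and M_iso: "x \<in> M \<inter> NE \<rho> G \<Longrightarrow> isolated_fixers G x"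
    and M_inf: "infinite M"
begin

text \<open>By invariance the orbit of a point of \<open>M\<close> outside this set never meets a
  non-expandable point, so expansion can be repeated along it forever.\<close>

definition N0 :: "complex set" where "N0 = orbit_set G (M \<inter> NE \<rho> G)"

lemma N0_invariant: "g \<in> G \<Longrightarrow> x \<in> N0 \<Longrightarrow> g x \<in> N0"
proof -
  assume g: "g \<in> G" and "x \<in> N0"
  then obtain h z where hz: "h \<in> G" "z \<in> M \<inter> NE \<rho> G" "x = h z" by (auto simp: N0_def orbit_set_def)
  obtain k where k: "k \<in> G" "\<forall>x\<in>S1. k x = g (h x)" using G_comp[OF g hz(1)] by blast
  then have "g x = k z" using hz M_S1 by auto
  with k(1) hz(2) show "g x \<in> N0" by (auto simp: N0_def orbit_set_def)
qed

lemma N0_subset: "N0 \<subseteq> M"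
  using M_inv by (auto simp: N0_def orbit_set_def)

lemma NE_subset_N0: "M \<inter> NE \<rho> G \<subseteq> N0"
proof
  fix x assume x: "x \<in> M \<inter> NE \<rho> G"
  obtain e where "e \<in> G" "\<forall>x\<in>S1. e x = x" using G_id by blast
  then have "e \<in> G" "x = e x" using x M_S1 by auto
  with x show "x \<in> N0" unfolding N0_def orbit_set_def by blast
qed

lemma X_invariant: assumes "g \<in> G" "x \<in> M - N0" shows "g x \<in> M - N0"
proof -
  obtain k where k: "k \<in> G" "\<forall>x\<in>S1. k (g x) = x \<and> g (k x) = x"
    using G_inv assms by blast
  have "x \<in> S1" using assms M_S1 by blast
  then have "k (g x) = x" using k by blast
  then have "g x \<notin> N0" using N0_invariant[OF k(1), of "g x"] assms by auto
  then show ?thesis using M_inv[OF assms(1)] assms by blast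
qed

lemma N0_invariant_set: "invariant_set G N0"
  using N0_invariant N0_subset M_S1 by (intro invariant_setI) auto

lemma finite_NE: "finite (M \<inter> NE \<rho> G)"
  using uniform_expansion[OF M_closed M_S1 M_iso] by metis

text \<open>Hence \<open>N0\<close> is Borel, null for the Lebesgue measure and for non-atomic
  measures, and a measure carried by it is atomic.\<close>

lemma countable_N0: "countable N0"
  unfolding N0_def orbit_set_def
  by (intro countable_UN[OF countable_G] countable_image countable_finite finite_NE)

lemma N0_sets: "N0 \<in> sets circle_borel"
  using countable_N0 N0_subset M_S1 by (intro countable_sets_circle) auto

lemma M_sets: "M \<in> sets circle_borel"
  using M_closed M_S1 by (rule sets_circle_closed)

text \<open>Derivative sums are bounded uniformly in the depth, so one radius \<open>\<eta>\<close>
  works for all \<open>x\<close> and \<open>n\<close>. The resulting \<open>K\<close> collects the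
  metric ratio, the distortion factor \<open>exp 1\<close> and \<open>\<eta>\<close>. The centre
  \<open>y\<close> stays over \<open>M\<close> because it is the image of \<open>x\<close> under a
  group element.\<close>

lemma contraction_to_point:
  obtains \<eta> \<kappa> K where "\<eta> > 0" "0 < \<kappa>" "\<kappa> < 1"
    "\<And>x n. cis x \<in> M - N0 \<Longrightarrow> \<exists>h\<in>lifts. \<exists>y. cis y \<in> M \<and> h y = x \<and> dd h y \<le> \<kappa> ^ n \<and>
        (\<forall>s. \<bar>s - y\<bar> \<le> \<eta> \<longrightarrow> \<bar>ln (dd h s) - ln (dd h y)\<bar> \<le> 1 \<and> \<bar>h s - x\<bar> \<le> K * \<kappa> ^ n)"
proof -
  obtain \<Phi> \<kappa> B where \<Phi>: "finite \<Phi>" "\<Phi> \<subseteq> lifts" and \<kappa>: "0 < \<kappa>" "\<kappa> < 1" and B: "B \<ge> 0"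
    and ex: "\<And>x. cis x \<in> M - NE \<rho> G \<Longrightarrow> expands \<Phi> \<kappa> B x"
    using uniform_expansion[OF M_closed M_S1 M_iso] by metis
  have ex': "expands \<Phi> \<kappa> B x" if "cis x \<in> M - N0" for x
    using that NE_subset_N0 by (intro ex) blast
  obtain \<eta> where \<eta>: "\<eta> > 0" "\<And>h y S s. word \<Phi> h y S \<Longrightarrow> S \<le> B / (1 - \<kappa>) \<Longrightarrow> \<bar>s - y\<bar> \<le> \<eta> \<Longrightarrow>
      \<bar>ln (dd h s) - ln (dd h y)\<bar> \<le> 1"
    using word_distortion[OF \<Phi>, of "B / (1 - \<kappa>)"] by blast
  obtain K where K: "K \<ge> 1" "\<And>s t. r s \<le> K * r t" using r_comparable by blast
  have "\<exists>h\<in>lifts. \<exists>y. cis y \<in> M \<and> h y = x \<and> dd h y \<le> \<kappa> ^ n \<and>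
        (\<forall>s. \<bar>s - y\<bar> \<le> \<eta> \<longrightarrow> \<bar>ln (dd h s) - ln (dd h y)\<bar> \<le> 1 \<and> \<bar>h s - x\<bar> \<le> K * exp 1 * \<eta> * \<kappa> ^ n)"
    if x: "cis x \<in> M - N0" for x n
  proof -
    have "expands \<Phi> (\<kappa> ^ n) (B / (1 - \<kappa>)) x"
      using iterated_expansion[of \<Phi> \<kappa> B "M - N0"] \<Phi>(2) \<kappa> B X_invariant ex' x by blast
    then obtain h y S where *: "word \<Phi> h y S" "h y = x" "S \<le> B / (1 - \<kappa>)" "dd h y \<le> \<kappa> ^ n"
      by (auto simp: expands_def)
    have h: "h \<in> lifts" using word_lift *(1) \<Phi>(2) by blast
    have dist: "\<bar>ln (dd h s) - ln (dd h y)\<bar> \<le> 1" if "\<bar>s - y\<bar> \<le> \<eta>" for s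
      using \<eta>(2)[OF *(1,3)] that .
    have close: "\<bar>h s - x\<bar> \<le> K * exp 1 * \<eta> * \<kappa> ^ n" if s: "\<bar>s - y\<bar> \<le> \<eta>" for s
    proof -
      have "dd h u \<le> exp 1 * dd h y" if "\<bar>u - y\<bar> \<le> \<bar>s - y\<bar>" for u
        by (rule dd_le_if_ln_close[OF h dist]) (use that s in simp)
      then have "\<bar>h s - h y\<bar> \<le> K * (exp 1 * dd h y) * \<bar>s - y\<bar>"
        by (rule lift_diff_le[OF h K(2)])
      also have "\<dots> \<le> K * (exp 1 * \<kappa> ^ n) * \<eta>"
        using s *(4) K(1) \<kappa> dd_pos[OF h, of y] by (intro mult_mono) auto
      finally show ?thesis using *(2) by (simp add: mult_ac)
    qed
    obtain k where k: "k \<in> lifts" "\<And>t. k (h t) = t" "\<And>t. h (k t) = t"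
      by (rule lift_inv[OF h]) (rule that)
    obtain g where g: "g \<in> G" "\<And>t. g (cis t) = cis (k t)" by (rule liftsE[OF k(1)]) (rule that)
    have "cis y = g (cis x)" using g(2)[of x] *(2) k(2)[of y] by simp
    then have "cis y \<in> M" using X_invariant[OF g(1) x] by simp
    with h * dist close show ?thesis by blast
  qed
  then show ?thesis by (rule that[OF \<eta>(1) \<kappa>])
qed

lemma null_outside_M:
  assumes "finite_measure \<mu>" "sets \<mu> = sets circle_borel" "measure \<mu> (S1 - (M - N0)) = 0"
  shows "measure \<mu> (S1 - M) = 0"
proof -
  interpret finite_measure \<mu> by fact
  have "S1 - (M - N0) \<in> sets circle_borel" using S1_sets M_sets N0_sets by blast
  then show ?thesis
    using finite_measure_mono[of "S1 - M" "S1 - (M - N0)"] assms(2,3) by (auto simp: measure_le_0_iff)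
qed

definition charges_arcs :: "complex measure \<Rightarrow> bool" where
  "charges_arcs \<mu> \<longleftrightarrow> (\<forall>y \<eta>. cis y \<in> M \<longrightarrow> \<eta> > 0 \<longrightarrow> measure \<mu> (arc_ball y \<eta>) > 0)"

text \<open>By compactness finitely many arcs of radius \<open>\<eta> / 2\<close> cover
  \<open>M\<close>, and the arc of radius \<open>\<eta>\<close> around any point of \<open>M\<close>
  contains one of them.\<close>

lemma charges_arcs_uniform:
  assumes \<mu>: "finite_measure \<mu>" "sets \<mu> = sets circle_borel" "charges_arcs \<mu>" and \<eta>: "\<eta> > 0"
  obtains c where "c > 0" "\<And>y. cis y \<in> M \<Longrightarrow> measure \<mu> (arc_ball y \<eta>) \<ge> c"
proof -
  interpret finite_measure \<mu> by fact
  define C where "C = {0..2 * pi} \<inter> cis -` M"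
  have "compact M" using M_closed M_S1 by (meson bounded_sphere bounded_subset compact_eq_bounded_closed)
  then have C: "compact C" unfolding C_def using M_S1 by (intro cis_image_compact_reduce)
  define J where "J p = {p - \<eta> / 2<..<p + \<eta> / 2}" for p
  have J: "open (J p)" for p by (simp add: J_def)
  have "C \<subseteq> (\<Union>p\<in>C. J p)" using \<eta> by (auto simp: J_def)
  from compactE_image[OF C J this]
  obtain T where T: "T \<subseteq> C" "finite T" "C \<subseteq> (\<Union>p\<in>T. J p)" by blast
  define c where "c = Min (insert 1 ((\<lambda>p. measure \<mu> (cis ` J p)) ` T))"
  have "measure \<mu> (cis ` J p) > 0" if "p \<in> T" for p
  proof -
    have "cis p \<in> M" using that T(1) by (auto simp: C_def)
    moreover have "\<eta> / 2 > 0" using \<eta> by simp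
    ultimately show ?thesis using \<mu>(3) unfolding charges_arcs_def J_def by blast
  qed
  then have "c > 0" unfolding c_def using T(2) by (subst Min_gr_iff) auto
  moreover have "measure \<mu> (arc_ball y \<eta>) \<ge> c" if y: "cis y \<in> M" for y
  proof -
    obtain k :: int where k: "y + 2 * pi * of_int k \<in> {0..<2 * pi}" using reduce_2pi by blast
    define z where "z = y + 2 * pi * of_int k"
    have "z \<in> C" using k y by (simp add: C_def z_def)
    then obtain p where p: "p \<in> T" "z \<in> J p" using T(3) by blast
    have "J p \<subseteq> {z - \<eta><..<z + \<eta>}" using p(2) by (auto simp: J_def)
    then have "cis ` J p \<subseteq> arc_ball z \<eta>" by (rule image_mono)
    moreover have "arc_ball z \<eta> = arc_ball y \<eta>"
      using cis_image_shift[of "y - \<eta>" k "y + \<eta>"] by (simp add: z_def algebra_simps)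
    ultimately have "measure \<mu> (cis ` J p) \<le> measure \<mu> (arc_ball y \<eta>)"
      using \<mu>(2) by (intro finite_measure_mono) auto
    moreover have "c \<le> measure \<mu> (cis ` J p)" unfolding c_def using p(1) T(2) by (intro Min_le) auto
    ultimately show ?thesis by simp
  qed
  ultimately show ?thesis using that by blast
qed

text \<open>If an arc were null, so would be its countably many translates; they cover
  \<open>M\<close>, and no mass would be left.\<close>

lemma conformal_charges_arcs:
  assumes \<mu>: "finite_conformal \<delta> \<mu>" and M: "measure \<mu> (S1 - M) = 0" and pos: "measure \<mu> S1 > 0"
  shows "charges_arcs \<mu>"
  unfolding charges_arcs_def
proof (intro allI impI)
  fix y \<eta> :: real assume y: "cis y \<in> M" "\<eta> > 0"
  note D = finite_conformalD[OF \<mu>]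
  interpret finite_measure \<mu> by (rule D)
  define A where "A = arc_ball y \<eta>"
  have A: "A \<in> sets circle_borel" by (simp add: A_def)
  have "measure \<mu> A \<noteq> 0"
  proof
    assume "measure \<mu> A = 0"
    then have "emeasure \<mu> A = 0" by (simp add: emeasure_eq_measure)
    then have "emeasure \<mu> (g ` A) = 0" if "g \<in> G" for g
      using finite_conformal_null_image[OF \<mu> that A] by simp
    then have "g ` A \<in> null_sets \<mu>" if "g \<in> G" for g
      using that G_image_sets[OF that A] D(2) by (auto intro: null_setsI)
    then have "(\<Union>g\<in>G. g ` A) \<in> null_sets \<mu>" using countable_G by (intro null_sets_UN') auto
    moreover have "S1 - M \<in> null_sets \<mu>"
      using M M_sets S1_sets D(2) by (intro null_setsI) (auto simp: emeasure_eq_measure)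
    ultimately have "(\<Union>g\<in>G. g ` A) \<union> (S1 - M) \<in> null_sets \<mu>" by blast
    moreover have "S1 \<subseteq> (\<Union>g\<in>G. g ` A) \<union> (S1 - M)"
      using M_min[OF y] unfolding A_def by blast
    moreover have "S1 \<in> sets \<mu>" using S1_sets D(2) by simp
    ultimately have "S1 \<in> null_sets \<mu>" by (metis null_sets_subset)
    then show False using pos by (simp add: emeasure_eq_measure null_sets_def)
  qed
  then show "measure \<mu> (arc_ball y \<eta>) > 0" by (simp add: A_def zero_less_measure_iff)
qed

text \<open>Pulling back arcs of fixed size along the contractions of \<open>contraction_to_point\<close> compares
  both measures of small arcs with a power of the derivative.\<close>

lemma conformal_comparison:
  assumes \<nu>: "finite_conformal \<delta>' \<nu>" "measure \<nu> (S1 - (M - N0)) = 0"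
    and \<mu>: "finite_conformal \<delta> \<mu>" "charges_arcs \<mu>" and le: "\<delta> \<le> \<delta>'"
  obtains C where "C > 0"
    "\<And>\<epsilon> A. 0 < \<epsilon> \<Longrightarrow> \<epsilon> \<le> 1 \<Longrightarrow> A \<in> sets circle_borel \<Longrightarrow> measure \<nu> A \<le> C * \<epsilon> powr (\<delta>' - \<delta>) * measure \<mu> A"
proof -
  note D = finite_conformalD[OF \<mu>(1)] and E = finite_conformalD[OF \<nu>(1)]
  interpret \<mu>: finite_measure \<mu> by (rule D)
  interpret \<nu>: finite_measure \<nu> by (rule E)
  obtain \<eta> \<kappa> K where \<eta>: "\<eta> > 0" and \<kappa>: "0 < \<kappa>" "\<kappa> < 1" and con:
    "\<And>x n. cis x \<in> M - N0 \<Longrightarrow> \<exists>h\<in>lifts. \<exists>y. cis y \<in> M \<and> h y = x \<and> dd h y \<le> \<kappa> ^ n \<and>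
        (\<forall>s. \<bar>s - y\<bar> \<le> \<eta> \<longrightarrow> \<bar>ln (dd h s) - ln (dd h y)\<bar> \<le> 1 \<and> \<bar>h s - x\<bar> \<le> K * \<kappa> ^ n)"
    by (rule contraction_to_point) (rule that)
  obtain c where c: "c > 0" "\<And>y. cis y \<in> M \<Longrightarrow> measure \<mu> (arc_ball y \<eta>) \<ge> c"
    using charges_arcs_uniform[OF D(1,2) \<mu>(2) \<eta>] by blast
  \<comment> \<open>On the fixed arc \<nu> is bounded above by its total mass and \<mu> below by
    \<open>c\<close>. Adding 1 keeps \<open>C\<close> positive when \<nu> vanishes.\<close>
  define C where "C = exp \<bar>\<delta>'\<bar> * exp \<bar>\<delta>\<bar> * (measure \<nu> S1 + 1) / c"
  have C: "C > 0" using c by (simp add: C_def add_nonneg_pos)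
  have "measure \<nu> A \<le> 2 * C * \<epsilon> powr (\<delta>' - \<delta>) * measure \<mu> A"
    if \<epsilon>: "0 < \<epsilon>" "\<epsilon> \<le> 1" and A: "A \<in> sets circle_borel" for \<epsilon> A
  proof -
    define A' where "A' = A \<inter> (M - N0)"
    have A': "A' \<in> sets circle_borel" using A M_sets N0_sets by (simp add: A'_def)
    have "measure \<nu> A' \<le> 2 * (C * \<epsilon> powr (\<delta>' - \<delta>)) * measure \<mu> A'"
    proof (rule fine_cover_measure_le[OF E(1) D(1) E(2) D(2) A'])
      show "0 \<le> C * \<epsilon> powr (\<delta>' - \<delta>)" using C by simp
      fix t w :: real assume t: "cis t \<in> A'" and w: "w > 0"
      \<comment> \<open>The depth \<open>n\<close> is chosen so that the image arc stays within
        \<open>w\<close> of \<open>t\<close> and the derivative at its base is at most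
        \<epsilon>.\<close>
      have "(\<lambda>n. K * \<kappa> ^ n) \<longlonglongrightarrow> K * 0"
        using \<kappa> by (intro tendsto_intros LIMSEQ_power_zero) auto
      then have "\<forall>\<^sub>F n in sequentially. K * \<kappa> ^ n < w"
        using w by (intro order_tendstoD(2)) auto
      moreover have "(\<lambda>n. \<kappa> ^ n) \<longlonglongrightarrow> 0" using \<kappa> by (intro LIMSEQ_power_zero) auto
      then have "\<forall>\<^sub>F n in sequentially. \<kappa> ^ n < \<epsilon>" using \<epsilon> by (intro order_tendstoD(2))
      ultimately have "\<forall>\<^sub>F n in sequentially. K * \<kappa> ^ n < w \<and> \<kappa> ^ n < \<epsilon>"
        by (rule eventually_conj)
      then obtain n where n: "K * \<kappa> ^ n < w" "\<kappa> ^ n < \<epsilon>"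
        by (auto simp: eventually_sequentially)
      have tX: "cis t \<in> M - N0" using t by (auto simp: A'_def)
      obtain h y where h: "h \<in> lifts" "h y = t" "dd h y \<le> \<kappa> ^ n" and yM: "cis y \<in> M"
        and dist: "\<And>s. \<bar>s - y\<bar> \<le> \<eta> \<Longrightarrow> \<bar>ln (dd h s) - ln (dd h y)\<bar> \<le> 1"
        and close: "\<And>s. \<bar>s - y\<bar> \<le> \<eta> \<Longrightarrow> \<bar>h s - t\<bar> \<le> K * \<kappa> ^ n"
        using con[OF tX, of n] by blast
      define I where "I = {h (y - \<eta>)<..<h (y + \<eta>)}"
      define d where "d = dd h y"
      have d: "d > 0" "d \<le> \<epsilon>" using h n(2) by (auto simp: d_def)
      have "t \<in> I" using lift_less[OF h(1)] h(2) \<eta> by (auto simp: I_def)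
      moreover have "I \<subseteq> {t - w<..<t + w}"
        using close[of "y - \<eta>"] close[of "y + \<eta>"] \<eta> n(1) by (auto simp: I_def)
      moreover have "measure \<nu> (cis ` I) \<le> C * \<epsilon> powr (\<delta>' - \<delta>) * measure \<mu> (cis ` I)"
      proof -
        have "measure \<nu> (arc_ball y \<eta>) \<le> measure \<nu> S1 + 1"
          using \<nu>.bounded_measure[of "arc_ball y \<eta>"] E(3) by simp
        then have "exp \<bar>\<delta>'\<bar> * d powr \<delta>' * measure \<nu> (arc_ball y \<eta>) \<le>
            exp \<bar>\<delta>'\<bar> * d powr \<delta>' * (measure \<nu> S1 + 1)"
          by (intro mult_left_mono) auto
        with finite_conformal_distortion(1)[OF \<nu>(1) h(1), of y \<eta>, OF dist]
        have 1: "measure \<nu> (cis ` I) \<le> exp \<bar>\<delta>'\<bar> * d powr \<delta>' * (measure \<nu> S1 + 1)"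
          unfolding I_def d_def by (rule order_trans)
        have "exp (- \<bar>\<delta>\<bar>) * d powr \<delta> * c \<le> exp (- \<bar>\<delta>\<bar>) * d powr \<delta> * measure \<mu> (arc_ball y \<eta>)"
          using c(2)[OF yM] by (intro mult_left_mono) auto
        then have 2: "exp (- \<bar>\<delta>\<bar>) * d powr \<delta> * c \<le> measure \<mu> (cis ` I)"
          unfolding I_def d_def
          by (rule order_trans[OF _ finite_conformal_distortion(2)[OF \<mu>(1) h(1), of y \<eta>, OF dist]])
        \<comment> \<open>Splitting off \<open>d powr \<delta>\<close> leaves the excess
          \<open>d powr (\<delta>' - \<delta>)\<close>, which \<open>d \<le> \<epsilon>\<close> and
          \<open>\<delta> \<le> \<delta>'\<close> bound by
          \<open>\<epsilon> powr (\<delta>' - \<delta>)\<close>.\<close>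
        have "exp \<bar>\<delta>'\<bar> * d powr \<delta>' * (measure \<nu> S1 + 1) =
            C * d powr (\<delta>' - \<delta>) * (exp (- \<bar>\<delta>\<bar>) * d powr \<delta> * c)"
        proof -
          have "d powr \<delta>' = d powr (\<delta>' - \<delta>) * d powr \<delta>" by (simp add: powr_add[symmetric])
          moreover have "exp \<bar>\<delta>\<bar> * exp (- \<bar>\<delta>\<bar>) = 1" by (simp add: exp_add[symmetric])
          ultimately show ?thesis using c(1) by (simp add: C_def field_simps exp_minus)
        qed
        also have "\<dots> \<le> C * \<epsilon> powr (\<delta>' - \<delta>) * measure \<mu> (cis ` I)"
          using 2 C d le c(1) by (intro mult_mono powr_mono2) auto
        finally show ?thesis using 1 by simp
      qed
      ultimately show "\<exists>a b. t \<in> {a<..<b} \<and> {a<..<b} \<subseteq> {t - w<..<t + w} \<and>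
          measure \<nu> (cis ` {a<..<b}) \<le> C * \<epsilon> powr (\<delta>' - \<delta>) * measure \<mu> (cis ` {a<..<b})"
        unfolding I_def by blast
    qed
    also have "\<dots> \<le> 2 * (C * \<epsilon> powr (\<delta>' - \<delta>)) * measure \<mu> A"
      using A D(2) C by (intro mult_left_mono \<mu>.finite_measure_mono) (auto simp: A'_def)
    finally have "measure \<nu> A' \<le> 2 * C * \<epsilon> powr (\<delta>' - \<delta>) * measure \<mu> A" by (simp add: mult_ac)
    moreover have "measure \<nu> A = measure \<nu> A'"
    proof -
      have "S1 - (M - N0) \<in> null_sets \<nu>"
        using \<nu>(2) M_sets N0_sets S1_sets E(2) by (intro null_setsI) (auto simp: \<nu>.emeasure_eq_measure)
      moreover have "A - A' \<subseteq> S1 - (M - N0)" using A by (auto simp: A'_def sets_circle_borel)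
      moreover have "A - A' \<in> sets \<nu>" using A A' E(2) by simp
      ultimately have "A - A' \<in> null_sets \<nu>" by (metis null_sets_subset)
      moreover have "A' = A - (A - A')" by (auto simp: A'_def)
      ultimately show ?thesis using A E(2) measure_Diff_null_set[of A \<nu> "A - A'"] by simp
    qed
    ultimately show ?thesis by simp
  qed
  then show ?thesis using C by (intro that[of "2 * C"]) auto
qed

text \<open>Arbitrarily small derivatives are available at great depth, so \<epsilon> may tend to 0
  in the comparison, and the gap between the exponents makes its constant vanish.\<close>

lemma smaller_exponent_null:
  assumes \<nu>: "finite_conformal \<delta>' \<nu>" "measure \<nu> (S1 - (M - N0)) = 0"
    and \<mu>: "finite_conformal \<delta> \<mu>" "charges_arcs \<mu>" and less: "\<delta> < \<delta>'"
  shows "measure \<nu> S1 = 0"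
proof -
  obtain C where C: "C > 0"
    "\<And>\<epsilon> A. 0 < \<epsilon> \<Longrightarrow> \<epsilon> \<le> 1 \<Longrightarrow> A \<in> sets circle_borel \<Longrightarrow> measure \<nu> A \<le> C * \<epsilon> powr (\<delta>' - \<delta>) * measure \<mu> A"
    using conformal_comparison[OF \<nu> \<mu>] less by (metis less_imp_le)
  have "((\<lambda>\<epsilon>. C * \<epsilon> powr (\<delta>' - \<delta>) * measure \<mu> S1) \<longlongrightarrow> C * 0 powr (\<delta>' - \<delta>) * measure \<mu> S1) (at_right 0)"
    using less by (intro tendsto_intros tendsto_powr') (auto simp: eventually_at_filter)
  then have "((\<lambda>\<epsilon>. C * \<epsilon> powr (\<delta>' - \<delta>) * measure \<mu> S1) \<longlongrightarrow> 0) (at_right 0)" by simp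
  moreover have "\<forall>\<^sub>F \<epsilon> in at_right (0::real). measure \<nu> S1 \<le> C * \<epsilon> powr (\<delta>' - \<delta>) * measure \<mu> S1"
    using eventually_at_right_real[of 0 "1::real"]
    by (auto elim!: eventually_mono intro!: C(2) S1_sets)
  ultimately have "measure \<nu> S1 \<le> 0" by (intro tendsto_lowerbound) auto
  then show ?thesis by (simp add: measure_le_0_iff)
qed

text \<open>If both pieces had positive mass, their restrictions would be conformal with the same
  exponent. The piece on the complement would then be dominated by the piece on \<open>A\<close>,
  which gives the complement mass zero.\<close>

lemma conformal_ergodic:
  assumes \<mu>: "finite_conformal \<delta> \<mu>" "measure \<mu> (S1 - (M - N0)) = 0"
    and A: "A \<in> sets circle_borel" "invariant_set G A"
  shows "measure \<mu> A = 0 \<or> measure \<mu> (S1 - A) = 0"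
proof (rule ccontr)
  assume neg: "\<not> ?thesis"
  note D = finite_conformalD[OF \<mu>(1)]
  interpret finite_measure \<mu> by (rule D)
  have inv: "invariant_set G (S1 - A)" by (rule invariant_set_complement[OF A(2)])
  have comp: "S1 - A \<in> sets circle_borel" using A S1_sets by blast
  have AS: "A \<subseteq> S1" using A by (simp add: sets_circle_borel)
  obtain \<mu>1 where 1: "finite_conformal \<delta> \<mu>1"
    "\<And>B. B \<in> sets circle_borel \<Longrightarrow> emeasure \<mu>1 B = emeasure \<mu> (A \<inter> B)"
    using finite_conformal_restrict[OF \<mu>(1) A] by blast
  obtain \<mu>2 where 2: "finite_conformal \<delta> \<mu>2"
    "\<And>B. B \<in> sets circle_borel \<Longrightarrow> emeasure \<mu>2 B = emeasure \<mu> ((S1 - A) \<inter> B)"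
    using finite_conformal_restrict[OF \<mu>(1) comp inv] by blast
  have m1: "measure \<mu>1 B = measure \<mu> (A \<inter> B)" and m2: "measure \<mu>2 B = measure \<mu> ((S1 - A) \<inter> B)"
    if "B \<in> sets circle_borel" for B
    using 1(2)[OF that] 2(2)[OF that] by (simp_all add: measure_def)
  have null: "measure \<mu> (B \<inter> C) = 0" if "measure \<mu> C = 0" "B \<in> sets circle_borel" "C \<in> sets circle_borel" for B C
    using finite_measure_mono[of "B \<inter> C" C] that D(2) by (auto simp: measure_le_0_iff)
  have X: "S1 - (M - N0) \<in> sets circle_borel" using S1_sets M_sets N0_sets by blast
  have N2: "measure \<mu>2 (S1 - (M - N0)) = 0" using m2[OF X] null[OF \<mu>(2) comp X] by simp
  have SM: "S1 - M \<in> sets circle_borel" using S1_sets M_sets by blast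
  from null_outside_M[OF D(1,2) \<mu>(2)] have N1: "measure \<mu>1 (S1 - M) = 0" using m1[OF SM] null[OF _ A(1) SM] by simp
  have "measure \<mu>1 S1 > 0" using neg m1[OF S1_sets] AS by (simp add: Int_absorb2 zero_less_measure_iff)
  then have "charges_arcs \<mu>1" using conformal_charges_arcs[OF 1(1) N1] by blast
  from conformal_comparison[OF 2(1) N2 1(1) this order_refl]
  obtain C where "C > 0" and C: "\<And>\<epsilon> B. 0 < \<epsilon> \<Longrightarrow> \<epsilon> \<le> 1 \<Longrightarrow> B \<in> sets circle_borel \<Longrightarrow>
     measure \<mu>2 B \<le> C * \<epsilon> powr (\<delta> - \<delta>) * measure \<mu>1 B" by metis
  have "measure \<mu>2 (S1 - A) \<le> C * 1 powr (\<delta> - \<delta>) * measure \<mu>1 (S1 - A)"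
    using C[of 1 "S1 - A"] comp by simp
  then have "measure \<mu> (S1 - A) \<le> 0" using m1[OF comp] m2[OF comp] by simp
  then show False using neg by (simp add: measure_le_0_iff)
qed

text \<open>If \<open>c\<close> is the least constant with \<open>\<nu> \<le> c \<mu>\<close>, then \<open>c \<mu> - \<nu>\<close> is again conformal. Unless it vanishes,
  it dominates a multiple of \<open>\<mu>\<close>, and then \<open>c\<close> could be decreased.\<close>

lemma conformal_unique_same_exponent:
  assumes \<mu>: "finite_conformal \<delta> \<mu>" "measure \<mu> (S1 - (M - N0)) = 0" "prob_space \<mu>"
    and \<nu>: "finite_conformal \<delta> \<nu>" "measure \<nu> (S1 - (M - N0)) = 0" "prob_space \<nu>"
  shows "\<mu> = \<nu>"
proof -
  note D = finite_conformalD[OF \<mu>(1)] and E = finite_conformalD[OF \<nu>(1)]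
  interpret \<mu>: prob_space \<mu> by (rule \<mu>)
  interpret \<nu>: prob_space \<nu> by (rule \<nu>)
  have one: "measure \<mu> S1 = 1" "measure \<nu> S1 = 1" using \<mu>.prob_space \<nu>.prob_space D(3) E(3) by simp_all
  have SM: "S1 - M \<in> sets circle_borel" using S1_sets M_sets by blast
  have SM0: "measure \<mu> (S1 - M) = 0" by (rule null_outside_M[OF D(1,2) \<mu>(2)])
  \<comment> \<open>The admissible constants in \<open>\<nu> \<le> c * \<mu>\<close>. The comparison
    provides one, and the infimum is attained because the inequality passes to it set by
    set.\<close>
  define R where "R = {c. c \<ge> 0 \<and> (\<forall>A\<in>sets circle_borel. measure \<nu> A \<le> c * measure \<mu> A)}"
  have "charges_arcs \<mu>" using conformal_charges_arcs[OF \<mu>(1) SM0] one by simp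
  from conformal_comparison[OF \<nu>(1,2) \<mu>(1) this order_refl]
  obtain C where C: "C > 0" "\<And>\<epsilon> B. 0 < \<epsilon> \<Longrightarrow> \<epsilon> \<le> 1 \<Longrightarrow> B \<in> sets circle_borel \<Longrightarrow>
     measure \<nu> B \<le> C * \<epsilon> powr (\<delta> - \<delta>) * measure \<mu> B" by blast
  have "C \<in> R" using C(1) C(2)[of 1] by (simp add: R_def)
  have bdd: "bdd_below R" by (rule bdd_belowI[of _ 0]) (simp add: R_def)
  define c where "c = Inf R"
  have "c \<ge> 0" unfolding c_def using \<open>C \<in> R\<close> by (intro cInf_greatest) (auto simp: R_def)
  have cle: "measure \<nu> A \<le> c * measure \<mu> A" if "A \<in> sets circle_borel" for A
  proof (cases "measure \<mu> A = 0")
    case True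
    then show ?thesis using \<open>C \<in> R\<close> that by (auto simp: R_def)
  next
    case False
    then have "measure \<mu> A > 0" by (simp add: zero_less_measure_iff)
    then have "measure \<nu> A / measure \<mu> A \<le> c"
      unfolding c_def using \<open>C \<in> R\<close> that by (intro cInf_greatest) (auto simp: R_def field_simps)
    then show ?thesis using \<open>measure \<mu> A > 0\<close> by (simp add: field_simps)
  qed
  obtain \<theta> where \<theta>: "finite_conformal \<delta> \<theta>"
    "\<And>A. A \<in> sets circle_borel \<Longrightarrow> measure \<theta> A = c * measure \<mu> A - measure \<nu> A"
    using finite_conformal_diff[OF \<mu>(1) \<nu>(1) \<open>c \<ge> 0\<close> cle] by blast
  interpret \<theta>: finite_measure \<theta> by (rule finite_conformalD(1)[OF \<theta>(1)])
  have "measure \<theta> S1 = 0"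
  proof (rule ccontr)
    assume "measure \<theta> S1 \<noteq> 0"
    then have "measure \<theta> S1 > 0" by (simp add: zero_less_measure_iff)
    moreover have "measure \<theta> (S1 - M) = 0"
      using \<theta>(2)[OF SM] SM0 measure_nonneg[of \<theta> "S1 - M"] measure_nonneg[of \<nu> "S1 - M"] by simp
    ultimately have "charges_arcs \<theta>" using conformal_charges_arcs[OF \<theta>(1)] by blast
    from conformal_comparison[OF \<mu>(1,2) \<theta>(1) this order_refl]
    obtain C' where C': "C' > 0" "\<And>\<epsilon> B. 0 < \<epsilon> \<Longrightarrow> \<epsilon> \<le> 1 \<Longrightarrow> B \<in> sets circle_borel \<Longrightarrow>
       measure \<mu> B \<le> C' * \<epsilon> powr (\<delta> - \<delta>) * measure \<theta> B" by blast
    \<comment> \<open>Rearranging \<open>\<mu> \<le> C' * (c * \<mu> - \<nu>)\<close> lowers the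
      constant by \<open>1 / C'\<close>.\<close>
    have le: "measure \<nu> A \<le> (c - 1 / C') * measure \<mu> A" if "A \<in> sets circle_borel" for A
    proof -
      have "measure \<mu> A \<le> C' * (c * measure \<mu> A - measure \<nu> A)" using C'(2)[of 1 A] that \<theta>(2) by simp
      then show ?thesis using C'(1) by (simp add: field_simps)
    qed
    \<comment> \<open>Evaluation on the whole circle shows that the smaller constant is still
      nonnegative, as membership in \<open>R\<close> demands.\<close>
    have "1 \<le> c - 1 / C'" using le[OF S1_sets] one by simp
    then have "c - 1 / C' \<in> R" using le by (simp add: R_def)
    then have "c \<le> c - 1 / C'" unfolding c_def using bdd by (intro cInf_lower)
    then show False using C'(1) by simp
  qed
  then have "c = 1" using \<theta>(2)[OF S1_sets] one by simp
  have eq: "measure \<mu> A = measure \<nu> A" if "A \<in> sets circle_borel" for A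
  proof -
    have "measure \<theta> A \<le> measure \<theta> S1"
      using \<theta>.bounded_measure[of A] finite_conformalD(3)[OF \<theta>(1)] by simp
    then have "measure \<theta> A = 0" using \<open>measure \<theta> S1 = 0\<close> by (simp add: measure_le_0_iff)
    then show ?thesis using \<theta>(2)[OF that] \<open>c = 1\<close> by simp
  qed
  show ?thesis
    by (rule measure_eqI) (use D(2) E(2) eq in \<open>auto simp: \<mu>.emeasure_eq_measure \<nu>.emeasure_eq_measure\<close>)
qed

text \<open>Both measures charge arcs, so the comparison applies in either direction, and the one
  with the larger exponent would have to vanish.\<close>

lemma conformal_unique:
  assumes \<mu>: "finite_conformal \<delta> \<mu>" "measure \<mu> (S1 - (M - N0)) = 0" "prob_space \<mu>"
    and \<nu>: "finite_conformal \<delta>' \<nu>" "measure \<nu> (S1 - (M - N0)) = 0" "prob_space \<nu>"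
  shows "\<delta> = \<delta>'" "\<mu> = \<nu>"
proof -
  have charges: "charges_arcs \<mu>" "measure \<mu> S1 = 1"
    if \<mu>: "finite_conformal \<delta> \<mu>" "measure \<mu> (S1 - (M - N0)) = 0" "prob_space \<mu>" for \<delta> \<mu>
  proof -
    note D = finite_conformalD[OF \<mu>(1)]
    interpret prob_space \<mu> by (rule \<mu>)
    show one: "measure \<mu> S1 = 1" using prob_space D(3) by simp
    show "charges_arcs \<mu>"
      using conformal_charges_arcs[OF \<mu>(1) null_outside_M[OF D(1,2) \<mu>(2)]] one by simp
  qed
  have "\<not> \<delta> < \<delta>'" using smaller_exponent_null[OF \<nu>(1,2) \<mu>(1) charges(1)[OF \<mu>]] charges(2)[OF \<nu>] by auto
  moreover have "\<not> \<delta>' < \<delta>" using smaller_exponent_null[OF \<mu>(1,2) \<nu>(1) charges(1)[OF \<nu>]] charges(2)[OF \<mu>] by auto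
  ultimately show "\<delta> = \<delta>'" by simp
  with \<nu> have "finite_conformal \<delta> \<nu>" by simp
  from conformal_unique_same_exponent[OF \<mu> this \<nu>(2,3)] show "\<mu> = \<nu>" .
qed

text \<open>A finite orbit would miss an arc around some point of the infinite set \<open>M\<close>;
  but the translates of that arc cover \<open>M\<close>, so some group element takes
  \<open>x\<close> into it.\<close>

lemma orbit_infinite: assumes "x \<in> M" shows "infinite ((\<lambda>g. g x) ` G)"
proof
  assume fin: "finite ((\<lambda>g. g x) ` G)"
  then obtain z where z: "z \<in> M" "z \<notin> (\<lambda>g. g x) ` G" using M_inf by (meson finite_subset subsetI)
  then obtain y where y: "z = cis y" using M_S1 S1_cis by blast
  have "open (cis -` (- ((\<lambda>g. g x) ` G)))"
    using fin by (intro open_vimage open_Compl finite_imp_closed) (auto intro: continuous_intros)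
  moreover have "y \<in> cis -` (- ((\<lambda>g. g x) ` G))" using z y by simp
  ultimately have "\<exists>w>0. \<forall>s. dist s y < w \<longrightarrow> s \<in> cis -` (- ((\<lambda>g. g x) ` G))"
    unfolding open_dist by blast
  then obtain w where w: "w > 0" "\<And>s. dist s y < w \<Longrightarrow> cis s \<in> - ((\<lambda>g. g x) ` G)"
    by auto
  have "x \<in> (\<Union>g\<in>G. g ` arc_ball y w)" using M_min[of y w] z y w(1) assms by blast
  then obtain g s where g: "g \<in> G" "s \<in> {y - w<..<y + w}" "x = g (cis s)" by blast
  obtain k where k: "k \<in> G" "\<forall>x\<in>S1. k (g x) = x \<and> g (k x) = x"
    using G_inv[OF g(1)] by blast
  have "k x = cis s" using k g(3) by simp
  then have "cis s \<in> (\<lambda>g. g x) ` G" using k(1) by (metis image_eqI)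
  moreover have "dist s y < w" using g(2) by (auto simp: dist_real_def)
  ultimately show False using w(2) by blast
qed

text \<open>For \<open>\<delta> \<le> 0\<close> contraction loses mass by at most a constant factor,
  so arcs of fixed size carry mass at least \<open>b\<close> into arbitrarily small neighbourhoods
  of any \<open>x\<close> in \<open>M - N0\<close>. Thus \<open>x\<close> is an atom of mass at
  least \<open>b\<close>, and so are the infinitely many points of its orbit, against finite total
  mass.\<close>

lemma conformal_exponent_pos:
  assumes \<mu>: "finite_conformal \<delta> \<mu>" "measure \<mu> (S1 - (M - N0)) = 0" and pos: "measure \<mu> S1 > 0"
  shows "\<delta> > 0"
proof (rule ccontr)
  assume "\<not> \<delta> > 0"
  then have \<delta>: "\<delta> \<le> 0" by simp
  note D = finite_conformalD[OF \<mu>(1)]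
  interpret finite_measure \<mu> by (rule D)
  have ch: "charges_arcs \<mu>"
    by (rule conformal_charges_arcs[OF \<mu>(1) null_outside_M[OF D(1,2) \<mu>(2)] pos])
  obtain \<eta> \<kappa> K where \<eta>: "\<eta> > 0" and \<kappa>: "0 < \<kappa>" "\<kappa> < 1" and con:
    "\<And>x n. cis x \<in> M - N0 \<Longrightarrow> \<exists>h\<in>lifts. \<exists>y. cis y \<in> M \<and> h y = x \<and> dd h y \<le> \<kappa> ^ n \<and>
        (\<forall>s. \<bar>s - y\<bar> \<le> \<eta> \<longrightarrow> \<bar>ln (dd h s) - ln (dd h y)\<bar> \<le> 1 \<and> \<bar>h s - x\<bar> \<le> K * \<kappa> ^ n)"
    by (rule contraction_to_point) (rule that)
  obtain c where c: "c > 0" "\<And>y. cis y \<in> M \<Longrightarrow> measure \<mu> (arc_ball y \<eta>) \<ge> c"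
    using charges_arcs_uniform[OF D(1,2) ch \<eta>] by blast
  define b where "b = exp (- \<bar>\<delta>\<bar>) * c"
  have b: "b > 0" using c by (simp add: b_def)
  have atom: "measure \<mu> {x} \<ge> b" if x: "x \<in> M - N0" for x
  proof -
    obtain t where t: "x = cis t" using x M_S1 S1_cis by blast
    define w where "w n = K * \<kappa> ^ n" for n
    have sm: "cis ` {t - w n..t + w n} \<in> sets circle_borel" for n
    proof -
      have "compact (cis ` {t - w n..t + w n})"
        by (intro compact_continuous_image continuous_on_cis continuous_on_id) auto
      then show ?thesis by (intro sets_circle_closed compact_imp_closed) auto
    qed
    have ge: "b \<le> measure \<mu> (cis ` {t - w n..t + w n})" for n
    proof -
      obtain h y where h: "h \<in> lifts" "h y = t" "dd h y \<le> \<kappa> ^ n" and yM: "cis y \<in> M"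
        and dist: "\<And>s. \<bar>s - y\<bar> \<le> \<eta> \<Longrightarrow> \<bar>ln (dd h s) - ln (dd h y)\<bar> \<le> 1"
        and close: "\<And>s. \<bar>s - y\<bar> \<le> \<eta> \<Longrightarrow> \<bar>h s - t\<bar> \<le> w n"
        using con[of t n] x t unfolding w_def by blast
      have "dd h y \<le> 1" using h(3) \<kappa> by (meson power_le_one less_imp_le order_trans)
      then have "dd h y powr \<delta> \<ge> 1" using \<delta> dd_pos[OF h(1), of y] powr_mono2'[of \<delta> "dd h y" 1] by simp
      then have "b \<le> exp (- \<bar>\<delta>\<bar>) * dd h y powr \<delta> * measure \<mu> (arc_ball y \<eta>)"
        unfolding b_def using c(2)[OF yM] c(1) by (intro mult_mono) auto
      also have "\<dots> \<le> measure \<mu> (cis ` {h (y - \<eta>)<..<h (y + \<eta>)})"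
        by (rule finite_conformal_distortion(2)[OF \<mu>(1) h(1), of y \<eta>, OF dist])
      also have "\<dots> \<le> measure \<mu> (cis ` {t - w n..t + w n})"
      proof (intro finite_measure_mono image_mono)
        show "{h (y - \<eta>)<..<h (y + \<eta>)} \<subseteq> {t - w n..t + w n}"
          using close[of "y - \<eta>"] close[of "y + \<eta>"] \<eta> by auto
        show "cis ` {t - w n..t + w n} \<in> sets \<mu>" using sm D(2) by simp
      qed
      finally show ?thesis .
    qed
    show ?thesis
    proof (rule field_le_epsilon)
      fix e :: real assume e: "e > 0"
      have "{x} \<in> sets circle_borel" using x M_S1 by (intro sets_circle_closed) auto
      then obtain W where W: "open W" "{x} \<subseteq> W" "measure \<mu> (W \<inter> S1) \<le> measure \<mu> {x} + e"
        using circle_regular[OF D(1,2) _ e] by metis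
      have "open (cis -` W)" using W(1) by (intro open_vimage) (auto intro: continuous_intros)
      moreover have "t \<in> cis -` W" using W(2) t by simp
      ultimately have "\<exists>u>0. \<forall>s. dist s t < u \<longrightarrow> s \<in> cis -` W"
        unfolding open_dist by blast
      then obtain u where u: "u > 0" "\<And>s. dist s t < u \<Longrightarrow> cis s \<in> W" by auto
      have "w \<longlonglongrightarrow> K * 0"
        unfolding w_def using \<kappa> by (intro tendsto_intros LIMSEQ_power_zero) auto
      then have "\<forall>\<^sub>F n in sequentially. w n < u" using u(1) by (intro order_tendstoD(2)) auto
      then obtain n where n: "w n < u" by (auto simp: eventually_sequentially)
      have "cis s \<in> W \<inter> S1" if "s \<in> {t - w n..t + w n}" for s
      proof -
        have "dist s t < u" using that n by (auto simp: dist_real_def)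
        then show ?thesis using u(2) by simp
      qed
      then have "cis ` {t - w n..t + w n} \<subseteq> W \<inter> S1" by blast
      moreover have "W \<inter> S1 \<in> sets \<mu>"
        using W(1) S1_sets D(2) by (simp add: sets_circle_borel borel_open)
      ultimately have "measure \<mu> (cis ` {t - w n..t + w n}) \<le> measure \<mu> (W \<inter> S1)"
        by (intro finite_measure_mono)
      then show "b \<le> measure \<mu> {x} + e" using ge[of n] W(3) by simp
    qed
  qed
  have "M - N0 \<noteq> {}"
  proof
    assume *: "M - N0 = {}"
    show False using \<mu>(2) pos unfolding * Diff_empty by simp
  qed
  then obtain x where x: "x \<in> M - N0" by blast
  define Q where "Q = (\<lambda>g. g x) ` G"
  have Q: "infinite Q" "Q \<subseteq> M - N0" using orbit_infinite[of x] X_invariant x by (auto simp: Q_def)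
  obtain n :: nat where n: "measure \<mu> S1 < n * b" using b reals_Archimedean3 by blast
  obtain T where T: "T \<subseteq> Q" "card T = n" "finite T" using infinite_arbitrarily_large[OF Q(1)] by metis
  have sT: "{z} \<in> sets \<mu>" if "z \<in> T" for z
  proof -
    have "z \<in> S1" using that T Q M_S1 by blast
    then show ?thesis unfolding D(2) by (intro sets_circle_closed) auto
  qed
  have "n * b = (\<Sum>z\<in>T. b)" using T by simp
  also have "\<dots> \<le> (\<Sum>z\<in>T. measure \<mu> {z})" using T Q by (intro sum_mono atom) auto
  also have "\<dots> = measure \<mu> T"
    using finite_measure_eq_sum_singleton[OF T(3)] sT by simp
  also have "\<dots> \<le> measure \<mu> S1" using bounded_measure[of T] D(3) by simp
  finally show False using n by simp
qed

end

section \<open>The Lebesgue measure\<close>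

text \<open>The piece beyond \<open>2 * pi\<close> is moved back by one period to fill the gap
  before \<open>a\<close>.\<close>

lemma nn_integral_period:
  fixes f :: "real \<Rightarrow> ennreal"
  assumes [measurable]: "f \<in> borel_measurable borel" and per: "\<And>t. f (t + 2 * pi) = f t" and a: "a \<in> {0..<2 * pi}"
  shows "(\<integral>\<^sup>+t. f t * indicator {a..<a + 2 * pi} t \<partial>lborel) = (\<integral>\<^sup>+t. f t * indicator {0..<2 * pi} t \<partial>lborel)"
proof -
  have split: "(\<integral>\<^sup>+t. f t * indicator {u..<w} t \<partial>lborel) =
      (\<integral>\<^sup>+t. f t * indicator {u..<v} t \<partial>lborel) + (\<integral>\<^sup>+t. f t * indicator {v..<w} t \<partial>lborel)"
    if "u \<le> v" "v \<le> w" for u v w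
  proof -
    have "f t * indicator {u..<w} t = f t * indicator {u..<v} t + f t * indicator {v..<w} t" for t
      using that by (auto simp: indicator_def)
    then show ?thesis by (simp add: nn_integral_add)
  qed
  have shift: "(\<integral>\<^sup>+t. f t * indicator {2 * pi..<a + 2 * pi} t \<partial>lborel) = (\<integral>\<^sup>+t. f t * indicator {0..<a} t \<partial>lborel)"
  proof -
    have "f (2 * pi + 1 * t) * indicator {2 * pi..<a + 2 * pi} (2 * pi + 1 * t) = f t * indicator {0..<a} t" for t
      using per[of t] by (simp add: add.commute indicator_def)
    then show ?thesis
      using nn_integral_real_affine[of "\<lambda>t. f t * indicator {2 * pi..<a + 2 * pi} t" 1 "2 * pi"] by simp
  qed
  show ?thesis
    using split[of a "2 * pi" "a + 2 * pi"] split[of 0 a "2 * pi"] a shift by (simp add: add.commute)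
qed

lemma cis_measurable: "cis \<in> borel \<rightarrow>\<^sub>M circle_borel"
  unfolding circle_borel_def
  by (intro measurable_restrict_space2) (auto intro!: borel_measurable_continuous_onI continuous_intros)

context circle_group
begin

definition Z :: real where "Z = integral {0..2 * pi} r"

abbreviation Leb :: "complex measure" where "Leb \<equiv> circle_lebesgue \<rho>"

lemma r_has_integral: "(r has_integral Z) {0..2 * pi}"
  unfolding Z_def by (intro integrable_integral integrable_continuous_real r_continuous)

lemma Z_pos: "Z > 0"
proof -
  obtain K where K: "K \<ge> 1" "\<And>s t. r s \<le> K * r t" using r_comparable by blast
  have "r 0 / K \<le> r t" for t using K(2)[of 0 t] K(1) by (simp add: field_simps)
  then have "integral {0..2 * pi} (\<lambda>t. r 0 / K) \<le> Z"
    unfolding Z_def using r_has_integral by (intro integral_le) auto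
  moreover have "r 0 / K * (2 * pi) > 0" using K(1) by (intro mult_pos_pos divide_pos_pos) auto
  ultimately show ?thesis by (simp add: mult.commute)
qed

definition leb_density :: "real \<Rightarrow> ennreal" where
  "leb_density t = ennreal (r t / Z) * indicator {0..<2 * pi} t"

lemma r_measurable [measurable]: "r \<in> borel_measurable borel"
  by (intro borel_measurable_continuous_onI r_continuous)

lemma leb_density_measurable [measurable]: "leb_density \<in> borel_measurable borel"
  unfolding leb_density_def[abs_def] by measurable

lemma Leb_eq: "Leb = distr (density lborel leb_density) circle_borel cis"
proof -
  have "(\<lambda>t. ennreal (indicator {0..<2 * pi} t * \<rho> (cis t) / integral {0..2 * pi} (\<lambda>s. \<rho> (cis s)))) = leb_density"
    by (rule ext) (simp add: leb_density_def Z_def r_def[abs_def] indicator_def)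
  then show ?thesis by (simp add: circle_lebesgue_def)
qed

lemma sets_Leb: "sets Leb = sets circle_borel" and space_Leb: "space Leb = S1"
  by (simp_all add: Leb_eq space_circle_borel)

lemma nn_integral_Leb:
  assumes [measurable]: "f \<in> borel_measurable circle_borel"
  shows "(\<integral>\<^sup>+x. f x \<partial>Leb) = (\<integral>\<^sup>+t. leb_density t * f (cis t) \<partial>lborel)"
proof -
  have [measurable]: "cis \<in> borel \<rightarrow>\<^sub>M circle_borel" by (rule cis_measurable)
  show ?thesis
    unfolding Leb_eq by (subst nn_integral_distr) (auto simp: nn_integral_density)
qed

lemma emeasure_Leb:
  assumes "B \<in> sets circle_borel"
  shows "emeasure Leb B = (\<integral>\<^sup>+t. leb_density t * indicator B (cis t) \<partial>lborel)"
  using nn_integral_Leb[of "indicator B"] assms by (simp add: sets_Leb)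

lemma AE_neq_lborel: "AE t in lborel. t \<noteq> (a::real)"
  by (rule AE_I'[of "{a}"]) (auto intro: countable_imp_null_set_lborel)

lemma Leb_prob: "prob_space Leb"
proof (rule prob_spaceI)
  have "(\<integral>\<^sup>+t. leb_density t * indicator S1 (cis t) \<partial>lborel) =
      (\<integral>\<^sup>+t. ennreal (indicator {0..2 * pi} t * (r t / Z)) \<partial>lborel)"
    using AE_neq_lborel[of "2 * pi"]
    by (intro nn_integral_cong_AE) (auto elim!: eventually_mono simp: leb_density_def indicator_def)
  also have "\<dots> = ennreal (Z / Z)"
    using has_integral_divide[OF r_has_integral, of Z] Z_pos
    by (intro nn_integral_has_integral_lebesgue) (auto simp: less_imp_le)
  finally show "emeasure Leb (space Leb) = 1"
    using emeasure_Leb[OF S1_sets] Z_pos by (simp add: space_Leb)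
qed

text \<open>Change of variables for the lift, normalised to send 0 into the first period so that the
  image of a period can be exchanged for the standard one. The densities match because
  \<open>r (F t) * deriv F t = r t * dd F t\<close>.\<close>

lemma Leb_conformal: "finite_conformal 1 Leb"
proof -
  have "emeasure Leb (g ` B) = (\<integral>\<^sup>+x\<in>B. ennreal (metric_deriv \<rho> g x powr 1) \<partial>Leb)"
    if g: "g \<in> G" and B: "B \<in> sets circle_borel" for g B
  proof -
    obtain F0 where F0: "F0 \<in> lifts" "\<And>t. g (cis t) = cis (F0 t)" by (rule lift_exists[OF g]) (rule that)
    obtain k :: int where k: "F0 0 + 2 * pi * of_int k \<in> {0..<0 + 2 * pi}" by (rule angle_reduce) (rule that)
    define F where "F t = F0 t + 2 * pi * of_int k" for t
    have F: "F \<in> lifts" unfolding F_def by (rule lift_shift[OF F0(1)])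
    have gF: "g (cis t) = cis (F t)" for t by (simp add: F_def F0(2))
    have Fa: "F 0 \<in> {0..<2 * pi}" "F (2 * pi) = F 0 + 2 * pi" using k lift_add_2pi[OF F, of 0] by (simp_all add: F_def)
    have BS: "B \<subseteq> S1" using B by (simp add: sets_circle_borel)
    note gB = G_image_sets[OF g B]
    have [measurable]: "cis \<in> borel \<rightarrow>\<^sub>M circle_borel" by (rule cis_measurable)
    define f where "f t = ennreal (r t / Z) * indicator (g ` B) (cis t)" for t
    have fm [measurable]: "f \<in> borel_measurable borel" unfolding f_def[abs_def] using gB by measurable
    have per: "f (t + 2 * pi) = f t" for t
      using cis_add_2pi_int[of t 1] r_2pi[of t 1] by (simp add: f_def)
    have mem: "cis (F t) \<in> g ` B \<longleftrightarrow> cis t \<in> B" for t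
    proof
      assume "cis (F t) \<in> g ` B"
      then obtain x where x: "x \<in> B" "g (cis t) = g x" using gF[of t] by auto
      then have "cis t = x" using G_inj[OF g _ _ x(2)] BS by auto
      then show "cis t \<in> B" using x by simp
    next
      assume "cis t \<in> B"
      then show "cis (F t) \<in> g ` B" unfolding gF[symmetric] by (rule imageI)
    qed
    have "emeasure Leb (g ` B) = (\<integral>\<^sup>+t. f t * indicator {0..<2 * pi} t \<partial>lborel)"
      unfolding emeasure_Leb[OF gB] f_def leb_density_def by (simp add: mult_ac)
    also have "\<dots> = (\<integral>\<^sup>+t. f t * indicator {F 0..<F 0 + 2 * pi} t \<partial>lborel)"
      using nn_integral_period[OF fm per Fa(1)] by simp
    \<comment> \<open>The substitution is made on closed intervals; the added endpoint is
      null.\<close>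
    also have "\<dots> = (\<integral>\<^sup>+t. f t * indicator {F 0..F (2 * pi)} t \<partial>lborel)"
      unfolding Fa(2) using AE_neq_lborel[of "F 0 + 2 * pi"]
      by (intro nn_integral_cong_AE) (auto elim!: eventually_mono simp: indicator_def)
    also have "\<dots> = (\<integral>\<^sup>+t. f (F t) * ennreal (deriv F t) * indicator {0..2 * pi} t \<partial>lborel)"
      using lift_DERIV[OF F] lift_deriv_pos[OF F]
      by (intro nn_integral_substitution_aux fm continuous_on_subset[OF lift_deriv_continuous[OF F]]) (auto simp: less_imp_le)
    also have "\<dots> = (\<integral>\<^sup>+t. leb_density t * (ennreal (metric_deriv \<rho> g (cis t) powr 1) * indicator B (cis t)) \<partial>lborel)"
    proof (intro nn_integral_cong_AE)
      have "f (F t) * ennreal (deriv F t) = ennreal (r t / Z) * (ennreal (dd F t powr 1) * indicator B (cis t))" for t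
      proof (cases "cis t \<in> B")
        case True
        have "r (F t) / Z * deriv F t = r t / Z * dd F t" by (simp add: dd_def)
        moreover have "dd F t > 0" using F by simp
        ultimately show ?thesis
          using True Z_pos lift_deriv_pos[OF F, of t]
          by (simp add: f_def mem ennreal_mult[symmetric] less_imp_le)
      next
        case False
        then show ?thesis by (simp add: f_def mem)
      qed
      then show "AE t in lborel. f (F t) * ennreal (deriv F t) * indicator {0..2 * pi} t =
          leb_density t * (ennreal (metric_deriv \<rho> g (cis t) powr 1) * indicator B (cis t))"
        using AE_neq_lborel[of "2 * pi"] unfolding metric_deriv_eq_dd[OF g F gF]
        by (auto elim!: eventually_mono simp: leb_density_def indicator_def)
    qed
    also have "\<dots> = (\<integral>\<^sup>+x\<in>B. ennreal (metric_deriv \<rho> g x powr 1) \<partial>Leb)"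
    proof (rule nn_integral_Leb[symmetric])
      show "(\<lambda>x. ennreal (metric_deriv \<rho> g x powr 1) * indicator B x) \<in> borel_measurable circle_borel"
        using metric_deriv_measurable[OF g] B by measurable
    qed
    finally show ?thesis .
  qed
  then show ?thesis
    unfolding finite_conformal_def using Leb_prob prob_space.finite_measure sets_Leb by blast
qed

lemma Leb_countable: assumes "countable A" "A \<subseteq> S1" shows "A \<in> null_sets Leb"
proof -
  have A: "A \<in> sets circle_borel" using assms by (rule countable_sets_circle)
  have "countable (cis ` ({0..<0 + 2 * pi} \<inter> cis -` A))" by (rule countable_subset[OF _ assms(1)]) auto
  then have "countable ({0..<0 + 2 * pi} \<inter> cis -` A)"
    by (rule countable_image_inj_on) (rule inj_on_subset[OF inj_on_cis], blast)
  then have "{0..<0 + 2 * pi} \<inter> cis -` A \<in> null_sets lborel" by (rule countable_imp_null_set_lborel)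
  then have "AE t in lborel. leb_density t * indicator A (cis t) = 0"
    by (rule AE_I') (auto simp: leb_density_def indicator_def split: if_splits)
  then have "emeasure Leb A = (\<integral>\<^sup>+t. 0 \<partial>(lborel :: real measure))"
    unfolding emeasure_Leb[OF A] by (rule nn_integral_cong_AE)
  then show ?thesis using A by (intro null_setsI) (simp_all add: sets_Leb)
qed

lemma Leb_open_pos:
  assumes W: "open W" and x: "x \<in> W \<inter> S1"
  shows "measure Leb (W \<inter> S1) > 0"
proof -
  interpret prob_space Leb by (rule Leb_prob)
  have WS: "W \<inter> S1 \<in> sets circle_borel" using W S1_sets by (simp add: sets_circle_borel borel_open)
  obtain t where t: "t \<in> {0..<2 * pi}" "x = cis t" using cis_range_reduce x by blast
  have "open (cis -` W)" using W by (intro open_vimage) (auto intro: continuous_intros)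
  moreover have "t \<in> cis -` W" using x t by simp
  ultimately have "\<exists>u>0. \<forall>s. dist s t < u \<longrightarrow> s \<in> cis -` W"
    unfolding open_dist by blast
  then obtain u where u: "u > 0" "\<And>s. dist s t < u \<Longrightarrow> cis s \<in> W" by auto
  \<comment> \<open>One-sided and cut at \<open>2 * pi\<close>, where the density on the line ends;
    it is nonempty because \<open>t < 2 * pi\<close>.\<close>
  define I where "I = {t<..<min (t + u) (2 * pi)}"
  have I: "s \<in> {0..<2 * pi}" "cis s \<in> W \<inter> S1" if "s \<in> I" for s
    using that t u(2)[of s] by (auto simp: I_def dist_real_def)
  have [measurable]: "cis \<in> borel \<rightarrow>\<^sub>M circle_borel" by (rule cis_measurable)
  have "emeasure Leb (W \<inter> S1) \<noteq> 0"
  proof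
    assume "emeasure Leb (W \<inter> S1) = 0"
    then have "(\<integral>\<^sup>+t. leb_density t * indicator (W \<inter> S1) (cis t) \<partial>lborel) = 0"
      using emeasure_Leb[OF WS] by simp
    moreover have "(\<lambda>t. leb_density t * indicator (W \<inter> S1) (cis t)) \<in> borel_measurable borel"
      by (intro borel_measurable_times_ennreal leb_density_measurable
          measurable_compose[OF cis_measurable] borel_measurable_indicator WS)
    then have "(\<lambda>t. leb_density t * indicator (W \<inter> S1) (cis t)) \<in> borel_measurable lborel"
      by (simp cong: measurable_cong_sets)
    ultimately have "AE s in lborel. leb_density s * indicator (W \<inter> S1) (cis s) = 0"
      by (simp only: nn_integral_0_iff_AE)
    moreover have "leb_density s * indicator (W \<inter> S1) (cis s) \<noteq> 0" if "s \<in> I" for s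
    proof -
      have "r s / Z > 0" using Z_pos by simp
      then have "ennreal (r s / Z) \<noteq> 0" by (simp add: ennreal_eq_0_iff not_le)
      then show ?thesis using I[OF that] by (simp add: leb_density_def)
    qed
    ultimately have "AE s in lborel. s \<notin> I" by (auto elim!: eventually_mono)
    then have "emeasure lborel I = 0"
      using AE_iff_null_sets[of I lborel] by (simp add: I_def null_setsD1)
    moreover have "t < min (t + u) (2 * pi)" using u(1) t(1) by auto
    then have "emeasure lborel I = ennreal (min (t + u) (2 * pi) - t)"
      unfolding I_def by (intro emeasure_lborel_Ioo) simp
    ultimately show False using \<open>t < _\<close> by (simp add: ennreal_eq_0_iff)
  qed
  then show ?thesis by (simp add: emeasure_eq_measure zero_less_measure_iff)
qed

end

section \<open>The two kinds of minimal sets\<close>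

lemma infinite_S1: "infinite S1"
proof
  assume "finite S1"
  then have "finite (cis ` {0..<0 + 2 * pi})" by (rule finite_subset[rotated]) auto
  then have "finite {0..<0 + 2 * pi}" using inj_on_cis finite_imageD by blast
  then show False using infinite_Ico[of 0 "2 * pi"] by simp
qed

lemma cantor_summable: "summable (\<lambda>n. (if a n then 2 else 0) / (3::real) ^ Suc n)"
proof (rule summable_comparison_test'[of "\<lambda>n. 2 * (1 / 3) ^ Suc n" 0])
  show "summable (\<lambda>n. 2 * (1 / 3 :: real) ^ Suc n)"
    by (intro summable_mult) (simp add: summable_Suc_iff summable_geometric)
qed (auto simp: power_divide)

lemma geometric_tail: "(\<lambda>n. 2 / (3::real) ^ (n + k + 1)) sums (1 / 3 ^ k)"
proof -
  have "(\<lambda>n. 2 / 3 ^ (k + 1) * (1 / 3 :: real) ^ n) sums (2 / 3 ^ (k + 1) * (1 / (1 - 1 / 3)))"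
    by (intro sums_mult geometric_sums) simp
  then show ?thesis by (simp add: power_add power_divide field_simps)
qed

text \<open>The point 1/2 is missing between 0 and 1: with first digit 2 the sum is at least 2/3,
  with first digit 0 at most 1/3.\<close>

lemma cantor_not_connected: "\<not> connected cantor_set"
proof
  assume con: "connected cantor_set"
  have "0 \<in> cantor_set" unfolding cantor_set_def by (rule range_eqI[of _ _ "\<lambda>_. False"]) simp
  moreover have "1 \<in> cantor_set" unfolding cantor_set_def
    using sums_unique[OF geometric_tail[of 0]] by (intro range_eqI[of _ _ "\<lambda>_. True"]) simp
  ultimately have "{0..1} \<subseteq> cantor_set" using con connected_contains_Icc by blast
  then have "1 / 2 \<in> cantor_set" by (auto simp: subset_iff)
  then obtain a :: "nat \<Rightarrow> bool" where a: "1 / 2 = (\<Sum>n. (if a n then 2 else 0) / (3::real) ^ Suc n)"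
    by (auto simp: cantor_set_def)
  define f where "f n = (if a n then 2 else 0) / (3::real) ^ Suc n" for n
  have f: "summable f" unfolding f_def[abs_def] by (rule cantor_summable)
  have "1 / 2 = suminf f" using a unfolding f_def[abs_def] .
  then have split: "(\<Sum>n. f (Suc n)) = 1 / 2 - f 0" using suminf_split_head[OF f] by simp
  have fS: "summable (\<lambda>n. f (Suc n))" using f by (simp add: summable_Suc_iff)
  have "(\<Sum>n. f (Suc n)) \<ge> 0" by (intro suminf_nonneg fS) (simp add: f_def)
  moreover have "(\<Sum>n. f (Suc n)) \<le> (\<Sum>n. 2 / (3::real) ^ (n + 1 + 1))"
    using sums_summable[OF geometric_tail[of 1]] by (intro suminf_le fS) (auto simp: f_def)
  then have "(\<Sum>n. f (Suc n)) \<le> 1 / 3" using sums_unique[OF geometric_tail[of 1]] by simp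
  moreover have "f 0 = 2 / 3 \<or> f 0 = 0" by (simp add: f_def)
  ultimately show False using split by auto
qed

text \<open>Expansions with a single digit 2 already give infinitely many values.\<close>

lemma infinite_cantor: "infinite cantor_set"
proof
  assume fin: "finite cantor_set"
  have val: "(\<Sum>n. (if n = k then 2 else 0) / (3::real) ^ Suc n) = 2 / 3 ^ Suc k" for k
  proof -
    have "(\<lambda>n. if n = k then 2 / (3::real) ^ Suc n else 0) sums (2 / 3 ^ Suc k)" by (rule sums_single)
    then show ?thesis
      by (intro sums_unique[symmetric]) (simp add: if_distrib[of "\<lambda>x. x / _"] cong: if_cong)
  qed
  have "(\<lambda>k. 2 / (3::real) ^ Suc k) ` UNIV \<subseteq> cantor_set"
  proof safe
    fix k
    show "2 / (3::real) ^ Suc k \<in> cantor_set"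
      unfolding cantor_set_def val[of k, symmetric] by (rule range_eqI[of _ _ "\<lambda>n. n = k"]) simp
  qed
  then have "finite (range (\<lambda>k. 2 / (3::real) ^ Suc k))" using fin finite_subset by blast
  moreover have "inj (\<lambda>k. 2 / (3::real) ^ Suc k)" by (rule injI) simp
  ultimately show False using finite_imageD infinite_UNIV_nat by blast
qed

context circle_group
begin

text \<open>\<open>M_min\<close> is dual to density of orbits: the orbit of \<open>x\<close> enters
  the open arc, and the inverse of the element that takes \<open>x\<close> there puts
  \<open>x\<close> into a translate.\<close>

lemma minimal_set_S1:
  assumes "acts_minimally G" "property_star \<rho> G" shows "minimal_set \<rho> G S1"
proof unfold_locales
  show "closed S1" "S1 \<subseteq> S1" by auto
  show "infinite S1" by (rule infinite_S1)
  show "g ` S1 = S1" if "g \<in> G" for g using G_image_S1 that .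
  show "isolated_fixers G x" if "x \<in> S1 \<inter> NE \<rho> G" for x using assms that by (auto simp: property_star_def)
  fix y \<eta> :: real assume "cis y \<in> S1" and \<eta>: "\<eta> > 0"
  show "S1 \<subseteq> (\<Union>g\<in>G. g ` arc_ball y \<eta>)"
  proof
    fix x assume x: "x \<in> S1"
    obtain W where W: "open W" "arc_ball y \<eta> = W \<inter> S1" by (rule arc_open) (rule that)
    have "cis y \<in> arc_ball y \<eta>" using \<eta> by (intro imageI) simp
    then have "cis y \<in> W" using W by blast
    moreover have "cis y \<in> closure (orbit_set G {x})"
      using assms(1) x \<open>cis y \<in> S1\<close> unfolding acts_minimally_def by blast
    ultimately have "W \<inter> orbit_set G {x} \<noteq> {}" using open_Int_closure_eq_empty[OF W(1)] by blast
    then obtain g where g: "g \<in> G" "g x \<in> W" by (auto simp: orbit_set_def)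
    obtain k where k: "k \<in> G" "\<forall>x\<in>S1. k (g x) = x \<and> g (k x) = x" using G_inv[OF g(1)] by blast
    have "g x \<in> arc_ball y \<eta>" unfolding W(2) using g G_S1 x by blast
    moreover have "x = k (g x)" using k x by simp
    ultimately have "x \<in> k ` arc_ball y \<eta>" by (metis image_eqI)
    then show "x \<in> (\<Union>g\<in>G. g ` arc_ball y \<eta>)" using k(1) by blast
  qed
qed

lemma G_arcs_open:
  obtains W where "open W" "(\<Union>g\<in>G. g ` cis ` {a<..<b}) = W \<inter> S1"
proof -
  have "\<forall>g\<in>G. \<exists>W. open W \<and> g ` cis ` {a<..<b} = W \<inter> S1"
  proof
    fix g assume "g \<in> G"
    then obtain F where F: "F \<in> lifts" "\<And>t. g (cis t) = cis (F t)" by (rule lift_exists) (rule that)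
    obtain W where "open W" "cis ` {F a<..<F b} = W \<inter> S1" by (rule arc_open) (rule that)
    then show "\<exists>W. open W \<and> g ` cis ` {a<..<b} = W \<inter> S1"
      using lift_image_arc[OF F] by metis
  qed
  from bchoice[OF this] obtain W where *: "\<forall>g\<in>G. open (W g) \<and> g ` cis ` {a<..<b} = W g \<inter> S1" ..
  then have W: "\<And>g. g \<in> G \<Longrightarrow> open (W g)" "\<And>g. g \<in> G \<Longrightarrow> g ` cis ` {a<..<b} = W g \<inter> S1" by simp_all
  have "open (\<Union>g\<in>G. W g)" using W(1) by blast
  moreover have "(\<Union>g\<in>G. g ` cis ` {a<..<b}) = (\<Union>g\<in>G. W g) \<inter> S1" using W(2) by simp
  ultimately show ?thesis by (rule that)
qed

text \<open>For \<open>M_min\<close>, the part of \<open>\<Lambda>\<close> outside the translates of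
  the arc is closed, invariant and misses \<open>cis y\<close>, so minimality leaves it
  empty.\<close>

lemma minimal_set_exceptional:
  assumes L: "exceptional_minimal_set G \<Lambda>" and star: "property_lambda_star \<rho> G \<Lambda>"
  shows "minimal_set \<rho> G \<Lambda>"
proof unfold_locales
  have inv: "\<Lambda> \<subseteq> S1" "\<And>g. g \<in> G \<Longrightarrow> g ` \<Lambda> = \<Lambda>" and cl: "closed \<Lambda>" and hom: "\<Lambda> homeomorphic cantor_set"
    and min: "\<And>K. K \<noteq> {} \<Longrightarrow> closed K \<Longrightarrow> invariant_set G K \<Longrightarrow> K \<subseteq> \<Lambda> \<Longrightarrow> K = \<Lambda>"
    using L by (auto simp: exceptional_minimal_set_def invariant_set_def)
  show "closed \<Lambda>" "\<Lambda> \<subseteq> S1" "\<And>g. g \<in> G \<Longrightarrow> g ` \<Lambda> = \<Lambda>" by fact+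
  show "isolated_fixers G x" if "x \<in> \<Lambda> \<inter> NE \<rho> G" for x using star that by (auto simp: property_lambda_star_def)
  show "infinite \<Lambda>"
  proof
    assume fin: "finite \<Lambda>"
    obtain f g where "homeomorphism \<Lambda> cantor_set f g" using hom by (auto simp: homeomorphic_def)
    then have "cantor_set = f ` \<Lambda>" by (simp add: homeomorphism_def)
    with finite_imageI[OF fin, of f] have "finite cantor_set" by (simp only:)
    with infinite_cantor show False ..
  qed
  fix y \<eta> :: real assume y: "cis y \<in> \<Lambda>" and \<eta>: "\<eta> > 0"
  define U where "U = (\<Union>g\<in>G. g ` arc_ball y \<eta>)"
  obtain W where "open W" "(\<Union>g\<in>G. g ` arc_ball y \<eta>) = W \<inter> S1" by (rule G_arcs_open) (rule that)
  then have W: "open W" "U = W \<inter> S1" by (simp_all only: U_def)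
  have cy: "cis y \<in> U"
  proof -
    obtain e where e: "e \<in> G" "\<forall>x\<in>S1. e x = x" using G_id by blast
    then have "cis y = e (cis y)" by simp
    moreover have "cis y \<in> arc_ball y \<eta>" using \<eta> by (intro imageI) simp
    ultimately have "cis y \<in> e ` arc_ball y \<eta>" by (rule image_eqI)
    then show ?thesis unfolding U_def using e(1) by blast
  qed
  have "\<Lambda> - U = {}"
  proof (rule ccontr)
    assume ne: "\<Lambda> - U \<noteq> {}"
    have "\<Lambda> - U = \<Lambda> - W" using W(2) inv(1) by blast
    then have closed: "closed (\<Lambda> - U)" using cl W(1) by (simp add: closed_Diff)
    have invU: "invariant_set G (\<Lambda> - U)"
    proof (rule invariant_setI)
      show "\<Lambda> - U \<subseteq> S1" using inv(1) by (rule order_trans[OF Diff_subset])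
      fix g x assume g: "g \<in> G" and x: "x \<in> \<Lambda> - U"
      obtain k where k: "k \<in> G" "\<forall>x\<in>S1. k (g x) = x \<and> g (k x) = x" using G_inv[OF g] by blast
      have "g x \<notin> U"
      proof
        assume "g x \<in> U"
        then obtain h s where h: "h \<in> G" "s \<in> {y - \<eta><..<y + \<eta>}" "g x = h (cis s)" by (auto simp: U_def)
        obtain j where j: "j \<in> G" "\<forall>x\<in>S1. j x = k (h x)" using G_comp[OF k(1) h(1)] by blast
        have "x = k (g x)" using k(2) x inv(1) by auto
        also have "\<dots> = j (cis s)" using j(2) h(3) by simp
        finally have "x \<in> U" unfolding U_def using j(1) h(2) by blast
        then show False using x by blast
      qed
      then show "g x \<in> \<Lambda> - U" using inv(2)[OF g] x by blast
    qed
    have "\<Lambda> - U = \<Lambda>" by (rule min[OF ne closed invU Diff_subset])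
    then show False using y cy by blast
  qed
  then show "\<Lambda> \<subseteq> (\<Union>g\<in>G. g ` arc_ball y \<eta>)" by (auto simp: U_def)
qed

text \<open>An arc inside \<open>\<Lambda>\<close> would make \<open>\<Lambda>\<close>, the union of
  its translates, open as well as closed in the circle. It would then be the whole circle, which is
  connected, unlike the Cantor set.\<close>

lemma exceptional_no_arc:
  assumes L: "exceptional_minimal_set G \<Lambda>" and star: "property_lambda_star \<rho> G \<Lambda>"
    and y: "cis y \<in> \<Lambda>" and \<eta>: "\<eta> > 0"
  shows "\<not> arc_ball y \<eta> \<subseteq> \<Lambda>"
proof
  assume sub: "arc_ball y \<eta> \<subseteq> \<Lambda>"
  interpret minimal_set \<rho> G \<Lambda> by (rule minimal_set_exceptional[OF L star])
  obtain W where W: "open W" "(\<Union>g\<in>G. g ` arc_ball y \<eta>) = W \<inter> S1" by (rule G_arcs_open) (rule that)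
  have "(\<Union>g\<in>G. g ` arc_ball y \<eta>) \<subseteq> \<Lambda>" using sub M_inv by blast
  with M_min[OF y \<eta>] W(2) have eq: "\<Lambda> = W \<inter> S1" by blast
  have "openin (top_of_set S1) \<Lambda>" using W(1) eq by (auto simp: openin_open)
  moreover have "closedin (top_of_set S1) \<Lambda>" using M_closed M_S1 by (auto simp: closedin_closed)
  moreover have conS: "connected S1" by (rule connected_sphere) simp
  ultimately have "\<Lambda> = S1" using y connected_clopen by blast
  then have "connected \<Lambda>" using conS by simp
  moreover have "\<Lambda> homeomorphic cantor_set" using L by (simp add: exceptional_minimal_set_def)
  ultimately show False using homeomorphic_connectedness cantor_not_connected by blast
qed

end

context minimal_set
begin

lemma null_outside:
  assumes \<mu>: "sets \<mu> = sets circle_borel" and "supported_on \<mu> M" "not_charging \<mu> N0"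
  shows "measure \<mu> (S1 - (M - N0)) = 0"
proof -
  have "(S1 - M) \<union> N0 \<in> null_sets \<mu>" using assms by (auto simp: supported_on_def not_charging_def)
  moreover have "S1 - (M - N0) = (S1 - M) \<union> N0" using N0_subset M_S1 by blast
  ultimately show ?thesis by (simp add: measure_def null_sets_def)
qed

lemma nonatomic_countable_null:
  assumes \<mu>: "sets \<mu> = sets circle_borel" and "nonatomic \<mu>" and A: "countable A" "A \<subseteq> S1"
  shows "A \<in> null_sets \<mu>"
proof -
  have "{x} \<in> null_sets \<mu>" if "x \<in> A" for x
    using that assms countable_sets_circle[of "{x}"] by (intro null_setsI) (auto simp: nonatomic_def)
  then have "(\<Union>x\<in>A. {x}) \<in> null_sets \<mu>" using A(1) by (intro null_sets_UN')
  then show ?thesis by simp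
qed

text \<open>Absence of atoms makes the countable set \<open>N0\<close> null, so that all mass lies
  on \<open>M - N0\<close>, where restrictions to invariant sets can be compared.\<close>

lemma nonatomic_conformal_ergodic:
  assumes "conformal \<rho> G \<mu>" "supported_on \<mu> M" "nonatomic \<mu>"
  shows "ergodic G \<mu>"
proof -
  obtain \<delta> where \<mu>: "prob_space \<mu>" "finite_conformal \<delta> \<mu>"
    using assms by (auto simp: conformal_def conformal_exp_iff)
  note D = finite_conformalD[OF \<mu>(2)]
  interpret prob_space \<mu> by (rule \<mu>)
  have "N0 \<in> null_sets \<mu>"
    using nonatomic_countable_null[OF D(2) assms(3) countable_N0] N0_subset M_S1 by blast
  then have null: "measure \<mu> (S1 - (M - N0)) = 0"
    using null_outside[OF D(2) assms(2)] by (simp add: not_charging_def)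
  have "quasi_invariant G \<mu>"
    unfolding quasi_invariant_def using finite_conformal_null_image[OF \<mu>(2)] D(2) by simp
  moreover have "emeasure \<mu> A = 0 \<or> emeasure \<mu> (S1 - A) = 0"
    if "A \<in> sets \<mu>" "invariant_set G A" for A
    using conformal_ergodic[OF \<mu>(2) null] that D(2) by (simp add: emeasure_eq_measure)
  ultimately show ?thesis by (simp add: ergodic_def)
qed

lemma not_charging_unique:
  assumes "conformal \<rho> G \<mu>" "supported_on \<mu> M" "not_charging \<mu> N0"
    and "conformal \<rho> G \<nu>" "supported_on \<nu> M" "not_charging \<nu> N0"
  shows "\<mu> = \<nu>"
proof -
  obtain \<delta> \<delta>' where \<mu>: "prob_space \<mu>" "finite_conformal \<delta> \<mu>" and \<nu>: "prob_space \<nu>" "finite_conformal \<delta>' \<nu>"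
    using assms by (auto simp: conformal_def conformal_exp_iff)
  show ?thesis
    by (rule conformal_unique(2)[OF \<mu>(2) null_outside \<mu>(1) \<nu>(2) null_outside \<nu>(1)])
      (use finite_conformalD(2)[OF \<mu>(2)] finite_conformalD(2)[OF \<nu>(2)] assms in auto)
qed

end

section \<open>The theorem\<close>

context circle_group
begin

text \<open>Another conformal measure must charge \<open>N0\<close>, by uniqueness. For
  \<open>\<delta> \<le> 1\<close> its restriction to \<open>N0\<close> would dominate the Lebesgue
  measure, impossible because \<open>N0\<close> is countable. For \<open>\<delta> > 1\<close> its
  restriction to the complement of \<open>N0\<close> vanishes by comparison with the Lebesgue
  measure, whose exponent is smaller. What remains sits on a countable set.\<close>

lemma minimal_case:
  assumes min: "acts_minimally G" "property_star \<rho> G"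
  shows "conformal \<rho> G Leb" "not_charging Leb (orbit_set G (NE \<rho> G))"
    "conformal \<rho> G \<mu> \<Longrightarrow> not_charging \<mu> (orbit_set G (NE \<rho> G)) \<Longrightarrow> \<mu> = Leb"
    "conformal_exp \<rho> G \<delta> \<mu> \<Longrightarrow> \<mu> \<noteq> Leb \<Longrightarrow>
       atomic \<mu> \<and> supported_on \<mu> (orbit_set G (NE \<rho> G)) \<and> \<delta> > 1"
proof -
  interpret minimal_set \<rho> G S1 by (rule minimal_set_S1[OF min])
  have "S1 \<inter> NE \<rho> G = NE \<rho> G" by (auto simp: NE_def)
  then have N0: "orbit_set G (NE \<rho> G) = N0" by (simp add: N0_def)
  have supp: "supported_on \<mu> S1" for \<mu> by (simp add: supported_on_def)
  show conf: "conformal \<rho> G Leb"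
    unfolding conformal_def conformal_exp_iff using Leb_prob Leb_conformal by blast
  have nc: "not_charging Leb N0"
    unfolding not_charging_def using Leb_countable[OF countable_N0] N0_subset by blast
  then show "not_charging Leb (orbit_set G (NE \<rho> G))" by (simp add: N0)
  show uniq: "\<mu> = Leb" if "conformal \<rho> G \<mu>" "not_charging \<mu> (orbit_set G (NE \<rho> G))" for \<mu>
    using not_charging_unique[OF that(1) supp _ conf supp nc] that(2) by (simp add: N0)
  show "atomic \<mu> \<and> supported_on \<mu> (orbit_set G (NE \<rho> G)) \<and> \<delta> > 1"
    if c: "conformal_exp \<rho> G \<delta> \<mu>" and ne: "\<mu> \<noteq> Leb"
  proof -
    have \<mu>: "prob_space \<mu>" "finite_conformal \<delta> \<mu>" using c by (auto simp: conformal_exp_iff)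
    note D = finite_conformalD[OF \<mu>(2)]
    interpret prob_space \<mu> by (rule \<mu>)
    have nullLeb: "measure Leb (S1 - (S1 - N0)) = 0" using null_outside[OF sets_Leb supp nc] .
    have oneLeb: "measure Leb S1 = 1" using prob_space.prob_space[OF Leb_prob] by (simp add: space_Leb)
    have Xs: "S1 - N0 \<in> sets circle_borel" using S1_sets N0_sets by blast
    have inv: "invariant_set G (S1 - N0)" by (rule invariant_set_complement[OF N0_invariant_set])
    have N0S: "N0 \<subseteq> S1" using N0_subset .
    obtain \<mu>2 where 2: "finite_conformal \<delta> \<mu>2"
      "\<And>B. B \<in> sets circle_borel \<Longrightarrow> emeasure \<mu>2 B = emeasure \<mu> (N0 \<inter> B)"
      using finite_conformal_restrict[OF \<mu>(2) N0_sets N0_invariant_set] by blast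
    obtain \<mu>1 where 1: "finite_conformal \<delta> \<mu>1"
      "\<And>B. B \<in> sets circle_borel \<Longrightarrow> emeasure \<mu>1 B = emeasure \<mu> ((S1 - N0) \<inter> B)"
      using finite_conformal_restrict[OF \<mu>(2) Xs inv] by blast
    have m1: "measure \<mu>1 B = measure \<mu> ((S1 - N0) \<inter> B)" and m2: "measure \<mu>2 B = measure \<mu> (N0 \<inter> B)"
      if "B \<in> sets circle_borel" for B
      using 1(2)[OF that] 2(2)[OF that] by (simp_all add: measure_def)
    have N0pos: "measure \<mu> N0 > 0"
    proof (rule ccontr)
      assume "\<not> ?thesis"
      then have "measure \<mu> N0 = 0" by (simp add: zero_less_measure_iff)
      then have "not_charging \<mu> N0"
        unfolding not_charging_def using N0_sets D(2) by (intro null_setsI) (auto simp: emeasure_eq_measure)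
      moreover have "conformal \<rho> G \<mu>" using c by (auto simp: conformal_def)
      ultimately show False using uniq ne by (simp add: N0)
    qed
    have "measure \<mu>2 S1 > 0" using N0pos m2[OF S1_sets] N0S by (simp add: Int_absorb2)
    then have ch2: "charges_arcs \<mu>2" by (intro conformal_charges_arcs[OF 2(1)]) auto
    have "measure \<mu>2 (S1 - N0) = 0"
    proof -
      have "N0 \<inter> (S1 - N0) = {}" by blast
      then show ?thesis using m2[OF Xs] by simp
    qed
    have \<delta>: "\<delta> > 1"
    proof (rule ccontr)
      assume "\<not> \<delta> > 1"
      then have "\<delta> \<le> 1" by simp
      from conformal_comparison[OF Leb_conformal nullLeb 2(1) ch2 this]
      obtain C where "C > 0" and C: "\<And>\<epsilon> A. 0 < \<epsilon> \<Longrightarrow> \<epsilon> \<le> 1 \<Longrightarrow> A \<in> sets circle_borel \<Longrightarrow>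
        measure Leb A \<le> C * \<epsilon> powr (1 - \<delta>) * measure \<mu>2 A" by metis
      have "measure Leb (S1 - N0) \<le> 0" using C[of 1 "S1 - N0"] Xs \<open>measure \<mu>2 (S1 - N0) = 0\<close> by simp
      moreover have "measure Leb (S1 - N0) = measure Leb S1"
        using nc S1_sets sets_Leb by (intro measure_Diff_null_set) (auto simp: not_charging_def)
      ultimately show False using oneLeb by simp
    qed
    have chLeb: "charges_arcs Leb" by (intro conformal_charges_arcs[OF Leb_conformal]) (auto simp: oneLeb)
    have comp: "S1 - (S1 - N0) \<in> sets circle_borel" using Xs S1_sets by blast
    have "(S1 - N0) \<inter> (S1 - (S1 - N0)) = {}" by blast
    then have "measure \<mu>1 (S1 - (S1 - N0)) = 0" using m1[OF comp] by simp
    from smaller_exponent_null[OF 1(1) this Leb_conformal chLeb \<delta>]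
    have "measure \<mu> (S1 - N0) = 0" using m1[OF S1_sets] by (simp add: Int_absorb2)
    then have outside: "S1 - N0 \<in> null_sets \<mu>"
      using Xs D(2) by (intro null_setsI) (auto simp: emeasure_eq_measure)
    \<comment> \<open>The massless points of \<open>N0\<close> are countably many and join the null
      set, so almost every point is an atom.\<close>
    define P where "P = {x \<in> N0. emeasure \<mu> {x} = 0}"
    have "{x} \<in> null_sets \<mu>" if "x \<in> P" for x
      using that N0S countable_sets_circle[of "{x}"] D(2) by (intro null_setsI) (auto simp: P_def)
    moreover have "countable P" using countable_N0 by (rule countable_subset[rotated]) (auto simp: P_def)
    ultimately have "(\<Union>x\<in>P. {x}) \<in> null_sets \<mu>" by (intro null_sets_UN')
    then have "P \<union> (S1 - N0) \<in> null_sets \<mu>" using null_sets.Un[OF _ outside, of P] by simp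
    then have "atomic \<mu>" unfolding atomic_def
    proof (rule AE_I')
      show "{x \<in> space \<mu>. \<not> 0 < emeasure \<mu> {x}} \<subseteq> P \<union> (S1 - N0)"
        by (auto simp: P_def D(3))
    qed
    with outside \<delta> show ?thesis by (simp add: supported_on_def N0)
  qed
qed

text \<open>For \<open>\<delta> \<ge> 1\<close> the comparison is made with the Lebesgue measure restricted to the complement of
  \<open>\<Lambda>\<close>. It charges every arc centred on \<open>\<Lambda>\<close> but not \<open>\<Lambda>\<close> itself.\<close>

lemma exceptional_exponent:
  assumes L: "exceptional_minimal_set G \<Lambda>" and star: "property_lambda_star \<rho> G \<Lambda>"
    and c: "conformal_exp \<rho> G \<delta> \<mu>" and supp: "supported_on \<mu> \<Lambda>"
    and nc: "not_charging \<mu> (orbit_set G (\<Lambda> \<inter> NE \<rho> G))"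
  shows "0 < \<delta>" "\<delta> < 1"
proof -
  interpret minimal_set \<rho> G \<Lambda> by (rule minimal_set_exceptional[OF L star])
  have \<mu>: "prob_space \<mu>" "finite_conformal \<delta> \<mu>" using c by (auto simp: conformal_exp_iff)
  note D = finite_conformalD[OF \<mu>(2)]
  interpret prob_space \<mu> by (rule \<mu>)
  have null: "measure \<mu> (S1 - (\<Lambda> - N0)) = 0" using null_outside[OF D(2) supp] nc by (simp add: N0_def)
  have one: "measure \<mu> S1 = 1" using prob_space D(3) by simp
  show "0 < \<delta>" using conformal_exponent_pos[OF \<mu>(2) null] one by simp
  show "\<delta> < 1"
  proof (rule ccontr)
    assume "\<not> \<delta> < 1"
    then have "1 \<le> \<delta>" by simp
    have SL: "S1 - \<Lambda> \<in> sets circle_borel" using S1_sets M_sets by blast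
    have "invariant_set G \<Lambda>" using M_S1 M_inv by (simp add: invariant_set_def)
    then have inv: "invariant_set G (S1 - \<Lambda>)" by (rule invariant_set_complement)
    obtain \<nu> where \<nu>: "finite_conformal 1 \<nu>"
      "\<And>B. B \<in> sets circle_borel \<Longrightarrow> emeasure \<nu> B = emeasure Leb ((S1 - \<Lambda>) \<inter> B)"
      using finite_conformal_restrict[OF Leb_conformal SL inv] by blast
    have m: "measure \<nu> B = measure Leb ((S1 - \<Lambda>) \<inter> B)" if "B \<in> sets circle_borel" for B
      using \<nu>(2)[OF that] by (simp add: measure_def)
    have "charges_arcs \<nu>"
      unfolding charges_arcs_def
    proof (intro allI impI)
      fix y \<eta> :: real assume y: "cis y \<in> \<Lambda>" and \<eta>: "\<eta> > 0"
      obtain W where W: "open W" "arc_ball y \<eta> = W \<inter> S1" by (rule arc_open) (rule that)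
      obtain x where x: "x \<in> arc_ball y \<eta>" "x \<notin> \<Lambda>"
        using exceptional_no_arc[OF L star y \<eta>] by blast
      have eq: "(S1 - \<Lambda>) \<inter> arc_ball y \<eta> = (W - \<Lambda>) \<inter> S1" unfolding W(2) by blast
      have "open (W - \<Lambda>)" using W(1) M_closed by (rule open_Diff)
      moreover have "x \<in> (W - \<Lambda>) \<inter> S1" using x W(2) by blast
      ultimately have "measure Leb ((W - \<Lambda>) \<inter> S1) > 0" by (rule Leb_open_pos)
      then show "measure \<nu> (arc_ball y \<eta>) > 0" by (simp add: m eq)
    qed
    from conformal_comparison[OF \<mu>(2) null \<nu>(1) this \<open>1 \<le> \<delta>\<close>]
    obtain C where "C > 0" and C: "\<And>\<epsilon> A. 0 < \<epsilon> \<Longrightarrow> \<epsilon> \<le> 1 \<Longrightarrow> A \<in> sets circle_borel \<Longrightarrow>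
        measure \<mu> A \<le> C * \<epsilon> powr (\<delta> - 1) * measure \<nu> A" by metis
    have "(S1 - \<Lambda>) \<inter> \<Lambda> = {}" by blast
    then have "measure \<nu> \<Lambda> = 0" using m[OF M_sets] by simp
    then have "measure \<mu> \<Lambda> \<le> 0" using C[of 1 \<Lambda>] M_sets by simp
    moreover have "measure \<mu> \<Lambda> = measure \<mu> S1"
    proof -
      have "S1 - (S1 - \<Lambda>) = \<Lambda>" using M_S1 by blast
      then show ?thesis using measure_Diff_null_set[of S1 \<mu> "S1 - \<Lambda>"] supp S1_sets D(2)
        by (simp add: supported_on_def)
    qed
    ultimately show False using one by simp
  qed
qed

end

theorem theorem6:
  fixes \<rho> :: "complex \<Rightarrow> real" and G :: "(complex \<Rightarrow> complex) set"
  assumes "riemannian_metric \<rho>" and "fg_C2_group G"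
  shows
    "(acts_minimally G \<and> property_star \<rho> G \<longrightarrow>
        (conformal \<rho> G (circle_lebesgue \<rho>) \<and>
         not_charging (circle_lebesgue \<rho>) (orbit_set G (NE \<rho> G)) \<and>
         (\<forall>\<mu>. conformal \<rho> G \<mu> \<and> not_charging \<mu> (orbit_set G (NE \<rho> G)) \<longrightarrow>
               \<mu> = circle_lebesgue \<rho>)) \<and>
        (\<forall>\<mu> \<delta>. conformal_exp \<rho> G \<delta> \<mu> \<and> \<mu> \<noteq> circle_lebesgue \<rho> \<longrightarrow>
               atomic \<mu> \<and> supported_on \<mu> (orbit_set G (NE \<rho> G)) \<and> \<delta> > 1))
     \<and>
     (\<forall>\<Lambda>. exceptional_minimal_set G \<Lambda> \<and> property_lambda_star \<rho> G \<Lambda> \<longrightarrow>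
        (\<forall>\<mu> \<nu>.
           conformal \<rho> G \<mu> \<and> supported_on \<mu> \<Lambda> \<and> not_charging \<mu> (orbit_set G (\<Lambda> \<inter> NE \<rho> G)) \<and>
           conformal \<rho> G \<nu> \<and> supported_on \<nu> \<Lambda> \<and> not_charging \<nu> (orbit_set G (\<Lambda> \<inter> NE \<rho> G)) \<longrightarrow>
           \<mu> = \<nu>) \<and>
        (\<forall>\<mu> \<delta>.
           conformal_exp \<rho> G \<delta> \<mu> \<and> supported_on \<mu> \<Lambda> \<and>
           not_charging \<mu> (orbit_set G (\<Lambda> \<inter> NE \<rho> G)) \<longrightarrow>
           \<delta> \<in> {0<..<1}))
     \<and>
     (acts_minimally G \<and> property_star \<rho> G \<longrightarrow>
        (\<forall>\<mu>. conformal \<rho> G \<mu> \<and> supported_on \<mu> S1 \<and> nonatomic \<mu> \<longrightarrow> ergodic G \<mu>))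
     \<and>
     (\<forall>\<Lambda>. exceptional_minimal_set G \<Lambda> \<and> property_lambda_star \<rho> G \<Lambda> \<longrightarrow>
        (\<forall>\<mu>. conformal \<rho> G \<mu> \<and> supported_on \<mu> \<Lambda> \<and> nonatomic \<mu> \<longrightarrow> ergodic G \<mu>))"
proof -
  interpret circle_group \<rho> G using assms by unfold_locales
  have lambda: "\<mu> = \<nu>" if "exceptional_minimal_set G \<Lambda>" "property_lambda_star \<rho> G \<Lambda>"
    "conformal \<rho> G \<mu>" "supported_on \<mu> \<Lambda>" "not_charging \<mu> (orbit_set G (\<Lambda> \<inter> NE \<rho> G))"
    "conformal \<rho> G \<nu>" "supported_on \<nu> \<Lambda>" "not_charging \<nu> (orbit_set G (\<Lambda> \<inter> NE \<rho> G))" for \<Lambda> \<mu> \<nu>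
  proof -
    interpret minimal_set \<rho> G \<Lambda> by (rule minimal_set_exceptional[OF that(1,2)])
    show ?thesis using not_charging_unique[OF that(3,4) _ that(6,7)] that(5,8) by (simp add: N0_def)
  qed
  have erg1: "ergodic G \<mu>" if "acts_minimally G" "property_star \<rho> G"
    "conformal \<rho> G \<mu>" "supported_on \<mu> S1" "nonatomic \<mu>" for \<mu>
    using minimal_set.nonatomic_conformal_ergodic[OF minimal_set_S1[OF that(1,2)] that(3-5)] .
  have erg2: "ergodic G \<mu>" if "exceptional_minimal_set G \<Lambda>" "property_lambda_star \<rho> G \<Lambda>"
    "conformal \<rho> G \<mu>" "supported_on \<mu> \<Lambda>" "nonatomic \<mu>" for \<Lambda> \<mu>
    using minimal_set.nonatomic_conformal_ergodic[OF minimal_set_exceptional[OF that(1,2)] that(3-5)] .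
  show ?thesis
  proof (intro conjI allI impI)
    assume "acts_minimally G \<and> property_star \<rho> G"
    note m = minimal_case[OF conjunct1[OF this] conjunct2[OF this]]
    show "conformal \<rho> G Leb" "not_charging Leb (orbit_set G (NE \<rho> G))" by (rule m(1), rule m(2))
    show "\<mu> = Leb" if "conformal \<rho> G \<mu> \<and> not_charging \<mu> (orbit_set G (NE \<rho> G))" for \<mu>
      using m(3) that by blast
    show "atomic \<mu>" "supported_on \<mu> (orbit_set G (NE \<rho> G))" "\<delta> > 1"
      if "conformal_exp \<rho> G \<delta> \<mu> \<and> \<mu> \<noteq> Leb" for \<mu> \<delta>
      using m(4) that by blast+
  next
    fix \<Lambda> \<mu> \<nu>
    assume "exceptional_minimal_set G \<Lambda> \<and> property_lambda_star \<rho> G \<Lambda>"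
      "conformal \<rho> G \<mu> \<and> supported_on \<mu> \<Lambda> \<and> not_charging \<mu> (orbit_set G (\<Lambda> \<inter> NE \<rho> G)) \<and>
       conformal \<rho> G \<nu> \<and> supported_on \<nu> \<Lambda> \<and> not_charging \<nu> (orbit_set G (\<Lambda> \<inter> NE \<rho> G))"
    then show "\<mu> = \<nu>" by (elim conjE) (rule lambda)
  next
    fix \<Lambda> \<mu> \<delta>
    assume "exceptional_minimal_set G \<Lambda> \<and> property_lambda_star \<rho> G \<Lambda>"
      "conformal_exp \<rho> G \<delta> \<mu> \<and> supported_on \<mu> \<Lambda> \<and> not_charging \<mu> (orbit_set G (\<Lambda> \<inter> NE \<rho> G))"
    then have "0 < \<delta>" "\<delta> < 1" using exceptional_exponent[of \<Lambda> \<delta> \<mu>] by blast+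
    then show "\<delta> \<in> {0<..<1}" by simp
  next
    fix \<mu>
    assume "acts_minimally G \<and> property_star \<rho> G" "conformal \<rho> G \<mu> \<and> supported_on \<mu> S1 \<and> nonatomic \<mu>"
    then show "ergodic G \<mu>" by (elim conjE) (rule erg1)
  next
    fix \<Lambda> \<mu>
    assume "exceptional_minimal_set G \<Lambda> \<and> property_lambda_star \<rho> G \<Lambda>"
      "conformal \<rho> G \<mu> \<and> supported_on \<mu> \<Lambda> \<and> nonatomic \<mu>"
    then show "ergodic G \<mu>" by (elim conjE) (rule erg2)
  qed
qed

end
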